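(* There exists a compact line $K$ of weight $\aleph_1$ with the following properties. (1) $C(K)$ has the continuous separable complementation property, and even the controlled separable complementation property. (2) For every $n\in\omega$, $C(K)$ fails to have the continuous $n$-SCP. In other words, whenever $\mathcal F$ is a continuous chain of separable subspaces of $C(K)$ with $C(K)=\bigcup\mathcal F$, one can find $\{X_n\}_{n\in\omega}\subseteq\mathcal F$ such that for each $n\in\omega$ the space $X_n$ is not $n$-complemented in $C(K)$.
   Context: A compact line is a linearly ordered space that is compact in its order topology. Projections are bounded linear idempotent operators; a closed subspace is complemented in $E$ if it is the range of a projection on $E$, and $k$-complemented if it is the range of a projection of norm at most $k$. For a Banach space $E$, $\operatorname{Sep}(E)$ is the set of closed separable linear subspaces ordered by inclusion; every sequence $(S_n)$ in it has supremum $\overline{\operatorname{span}\bigcup_n S_n}$. A subset $\mathcal F\subseteq\operatorname{Sep}(E)$ is closed cofinal if every $S\in\operatorname{Sep}(E)$ is contained in some $F\in\mathcal F$ and, whenever $F_1\subseteq F_2\subseteq\cdots$ are from $\mathcal F$, their supremum belongs to $\mathcal F$. $E$ has the continuous separable complementation property (continuous SCP) if there is a closed cofinal $\mathcal F\subseteq\operatorname{Sep}(E)$ formed by complemented subspaces, and the continuous $k$-SCP if there is such an $\mathcal F$ whose elements are all $k$-complemented. $E$ has the controlled SCP if for all countable $S\subseteq E$, $T\subseteq E^*$ there is a projection $P$ on $E$ with $\operatorname{im}P$ separable, $S\subseteq\operatorname{im}P$ and $T\subseteq\operatorname{im}P^*$. A continuous chain of separable subspaces is a family of closed separable subspaces linearly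 ordered by inclusion and containing the supremum (closure of the union) of each increasing sequence of its members. *)

theory Defs
  imports "HOL-Analysis.Analysis" "HOL-Probability.Discrete_Topology"
begin

unbundle cardinal_syntax

section \<open>Compact lines and their weight\<close>

text \<open>
  A linear order is given by its carrier \<open>K\<close> and its reflexive order relation \<open>r\<close>.
  The carrier itself is put among the generators because the open rays of a singleton
  do not cover it.
\<close>

definition order_topology_on :: "'a set \<Rightarrow> 'a rel \<Rightarrow> 'a topology" where
  "order_topology_on K r = topology_generated_by
     (insert K ({{x \<in> K. (x, a) \<in> r \<and> x \<noteq> a} | a. a \<in> K} \<union>
                {{x \<in> K. (a, x) \<in> r \<and> x \<noteq> a} | a. a \<in> K}))"

definition compact_line :: "'a set \<Rightarrow> 'a rel \<Rightarrow> bool" where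
  "compact_line K r \<longleftrightarrow> linear_order_on K r \<and> compact_space (order_topology_on K r)"

text \<open>
  A compact line of infinite weight \<open>\<kappa>\<close> has at most \<open>2\<^sup>\<kappa>\<close> points. For weight \<open>\<aleph>\<^sub>1\<close>,
  which is at most the size of the continuum, it is therefore no restriction, up to order
  isomorphism, to take the points in the type \<^typ>\<open>nat set set\<close>.
\<close>

definition topology_base :: "'a topology \<Rightarrow> 'a set set \<Rightarrow> bool" where
  "topology_base X \<B> \<longleftrightarrow> (\<forall>V\<in>\<B>. openin X V) \<and>
     (\<forall>U x. openin X U \<and> x \<in> U \<longrightarrow> (\<exists>V\<in>\<B>. x \<in> V \<and> V \<subseteq> U))"

definition has_weight :: "'a topology \<Rightarrow> 'k rel \<Rightarrow> bool" where
  "has_weight X \<kappa> \<longleftrightarrow>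
     (\<exists>\<B>. topology_base X \<B> \<and> |\<B>| =o \<kappa>) \<and>
     (\<forall>\<B>. topology_base X \<B> \<longrightarrow> \<kappa> \<le>o |\<B>| )"

section \<open>The Banach space of continuous functions on a compact space\<close>

text \<open>
  Since the underlying set of \<open>X\<close> is a carrier set and not a type, \<open>C(X)\<close> is represented as the
  closed subspace of the Banach space of bounded functions (with the supremum norm) on the whole
  type, taken with the discrete topology, that consists of those functions which are continuous
  on \<open>X\<close> and vanish off its carrier. For compact \<open>X\<close> restriction to the carrier is an isometric
  isomorphism onto all continuous real functions on \<open>X\<close> with the supremum norm; see the lemmas
  below.
\<close>

definition cfun_space :: "'a topology \<Rightarrow> ('a discrete \<Rightarrow>\<^sub>C real) set" where
  "cfun_space X = {f. continuous_map X euclideanreal (\<lambda>x. apply_bcontfun f (discrete x)) \<and>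
                      (\<forall>x. x \<notin> topspace X \<longrightarrow> apply_bcontfun f (discrete x) = 0)}"

lemma topspace_order_topology_on [simp]: "topspace (order_topology_on K r) = K"
  unfolding order_topology_on_def topology_generated_by_topspace by auto

lemma subspace_cfun_space: "subspace (cfun_space X)"
  unfolding cfun_space_def subspace_def
  by (auto intro!: continuous_map_add continuous_map_real_mult_left)

lemma closed_cfun_space: "closed (cfun_space X)"
proof -
  have "l \<in> cfun_space X" if f: "\<forall>n. f n \<in> cfun_space X" and lim: "f \<longlonglongrightarrow> l" for f l
  proof -
    have d: "(\<lambda>n. dist (f n) l) \<longlonglongrightarrow> 0"
      using lim tendsto_dist_iff by blast
    have unif: "\<forall>\<^sub>F n in sequentially. \<forall>x.
        dist (apply_bcontfun (f n) (discrete x)) (apply_bcontfun l (discrete x)) < e"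
      if "e > 0" for e
      using order_tendstoD(2)[OF d that]
      by eventually_elim (auto intro: dist_fun_lt_imp_dist_val_lt)
    have "continuous_map X Met_TC.mtopology (\<lambda>x. apply_bcontfun l (discrete x))"
      by (rule Met_TC.continuous_map_uniform_limit
            [where F = sequentially and f = "\<lambda>n x. apply_bcontfun (f n) (discrete x)"])
         (use f in \<open>auto simp: cfun_space_def intro!: eventually_mono[OF unif]\<close>)
    then have "continuous_map X euclideanreal (\<lambda>x. apply_bcontfun l (discrete x))"
      by simp
    moreover have "apply_bcontfun l (discrete x) = 0" if "x \<notin> topspace X" for x
    proof (rule ccontr)
      assume nz: "apply_bcontfun l (discrete x) \<noteq> 0"
      obtain n where "dist (apply_bcontfun (f n) (discrete x)) (apply_bcontfun l (discrete x))
                        < \<bar>apply_bcontfun l (discrete x)\<bar>"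
        using unif[of "\<bar>apply_bcontfun l (discrete x)\<bar>"] nz
          eventually_happens'[OF sequentially_bot] by force
      then show False
        using f that by (auto simp: cfun_space_def dist_real_def)
    qed
    ultimately show ?thesis by (simp add: cfun_space_def)
  qed
  then show ?thesis unfolding closed_sequential_limits by blast
qed

lemma norm_cfun_space:
  assumes f: "f \<in> cfun_space X" and ne: "topspace X \<noteq> {}"
  shows "norm f = (SUP x\<in>topspace X. \<bar>apply_bcontfun f (discrete x)\<bar>)"
proof (rule antisym)
  have bdd: "bdd_above ((\<lambda>x. \<bar>apply_bcontfun f (discrete x)\<bar>) ` topspace X)"
    using norm_bounded[of f] by (auto intro!: bdd_aboveI2)
  have nn: "0 \<le> (SUP x\<in>topspace X. \<bar>apply_bcontfun f (discrete x)\<bar>)"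
    using ne bdd by (meson abs_ge_zero cSUP_upper2 ex_in_conv)
  show "norm f \<le> (SUP x\<in>topspace X. \<bar>apply_bcontfun f (discrete x)\<bar>)"
  proof (rule norm_bound)
    fix y :: "'a discrete"
    obtain x where y: "y = discrete x" by (metis of_discrete_inverse)
    show "norm (apply_bcontfun f y) \<le> (SUP x\<in>topspace X. \<bar>apply_bcontfun f (discrete x)\<bar>)"
    proof (cases "x \<in> topspace X")
      case True
      then show ?thesis using bdd y by (auto intro: cSUP_upper)
    next
      case False
      then show ?thesis using f y nn by (auto simp: cfun_space_def)
    qed
  qed
  show "(SUP x\<in>topspace X. \<bar>apply_bcontfun f (discrete x)\<bar>) \<le> norm f"
    using ne norm_bounded[of f] by (auto intro!: cSUP_least)
qed

lemma cfun_space_surj: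
  assumes X: "compact_space X" and g: "continuous_map X euclideanreal g"
  shows "\<exists>f\<in>cfun_space X. \<forall>x\<in>topspace X. apply_bcontfun f (discrete x) = g x"
proof -
  define h where "h = (\<lambda>y. if of_discrete y \<in> topspace X then g (of_discrete y) else 0)"
  have "compact (g ` topspace X)"
    using image_compactin[OF _ g] X by (auto simp: compact_space_def)
  then have "bounded (insert 0 (g ` topspace X))"
    by (simp add: compact_imp_bounded)
  then have "bounded (range h)"
    by (rule bounded_subset) (auto simp: h_def)
  moreover have "continuous_on UNIV h"
    by (auto simp: continuous_on_open_vimage open_discrete)
  ultimately have h: "apply_bcontfun (Bcontfun h) = h"
    by (intro Bcontfun_inverse) (simp add: bcontfun_def)
  have "continuous_map X euclideanreal (\<lambda>x. apply_bcontfun (Bcontfun h) (discrete x))"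
    by (rule continuous_map_eq[OF g]) (simp add: h, simp add: h_def discrete_inverse)
  then have "Bcontfun h \<in> cfun_space X"
    by (simp add: cfun_space_def h) (simp add: h_def discrete_inverse)
  then show ?thesis
    by (rule bexI[rotated]) (simp add: h, simp add: h_def discrete_inverse)
qed

section \<open>Operators on a closed subspace of a Banach space\<close>

text \<open>
  In what follows a Banach space is a closed linear subspace \<open>E\<close> of a type of class
  \<^class>\<open>banach\<close>. Operators and functionals on \<open>E\<close> are functions on the ambient type of
  which only the values on \<open>E\<close> matter; the elements of the dual are normalised to be
  \<^const>\<open>undefined\<close> outside \<open>E\<close>. For \<open>k \<ge> 0\<close> the inequality in \<open>k_complemented_in\<close> says that
  the operator norm of \<open>P\<close> on \<open>E\<close> is at most \<open>k\<close>.
\<close>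

definition bounded_linear_on ::
    "'b::real_normed_vector set \<Rightarrow> ('b \<Rightarrow> 'c::real_normed_vector) \<Rightarrow> bool" where
  "bounded_linear_on E f \<longleftrightarrow>
     (\<forall>x\<in>E. \<forall>y\<in>E. f (x + y) = f x + f y) \<and>
     (\<forall>c. \<forall>x\<in>E. f (c *\<^sub>R x) = c *\<^sub>R f x) \<and>
     (\<exists>B. \<forall>x\<in>E. norm (f x) \<le> B * norm x)"

definition projection_on :: "'b::real_normed_vector set \<Rightarrow> ('b \<Rightarrow> 'b) \<Rightarrow> bool" where
  "projection_on E P \<longleftrightarrow> P ` E \<subseteq> E \<and> bounded_linear_on E P \<and> (\<forall>x\<in>E. P (P x) = P x)"

definition complemented_in :: "'b::real_normed_vector set \<Rightarrow> 'b set \<Rightarrow> bool" where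
  "complemented_in E X \<longleftrightarrow> (\<exists>P. projection_on E P \<and> P ` E = X)"

definition k_complemented_in :: "real \<Rightarrow> 'b::real_normed_vector set \<Rightarrow> 'b set \<Rightarrow> bool" where
  "k_complemented_in k E X \<longleftrightarrow>
     (\<exists>P. projection_on E P \<and> (\<forall>x\<in>E. norm (P x) \<le> k * norm x) \<and> P ` E = X)"

definition dual_on :: "'b::real_normed_vector set \<Rightarrow> ('b \<Rightarrow> real) set" where
  "dual_on E = {f \<in> extensional E. bounded_linear_on E f}"

definition adjoint_on ::
    "'b::real_normed_vector set \<Rightarrow> ('b \<Rightarrow> 'b) \<Rightarrow> ('b \<Rightarrow> real) \<Rightarrow> ('b \<Rightarrow> real)" where
  "adjoint_on E P g = compose E g P"

section \<open>Separable complementation properties\<close>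

definition Sep :: "'b::real_normed_vector set \<Rightarrow> 'b set set" where
  "Sep E = {S. S \<subseteq> E \<and> subspace S \<and> closed S \<and> separable_space (top_of_set S)}"

definition closed_cofinal :: "'b::real_normed_vector set \<Rightarrow> 'b set set \<Rightarrow> bool" where
  "closed_cofinal E \<F> \<longleftrightarrow> \<F> \<subseteq> Sep E \<and> (\<forall>S\<in>Sep E. \<exists>F\<in>\<F>. S \<subseteq> F) \<and>
     (\<forall>F::nat \<Rightarrow> 'b set. range F \<subseteq> \<F> \<and> incseq F \<longrightarrow> closure (span (\<Union>n. F n)) \<in> \<F>)"

definition continuous_SCP :: "'b::real_normed_vector set \<Rightarrow> bool" where
  "continuous_SCP E \<longleftrightarrow> (\<exists>\<F>. closed_cofinal E \<F> \<and> (\<forall>F\<in>\<F>. complemented_in E F))"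

definition continuous_k_SCP :: "real \<Rightarrow> 'b::real_normed_vector set \<Rightarrow> bool" where
  "continuous_k_SCP k E \<longleftrightarrow> (\<exists>\<F>. closed_cofinal E \<F> \<and> (\<forall>F\<in>\<F>. k_complemented_in k E F))"

definition controlled_SCP :: "'b::real_normed_vector set \<Rightarrow> bool" where
  "controlled_SCP E \<longleftrightarrow>
     (\<forall>S T. countable S \<and> S \<subseteq> E \<and> countable T \<and> T \<subseteq> dual_on E \<longrightarrow>
        (\<exists>P. projection_on E P \<and> separable_space (top_of_set (P ` E)) \<and>
             S \<subseteq> P ` E \<and> T \<subseteq> adjoint_on E P ` dual_on E))"

definition continuous_chain :: "'b::real_normed_vector set \<Rightarrow> 'b set set \<Rightarrow> bool" where
  "continuous_chain E \<F> \<longleftrightarrow> \<F> \<subseteq> Sep E \<and> (\<forall>F\<in>\<F>. \<forall>G\<in>\<F>. F \<subseteq> G \<or> G \<subseteq> F) \<and>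
     (\<forall>F::nat \<Rightarrow> 'b set. range F \<subseteq> \<F> \<and> incseq F \<longrightarrow> closure (\<Union>n. F n) \<in> \<F>)"

end

theory Submission
  imports Defs "HOL-Library.Countable_Set_Type"
begin

text \<open>
  For a linear order \<open>L\<close>, the initial segments of \<open>L\<close> form a compact line \<open>K\<close>, and \<open>C(K)\<close> is
  generated by the constants and the indicators \<open>e\<^sub>x\<close> of \<open>{I. x \<in> I}\<close>. A countable \<open>Y \<subseteq> L\<close> generates a
  separable subspace \<open>C\<^sub>Y\<close>, and what matters for its complementation is which cuts of \<open>Y\<close> are filled
  in \<open>L\<close>: a projection onto \<open>C\<^sub>Y\<close> must have large norm if passing from a set of filled cuts to
  those which are limits of the set from both sides can be iterated many times.

  Here \<open>L\<close> consists of the finite sequences of countable ordinals in lexicographic order, together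
  with, for each countable limit ordinal \<open>d\<close>, countably many infinite sequences that are cofinal in
  \<open>d\<close> and are obtained from a fixed ladder by at most \<open>rk d\<close> modifications. At stage \<open>d\<close> these are
  the only filled cuts that are limits of filled cuts from both sides, and the number of iterations is \<open>rk d\<close> up to
  a constant: pushing each of them up to the end of a short interval gives a projection of norm at
  most \<open>2 rk d + 3\<close>, while every projection has norm at least \<open>(rk d + 1) / 3 - 1\<close>. If \<open>rk\<close> takes
  each value on a stationary set, then each closed cofinal family contains stages of every rank.

  A functional on \<open>C(K)\<close> is eventually constant on \<open>e\<^sub>x\<close> along the successors of each finite sequence.
  Replacing the first entry that is at least \<open>e\<close> by \<open>e\<close> and deleting the rest is monotone, so it
  induces a projection of norm one, which for suitable \<open>e\<close> respects countably many functionals.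
\<close>

section \<open>The first uncountable ordinal\<close>

text \<open>Norm one is attained at many stages: \<open>range (push e)\<close> contains every branch
  cofinal in \<open>e\<close>, and its subspace is the image of a norm-one projection. These stages
  are not closed under suprema. If e_n increases strictly to \<open>d\<close>, the union of the sets
  \<open>range (push e_n)\<close> is \<open>below d\<close>, which misses \<open>branches d\<close>,
  and a closed cofinal family has to contain many such stages. The branches at \<open>d\<close>
  therefore decide which norms are possible there, and \<open>rk d\<close> meters them. It is
  finite, so every stage is complemented; it is unbounded on every club, so no single bound serves a
  closed cofinal family. The number of modifications works in both directions. A branch with fewer
  than \<open>rk d\<close> of them has branches with one more arbitrarily close on either side, so
  signed residues can be piled up for \<open>rk d + 1\<close> rounds. Conversely, the branches at
  which pushing up disagrees with one fixed cut all have different numbers of modifications, so at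
  most \<open>rk d + 1\<close> corrections are needed at that cut.\<close>

typedef omega1 = "Field (cardSuc natLeq) :: nat set set"
  using Field_cardSuc_not_empty[OF natLeq_Card_order] by blast

instantiation omega1 :: linorder
begin

definition less_eq_omega1 :: "omega1 \<Rightarrow> omega1 \<Rightarrow> bool"
  where "a \<le> b \<longleftrightarrow> (Rep_omega1 a, Rep_omega1 b) \<in> cardSuc natLeq"

definition less_omega1 :: "omega1 \<Rightarrow> omega1 \<Rightarrow> bool"
  where "a < b \<longleftrightarrow> a \<le> b \<and> \<not> b \<le> (a :: omega1)"

instance
proof
  have wo: "Well_order (cardSuc natLeq)"
    using cardSuc_Well_order[OF natLeq_Card_order] .
  then have refl: "refl_on (Field (cardSuc natLeq)) (cardSuc natLeq)"
    and trans: "trans (cardSuc natLeq)" and anti: "antisym (cardSuc natLeq)"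
    and total: "total_on (Field (cardSuc natLeq)) (cardSuc natLeq)"
    unfolding order_on_defs well_order_on_def by auto
  fix x y z :: omega1
  show "(x < y) = (x \<le> y \<and> \<not> y \<le> x)" by (rule less_omega1_def)
  have xx: "x \<le> x" for x :: omega1
    using refl Rep_omega1 by (auto simp: less_eq_omega1_def refl_on_def)
  then show "x \<le> x" .
  show "x \<le> y \<Longrightarrow> y \<le> z \<Longrightarrow> x \<le> z"
    using trans by (auto simp: less_eq_omega1_def elim: transE)
  show "x \<le> y \<Longrightarrow> y \<le> x \<Longrightarrow> x = y"
    using anti by (auto simp: less_eq_omega1_def Rep_omega1_inject dest: antisymD)
  show "x \<le> y \<or> y \<le> x"
    using total Rep_omega1[of x] Rep_omega1[of y] xx
    by (auto simp: less_eq_omega1_def total_on_def) (metis Rep_omega1_inject)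
qed

end

instance omega1 :: wellorder
proof
  fix P :: "omega1 \<Rightarrow> bool" and a
  assume step: "\<And>x. (\<And>y. y < x \<Longrightarrow> P y) \<Longrightarrow> P x"
  have wf: "wf (cardSuc natLeq - Id)"
    using cardSuc_Well_order[OF natLeq_Card_order] unfolding well_order_on_def by simp
  have "wf (inv_image (cardSuc natLeq - Id) Rep_omega1)"
    by (rule wf_inv_image[OF wf])
  then show "P a"
  proof (induction a rule: wf_induct_rule)
    case (less x)
    show ?case
    proof (rule step)
      fix y assume "y < x"
      then show "P y"
        by (intro less) (auto simp: less_eq_omega1_def less_omega1_def Rep_omega1_inject)
    qed
  qed
qed

lemma card_of_omega1: "|UNIV :: omega1 set| =o cardSuc natLeq"
proof -
  have "bij_betw Rep_omega1 UNIV (Field (cardSuc natLeq))"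
    by (metis Rep_omega1_inject inj_onI bij_betw_def type_definition.Rep_range
        type_definition_omega1)
  then have "|UNIV :: omega1 set| =o |Field (cardSuc natLeq)|"
    by (rule card_of_ordIsoI)
  then show ?thesis
    using card_of_Field_ordIso[OF cardSuc_Card_order[OF natLeq_Card_order]] ordIso_transitive
    by blast
qed

lemma countable_atMost_omega1: "countable {..a :: omega1}"
proof -
  let ?r = "cardSuc natLeq"
  have co: "Card_order ?r" by (rule cardSuc_Card_order[OF natLeq_Card_order])
  have "|underS ?r (Rep_omega1 a)| <o ?r"
    using card_of_underS[OF co Rep_omega1] .
  then have "|underS ?r (Rep_omega1 a)| \<le>o natLeq"
    using cardSuc_ordLeq_ordLess[OF natLeq_Card_order card_of_Card_order] by blast
  then have "countable (underS ?r (Rep_omega1 a))"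
    by (simp add: countable_card_le_natLeq)
  moreover have "Rep_omega1 ` {..<a} \<subseteq> underS ?r (Rep_omega1 a)"
    by (auto simp: underS_def less_omega1_def less_eq_omega1_def)
  ultimately have "countable (Rep_omega1 ` {..<a})"
    by (rule countable_subset[rotated])
  then have "countable {..<a}"
    by (rule countable_image_inj_on) (auto simp: inj_on_def Rep_omega1_inject)
  moreover have "{..a} = insert a {..<a}" by auto
  ultimately show ?thesis by simp
qed

lemma uncountable_omega1: "uncountable (UNIV :: omega1 set)"
proof
  assume "countable (UNIV :: omega1 set)"
  then have "|UNIV :: omega1 set| \<le>o natLeq"
    by (simp add: countable_card_le_natLeq)
  then have "cardSuc natLeq \<le>o natLeq"
    using card_of_omega1 ordIso_ordLeq_trans ordIso_symmetric by blast
  then show False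
    using cardSuc_greater[OF natLeq_Card_order] not_ordLess_ordLeq by blast
qed

lemma countable_bounded_omega1:
  assumes "countable (A :: omega1 set)"
  obtains b where "\<And>a. a \<in> A \<Longrightarrow> a < b"
proof -
  have "countable (\<Union>a\<in>A. {..a})"
    using assms countable_atMost_omega1 by blast
  then obtain b where "b \<notin> (\<Union>a\<in>A. {..a})"
    using uncountable_omega1 by (metis UNIV_eq_I)
  then show ?thesis
    by (intro that[of b]) (auto simp: not_le)
qed

lemma ex_greater_omega1: "\<exists>b. (a :: omega1) < b"
  using countable_bounded_omega1[of "{a}"] by auto

section \<open>Successors, limits and suprema of countable ordinals\<close>

definition zero1 :: omega1 where "zero1 = (LEAST a. True)"

definition suc1 :: "omega1 \<Rightarrow> omega1" where "suc1 a = (LEAST b. a < b)"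

definition limit1 :: "omega1 \<Rightarrow> bool" where
  "limit1 d \<longleftrightarrow> zero1 < d \<and> (\<forall>a<d. suc1 a < d)"

lemma zero1_le [simp]: "zero1 \<le> a"
  unfolding zero1_def by (rule Least_le) simp

lemma less_suc1 [simp]: "a < suc1 a"
  unfolding suc1_def using ex_greater_omega1 by (rule LeastI_ex)

lemma suc1_le_iff [simp]: "suc1 a \<le> b \<longleftrightarrow> a < b"
proof
  show "suc1 a \<le> b \<Longrightarrow> a < b" using less_suc1[of a] by order
  show "a < b \<Longrightarrow> suc1 a \<le> b" unfolding suc1_def by (rule Least_le)
qed

lemma less_suc1_iff [simp]: "a < suc1 b \<longleftrightarrow> a \<le> b"
  by (metis linorder_not_le suc1_le_iff)

definition lub1 :: "omega1 set \<Rightarrow> omega1" where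
  "lub1 A = (LEAST b. \<forall>a\<in>A. a \<le> b)"

lemma lub1_upper: "countable A \<Longrightarrow> a \<in> A \<Longrightarrow> a \<le> lub1 A"
proof -
  assume A: "countable A" "a \<in> A"
  obtain b where "\<forall>a\<in>A. a \<le> b"
    using countable_bounded_omega1[OF A(1)] less_imp_le by metis
  then have "\<forall>a\<in>A. a \<le> lub1 A" unfolding lub1_def by (rule LeastI)
  then show ?thesis using A by blast
qed

lemma less_lub1:
  assumes "c < lub1 A"
  shows "\<exists>a\<in>A. c < a"
  using not_less_Least[OF assms[unfolded lub1_def]] by (auto simp: not_le)

lemma limit1_lub1_strict_mono:
  fixes f :: "nat \<Rightarrow> omega1"
  assumes f: "\<And>n. f n < f (Suc n)"
  shows "limit1 (lub1 (range f))" "f n < lub1 (range f)"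
proof -
  have up: "f n \<le> lub1 (range f)" for n by (rule lub1_upper) auto
  show lt: "f n < lub1 (range f)" for n
    using f[of n] up[of "Suc n"] by order
  have "suc1 a < lub1 (range f)" if a: "a < lub1 (range f)" for a
    using less_lub1[OF a] lt by (metis image_iff order_le_less_trans suc1_le_iff)
  moreover have "zero1 < lub1 (range f)"
    using lt[of 0] zero1_le[of "f 0"] by order
  ultimately show "limit1 (lub1 (range f))" by (simp add: limit1_def)
qed

lemma limit1_cofinal_sequence:
  assumes d: "limit1 d" and C: "\<And>a. a < d \<Longrightarrow> \<exists>c\<in>C. a < c \<and> c < d"
  obtains f :: "nat \<Rightarrow> omega1"
  where "\<And>n. f n \<in> C" "\<And>n. f n < f (Suc n)" "\<And>n. f n < d" "\<And>a. a < d \<Longrightarrow> \<exists>n. a < f n"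
proof -
  have "{..<d} \<noteq> {}" using d by (auto simp: limit1_def)
  moreover have "countable {..<d}"
    by (rule countable_subset[OF _ countable_atMost_omega1[of d]]) auto
  ultimately obtain e :: "nat \<Rightarrow> omega1" where e: "range e = {..<d}"
    by (metis range_from_nat_into)
  obtain h where h: "\<And>a. a < d \<Longrightarrow> h a \<in> C \<and> a < h a \<and> h a < d"
    using C by metis
  \<comment> \<open>The maximum with \<open>e n\<close> forces the sequence past every point of the
    enumeration \<open>e\<close> of the ordinals below \<open>d\<close>, which gives cofinality; the
    maximum with \<open>c\<close> gives strict growth.\<close>
  define f where "f = rec_nat (h (e 0)) (\<lambda>n c. h (max c (e n)))"
  have f0: "f 0 = h (e 0)" and fS: "f (Suc n) = h (max (f n) (e n))" for n
    by (simp_all add: f_def)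
  have ed: "e n < d" for n using e by auto
  have fd: "f n \<in> C \<and> f n < d" for n
    by (induction n) (use h ed f0 fS in auto)
  have m: "max (f n) (e n) < d" for n using fd[of n] ed[of n] by simp
  have step: "max (f n) (e n) < f (Suc n)" for n
    using h[OF m[of n]] fS[of n] by simp
  show ?thesis
  proof (rule that[of f])
    show "f n \<in> C" "f n < d" for n using fd by auto
    show "f n < f (Suc n)" for n using step[of n] by simp
    fix a assume "a < d"
    then obtain n where "a = e n" using e by auto
    then show "\<exists>n. a < f n" using step[of n] by (metis max_less_iff_conj)
  qed
qed

text \<open>\<open>F\<close> may fail to be monotone, so \<open>h c\<close> bounds \<open>F\<close>
  on the whole countable set \<open>{..c}\<close>; the supremum of the iterates of \<open>h\<close>
  then absorbs \<open>F\<close>.\<close>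

lemma ex_limit1_closed_under:
  obtains d where "limit1 d" "a < d" "\<And>c. c < d \<Longrightarrow> F c < (d :: omega1)"
proof -
  have "\<exists>b. c < b \<and> (\<forall>c'\<le>c. F c' < b)" for c
  proof -
    have "countable (insert c (F ` {..c}))" using countable_atMost_omega1 by auto
    then obtain b where "\<And>x. x \<in> insert c (F ` {..c}) \<Longrightarrow> x < b"
      using countable_bounded_omega1 by blast
    then show ?thesis by (intro exI[of _ b]) auto
  qed
  then obtain h where h: "\<And>c. c < h c" "\<And>c c'. c' \<le> c \<Longrightarrow> F c' < h c" by metis
  define f where "f = rec_nat a (\<lambda>_. h)"
  have f: "f 0 = a" "f (Suc n) = h (f n)" for n by (simp_all add: f_def)
  have mono: "f n < f (Suc n)" for n using h(1) f by simp
  note l = limit1_lub1_strict_mono[of f, OF mono]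
  show ?thesis
  proof (rule that[of "lub1 (range f)"])
    show "limit1 (lub1 (range f))" by (rule l)
    show "a < lub1 (range f)" using l(2)[of 0] f by simp
    fix c assume "c < lub1 (range f)"
    then obtain n where "c < f n" using less_lub1 by blast
    then have "F c < f (Suc n)" using h(2)[of c "f n"] f by simp
    then show "F c < lub1 (range f)" using l(2)[of "Suc n"] by order
  qed
qed

text \<open>The conjunct \<open>limit1 d\<close> excludes \<open>zero1\<close>, where the cofinality
  condition is vacuous.\<close>

definition club :: "omega1 set \<Rightarrow> bool" where
  "club C \<longleftrightarrow> (\<forall>a. \<exists>c\<in>C. a < c) \<and>
     (\<forall>d. limit1 d \<and> (\<forall>a<d. \<exists>c\<in>C. a < c \<and> c < d) \<longrightarrow> d \<in> C)"

definition stationary :: "omega1 set \<Rightarrow> bool" where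
  "stationary S \<longleftrightarrow> (\<forall>C. club C \<longrightarrow> S \<inter> C \<noteq> {})"

lemma club_greaterThan: "club {a<..}"
  unfolding club_def
proof (intro conjI allI impI)
  fix b
  obtain c where "max a b < c" using ex_greater_omega1 by blast
  then show "\<exists>c\<in>{a<..}. b < c" by auto
next
  fix d assume d: "limit1 d \<and> (\<forall>b<d. \<exists>c\<in>{a<..}. b < c \<and> c < d)"
  then obtain c where "c \<in> {a<..}" "c < d" unfolding limit1_def by blast
  then show "d \<in> {a<..}" by auto
qed

text \<open>Choose for every k a function that leads upwards into \<open>C k\<close>. A limit
  ordinal closed under all of them is a limit of points of every \<open>C k\<close>, hence belongs
  to each.\<close>

lemma club_Inter:
  assumes C: "\<And>k :: nat. club (C k)"
  shows "club (\<Inter>k. C k)"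
proof -
  have "\<exists>c. c \<in> (\<Inter>k. C k) \<and> a < c" for a
  proof -
    have "\<exists>c. c \<in> C k \<and> b < c" for k b using C[of k] unfolding club_def by blast
    then obtain g where g: "\<And>k b. g k b \<in> C k \<and> b < g k b" by metis
    obtain d where d: "limit1 d" "a < d" "\<And>b. b < d \<Longrightarrow> lub1 (range (\<lambda>k. g k b)) < d"
      using ex_limit1_closed_under[of a "\<lambda>b. lub1 (range (\<lambda>k. g k b))"] by blast
    have "g k b < d" if "b < d" for k b
      using lub1_upper[of "range (\<lambda>k. g k b)" "g k b"] d(3)[OF that] by auto
    then have "\<forall>b<d. \<exists>c\<in>C k. b < c \<and> c < d" for k
      using g[of k] by blast
    then have "d \<in> C k" for k
      using C[of k] d(1) unfolding club_def by simp
    then show ?thesis using d(2) by blast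
  qed
  moreover have "d \<in> C k" if "limit1 d" "\<forall>a<d. \<exists>c\<in>(\<Inter>k. C k). a < c \<and> c < d" for d k
  proof -
    have "\<forall>a<d. \<exists>c\<in>C k. a < c \<and> c < d" using that(2) by blast
    then show ?thesis using that(1) C[of k] unfolding club_def by simp
  qed
  ultimately show ?thesis unfolding club_def by (metis INT_iff)
qed

lemma club_Int: "club C \<Longrightarrow> club D \<Longrightarrow> club (C \<inter> D)"
proof -
  assume "club C" "club D"
  then have "club (\<Inter>k::nat. if k = 0 then C else D)" by (intro club_Inter) simp
  moreover have "(\<Inter>k::nat. if k = 0 then C else D) = C \<inter> D" by (auto split: if_splits)
  ultimately show ?thesis by simp
qed

text \<open>
  Points of \<^typ>\<open>omega1\<close> are coded by sets of natural numbers. If each digit of the code were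
  constant on the trace of a club on \<open>A\<close>, then one club would meet \<open>A\<close> in at most one point.
\<close>

lemma stationary_split:
  assumes A: "stationary A"
  obtains B where "B \<subseteq> A" "stationary B" "stationary (A - B)"
proof (rule ccontr)
  assume "\<not> thesis"
  then have no: "\<not> (stationary B \<and> stationary (A - B))" if "B \<subseteq> A" for B
    using that \<open>\<And>B. B \<subseteq> A \<Longrightarrow> stationary B \<Longrightarrow> stationary (A - B) \<Longrightarrow> thesis\<close> by blast
  define B where "B k = {a \<in> A. k \<in> Rep_omega1 a}" for k :: nat
  have "\<exists>C. club C \<and> (B k \<inter> C = {} \<or> (A - B k) \<inter> C = {})" for k
    using no[of "B k"] by (auto simp: stationary_def B_def)
  then obtain C where C: "\<And>k. club (C k)" "\<And>k. B k \<inter> C k = {} \<or> (A - B k) \<inter> C k = {}"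
    by metis
  define D where "D = (\<Inter>k. C k)"
  have D: "club D" unfolding D_def by (rule club_Inter[OF C(1)])
  obtain a where a: "a \<in> A" "a \<in> D" using A D unfolding stationary_def by blast
  obtain b where b: "b \<in> A" "b \<in> D" "a < b"
    using A club_Int[OF D club_greaterThan[of a]] unfolding stationary_def by blast
  have "k \<in> Rep_omega1 a \<longleftrightarrow> k \<in> Rep_omega1 b" for k
    using C(2)[of k] a b by (auto simp: B_def D_def)
  then have "a = b" by (metis Rep_omega1_inject set_eqI)
  then show False using b by simp
qed

lemma stationary_UNIV: "stationary UNIV"
  unfolding stationary_def club_def by blast

text \<open>Repeated splitting gives decreasing stationary sets \<open>A n\<close> whose successive
  differences are stationary; \<open>rk\<close> records where a point drops out.\<close>

lemma ex_rank_function: "\<exists>rk :: omega1 \<Rightarrow> nat. \<forall>n. stationary {d. rk d = n}"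
proof -
  have "\<exists>B. stationary A \<longrightarrow> B \<subseteq> A \<and> stationary B \<and> stationary (A - B)" for A
    using stationary_split[of A] by blast
  then obtain h where h: "\<And>A. stationary A \<Longrightarrow> h A \<subseteq> A \<and> stationary (h A) \<and> stationary (A - h A)"
    by metis
  define A where "A n = (h ^^ n) UNIV" for n :: nat
  have st: "stationary (A n)" for n
    by (induction n) (auto simp: A_def stationary_UNIV h)
  have sub: "A (Suc n) \<subseteq> A n" for n using h[OF st[of n]] by (simp add: A_def)
  have anti: "m \<le> n \<Longrightarrow> A n \<subseteq> A m" for m n
    by (rule lift_Suc_antimono_le[of A]) (use sub in auto)
  define rk where "rk d = (LEAST n. d \<notin> A (Suc n))" for d
  have "rk d = n" if "d \<in> A n" "d \<notin> A (Suc n)" for d n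
    unfolding rk_def
  proof (rule Least_equality)
    show "d \<notin> A (Suc n)" by (rule that(2))
    fix m assume "d \<notin> A (Suc m)"
    then show "n \<le> m" using that(1) anti[of "Suc m" n] by (meson not_less_eq_eq subsetD)
  qed
  \<comment> \<open>Only an inclusion: a point in all \<open>A n\<close> gets the unspecified
    \<open>LEAST\<close> of an unsatisfiable predicate. Stationarity passes to supersets.\<close>
  then have sup: "A n - A (Suc n) \<subseteq> {d. rk d = n}" for n by auto
  have "stationary (A n - A (Suc n))" for n using h[OF st[of n]] by (simp add: A_def)
  then have "stationary {d. rk d = n}" for n
    using sup[of n] unfolding stationary_def by blast
  then show ?thesis by blast
qed

section \<open>Bounded operators and separable spans\<close>

lemma subspace_closure:
  fixes S :: "'a::real_normed_vector set"
  assumes S: "subspace S"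
  shows "subspace (closure S)"
  unfolding subspace_def
proof (intro conjI ballI allI)
  show "0 \<in> closure S" using subspace_0[OF S] closure_subset by blast
  fix x assume "x \<in> closure S"
  then obtain f where f: "\<And>n. f n \<in> S" "f \<longlonglongrightarrow> x" unfolding closure_sequential by blast
  show "c *\<^sub>R x \<in> closure S" for c
    unfolding closure_sequential using f subspace_scale[OF S]
    by (intro exI[of _ "\<lambda>n. c *\<^sub>R f n"]) (auto intro: tendsto_intros)
  fix y assume "y \<in> closure S"
  then obtain h where h: "\<And>n. h n \<in> S" "h \<longlonglongrightarrow> y" unfolding closure_sequential by blast
  show "x + y \<in> closure S"
    unfolding closure_sequential using f h subspace_add[OF S]
    by (intro exI[of _ "\<lambda>n. f n + h n"]) (auto intro: tendsto_intros)
qed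

lemma bounded_linear_on_diff:
  assumes "subspace E" "bounded_linear_on E f" "x \<in> E" "y \<in> E"
  shows "f (x - y) = f x - f y"
proof -
  have "f (x + (-1) *\<^sub>R y) = f x + f ((-1) *\<^sub>R y)"
    using assms by (meson bounded_linear_on_def subspace_scale)
  also have "f ((-1) *\<^sub>R y) = (-1) *\<^sub>R f y"
    using assms unfolding bounded_linear_on_def by blast
  finally show ?thesis by simp
qed

lemma bounded_linear_on_zero:
  assumes "subspace E" "bounded_linear_on E f"
  shows "f 0 = 0"
  using bounded_linear_on_diff[OF assms(1,2), of 0 0] subspace_0[OF assms(1)] by simp

lemma bounded_linear_on_sum:
  assumes "subspace E" "bounded_linear_on E f" "\<And>i. i \<in> A \<Longrightarrow> x i \<in> E"
  shows "f (\<Sum>i\<in>A. x i) = (\<Sum>i\<in>A. f (x i))"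
  using assms(3)
proof (induction A rule: infinite_finite_induct)
  case (insert a A)
  then have "x a \<in> E" "sum x A \<in> E" using assms(1) by (auto intro: subspace_sum)
  then have "f (x a + sum x A) = f (x a) + f (sum x A)"
    using assms(2) unfolding bounded_linear_on_def by blast
  then show ?case using insert by simp
qed (use bounded_linear_on_zero[OF assms(1,2)] in auto)

lemma continuous_on_bounded_linear_on:
  assumes "subspace E" "bounded_linear_on E f"
  shows "continuous_on E f"
proof -
  obtain B where B: "\<And>x. x \<in> E \<Longrightarrow> norm (f x) \<le> B * norm x"
    using assms unfolding bounded_linear_on_def by blast
  \<comment> \<open>A Lipschitz constant must be nonnegative, while \<open>B\<close> may be negative
    when \<open>E\<close> is trivial.\<close>
  have "norm (f x - f y) \<le> max B 0 * norm (x - y)" if "x \<in> E" "y \<in> E" for x y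
    using B[of "x - y"] that bounded_linear_on_diff[OF assms that] subspace_diff[OF assms(1) that]
    by (smt (verit) mult_right_mono norm_ge_zero)
  then have "(max B 0)-lipschitz_on E f"
    by (intro lipschitz_onI) (auto simp: dist_norm)
  then show ?thesis by (rule lipschitz_on_continuous_on)
qed

lemma closure_span_subset:
  "subspace E \<Longrightarrow> closed E \<Longrightarrow> G \<subseteq> E \<Longrightarrow> closure (span G) \<subseteq> E"
  by (simp add: closure_minimal span_minimal)

text \<open>The points of \<open>E\<close> that \<open>f\<close> maps into \<open>S\<close> form a
  closed subspace, so it suffices to test generators. This is how statements about operators on C(K)
  are reduced to the constants and the indicators.\<close>

lemma bounded_linear_on_closure_span:
  assumes E: "subspace E" "closed E" and f: "bounded_linear_on E f"
    and S: "subspace S" "closed S"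
    and G: "G \<subseteq> E" "\<And>x. x \<in> G \<Longrightarrow> f x \<in> S" and x: "x \<in> closure (span G)"
  shows "f x \<in> S"
proof -
  have "closed (E \<inter> f -` S)"
    by (rule continuous_closed_preimage[OF continuous_on_bounded_linear_on[OF E(1) f] E(2) S(2)])
  moreover have "subspace (E \<inter> f -` S)"
    unfolding subspace_def
  proof (intro conjI ballI allI)
    show "0 \<in> E \<inter> f -` S"
      using bounded_linear_on_zero[OF E(1) f] subspace_0[OF E(1)] subspace_0[OF S(1)] by simp
    fix x y c assume xy: "x \<in> E \<inter> f -` S"
    then show "c *\<^sub>R x \<in> E \<inter> f -` S"
      using f subspace_scale[OF E(1)] subspace_scale[OF S(1)] by (simp add: bounded_linear_on_def)
    assume "y \<in> E \<inter> f -` S"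
    then show "x + y \<in> E \<inter> f -` S"
      using xy f subspace_add[OF E(1)] subspace_add[OF S(1)] by (simp add: bounded_linear_on_def)
  qed
  ultimately have "closure (span G) \<subseteq> E \<inter> f -` S"
    using G by (intro closure_span_subset) auto
  then show ?thesis using x by blast
qed

lemma bounded_linear_on_eq_closure_span:
  assumes E: "subspace E" "closed E" and f: "bounded_linear_on E f" and h: "bounded_linear_on E h"
    and G: "G \<subseteq> E" and eq: "\<And>x. x \<in> G \<Longrightarrow> f x = h x" and x: "x \<in> closure (span G)"
  shows "f x = h x"
proof -
  have "bounded_linear_on E (\<lambda>x. f x - h x)"
  proof -
    obtain B D where "\<And>x. x \<in> E \<Longrightarrow> norm (f x) \<le> B * norm x"
      and "\<And>x. x \<in> E \<Longrightarrow> norm (h x) \<le> D * norm x"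
      using f h unfolding bounded_linear_on_def by blast
    then have "norm (f x - h x) \<le> (B + D) * norm x" if "x \<in> E" for x
      using that norm_triangle_ineq4[of "f x" "h x"] by (fastforce simp: distrib_right)
    moreover have "f (x + y) - h (x + y) = f x - h x + (f y - h y)" if "x \<in> E" "y \<in> E" for x y
      using f h that by (simp add: bounded_linear_on_def)
    moreover have "f (c *\<^sub>R x) - h (c *\<^sub>R x) = c *\<^sub>R (f x - h x)" if "x \<in> E" for c x
      using f h that by (simp add: bounded_linear_on_def scaleR_diff_right)
    ultimately show ?thesis unfolding bounded_linear_on_def by blast
  qed
  then have "f x - h x \<in> {0}"
    by (rule bounded_linear_on_closure_span[OF E _ _ _ G _ x]) (auto simp: eq)
  then show ?thesis by simp
qed

lemma separable_closure_span:
  fixes G :: "'a::real_normed_vector set"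
  assumes "countable G"
  shows "separable_space (top_of_set (closure (span G)))"
proof -
  define Q where "Q = (\<lambda>l. \<Sum>(q, v)\<leftarrow>l. real_of_rat q *\<^sub>R v) ` lists (UNIV \<times> G)"
  have cQ: "countable Q"
    unfolding Q_def using assms by (intro countable_image countable_lists) auto
  \<comment> \<open>Rational combinations do not form a real subspace, but their closure does: a
    real scalar is a limit of rational ones, here taken from above.\<close>
  have sub: "subspace (closure Q)"
    unfolding subspace_def
  proof (intro conjI ballI allI)
    have "0 \<in> Q" unfolding Q_def by (rule image_eqI[of _ _ "[]"]) auto
    then show "0 \<in> closure Q" using closure_subset by blast
    fix x assume "x \<in> closure Q"
    then obtain f where f: "\<And>n. f n \<in> Q" "f \<longlonglongrightarrow> x" unfolding closure_sequential by blast
    have add: "x + y \<in> closure Q" if y: "y \<in> closure Q" for y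
    proof -
      obtain h where h: "\<And>n. h n \<in> Q" "h \<longlonglongrightarrow> y" using y unfolding closure_sequential by blast
      have "f n + h n \<in> Q" for n
      proof -
        obtain k l where "k \<in> lists (UNIV \<times> G)" "l \<in> lists (UNIV \<times> G)"
          "f n = (\<Sum>(q, v)\<leftarrow>k. real_of_rat q *\<^sub>R v)" "h n = (\<Sum>(q, v)\<leftarrow>l. real_of_rat q *\<^sub>R v)"
          using f(1)[of n] h(1)[of n] unfolding Q_def by blast
        then show ?thesis unfolding Q_def by (intro image_eqI[of _ _ "k @ l"]) auto
      qed
      moreover have "(\<lambda>n. f n + h n) \<longlonglongrightarrow> x + y" using f h by (intro tendsto_add)
      ultimately show ?thesis
        unfolding closure_sequential by (intro exI[of _ "\<lambda>n. f n + h n"]) auto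
    qed
    show "x + y \<in> closure Q" if "y \<in> closure Q" for y using add[OF that] .
    fix c :: real
    have "\<exists>q. real_of_rat q < c + inverse (Suc n) \<and> c < real_of_rat q" for n
      using of_rat_dense[of c "c + inverse (Suc n)"] by auto
    then obtain q where q: "\<And>n. real_of_rat (q n) < c + inverse (Suc n)" "\<And>n. c < real_of_rat (q n)"
      by metis
    have "(\<lambda>n. real_of_rat (q n)) \<longlonglongrightarrow> c"
    proof (rule tendsto_sandwich[of "\<lambda>_. c" _ _ "\<lambda>n. c + inverse (real (Suc n))"])
      show "(\<lambda>n. c + inverse (real (Suc n))) \<longlonglongrightarrow> c"
        using tendsto_add[OF tendsto_const LIMSEQ_inverse_real_of_nat, of c] by simp
      show "\<forall>\<^sub>F n in sequentially. c \<le> real_of_rat (q n)" using q(2) by (simp add: less_imp_le)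
      show "\<forall>\<^sub>F n in sequentially. real_of_rat (q n) \<le> c + inverse (real (Suc n))"
        using q(1) by (simp add: less_imp_le)
    qed auto
    then have "(\<lambda>n. real_of_rat (q n) *\<^sub>R f n) \<longlonglongrightarrow> c *\<^sub>R x" using f by (intro tendsto_scaleR)
    moreover have "real_of_rat p *\<^sub>R f n \<in> Q" for p n
    proof -
      obtain l where l: "l \<in> lists (UNIV \<times> G)" "f n = (\<Sum>(q, v)\<leftarrow>l. real_of_rat q *\<^sub>R v)"
        using f(1)[of n] unfolding Q_def by blast
      have "real_of_rat p *\<^sub>R (\<Sum>(q, v)\<leftarrow>l. real_of_rat q *\<^sub>R v)
          = (\<Sum>(q, v)\<leftarrow>map (\<lambda>(q, v). (p * q, v)) l. real_of_rat q *\<^sub>R v)"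
        by (induction l) (auto simp: scaleR_add_right of_rat_mult)
      then show ?thesis
        unfolding Q_def using l by (intro image_eqI[of _ _ "map (\<lambda>(q, v). (p * q, v)) l"]) auto
    qed
    ultimately show "c *\<^sub>R x \<in> closure Q"
      unfolding closure_sequential using f(1)
      by (intro exI[of _ "\<lambda>n. real_of_rat (q n) *\<^sub>R f n"]) auto
  qed
  have "G \<subseteq> Q"
  proof
    fix v assume "v \<in> G"
    then show "v \<in> Q" unfolding Q_def by (intro image_eqI[of _ _ "[(1, v)]"]) auto
  qed
  then have "closure (span G) \<subseteq> closure Q"
    using sub closure_subset[of Q] by (intro closure_span_subset) auto
  moreover have Qs: "Q \<subseteq> closure (span G)"
  proof -
    have "(\<Sum>(q, v)\<leftarrow>l. real_of_rat q *\<^sub>R v) \<in> span G" if "l \<in> lists (UNIV \<times> G)" for l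
      using that by (induction l) (auto intro: span_add span_scale span_base span_zero)
    then show ?thesis using closure_subset unfolding Q_def by blast
  qed
  ultimately show ?thesis
    unfolding separable_space_def
    by (intro exI[of _ Q]) (auto simp: cQ closure_of_subtopology inf.absorb2)
qed

lemma in_span_finite:
  assumes "x \<in> span G"
  obtains F where "finite F" "F \<subseteq> G" "x \<in> span F"
  using assms unfolding span_explicit by (auto intro: that span_sum span_scale span_base)

text \<open>Each point of a countable dense subset is the limit of a sequence of finite
  combinations, so countably many generators suffice for all of them together.\<close>

lemma separable_subset_closure_span:
  fixes S :: "'a::real_normed_vector set"
  assumes S: "separable_space (top_of_set S)" "S \<subseteq> closure (span G)"
  obtains D where "countable D" "D \<subseteq> G" "S \<subseteq> closure (span D)"
proof -
  obtain Q where Q: "countable Q" "Q \<subseteq> S" "(top_of_set S) closure_of Q = S"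
    using S unfolding separable_space_def by auto
  have "\<exists>D. countable D \<and> D \<subseteq> G \<and> q \<in> closure (span D)" if "q \<in> Q" for q
  proof -
    have "q \<in> closure (span G)" using that Q S by blast
    then obtain f where f: "\<And>n. f n \<in> span G" "f \<longlonglongrightarrow> q" unfolding closure_sequential by blast
    have "\<exists>F. finite F \<and> F \<subseteq> G \<and> f n \<in> span F" for n using in_span_finite[OF f(1)] by metis
    then obtain F where F: "\<And>n. finite (F n)" "\<And>n. F n \<subseteq> G" "\<And>n. f n \<in> span (F n)" by metis
    have "f n \<in> span (\<Union>n. F n)" for n using F(3)[of n] span_mono[of "F n" "\<Union>n. F n"] by blast
    then have "q \<in> closure (span (\<Union>n. F n))" using f(2) unfolding closure_sequential by blast
    moreover have "countable (\<Union>n. F n)" using F(1) by (simp add: countable_finite)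
    ultimately show ?thesis using F(2) by blast
  qed
  then obtain D where D: "\<And>q. q \<in> Q \<Longrightarrow> countable (D q) \<and> D q \<subseteq> G \<and> q \<in> closure (span (D q))"
    by metis
  have "Q \<subseteq> closure (span (\<Union>q\<in>Q. D q))"
  proof
    fix q assume q: "q \<in> Q"
    then have "closure (span (D q)) \<subseteq> closure (span (\<Union>q\<in>Q. D q))"
      by (intro closure_mono span_mono) auto
    then show "q \<in> closure (span (\<Union>q\<in>Q. D q))" using D[OF q] by blast
  qed
  moreover have "S \<subseteq> closure Q"
    using Q(2,3) by (auto simp: closure_of_subtopology inf.absorb2)
  ultimately have "S \<subseteq> closure (span (\<Union>q\<in>Q. D q))"
    using closure_minimal[OF _ closed_closure] by blast
  then show ?thesis using D Q(1) by (intro that[of "\<Union>q\<in>Q. D q"]) auto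
qed

section \<open>Lines of initial segments\<close>

definition segment :: "'i::linorder set \<Rightarrow> bool" where
  "segment I \<longleftrightarrow> (\<forall>x\<in>I. \<forall>y\<le>x. y \<in> I)"

lemma segmentD: "segment I \<Longrightarrow> x \<in> I \<Longrightarrow> y \<le> x \<Longrightarrow> y \<in> I"
  unfolding segment_def by blast

lemma segment_linear: "segment I \<Longrightarrow> segment J \<Longrightarrow> I \<subseteq> J \<or> J \<subseteq> I"
  unfolding segment_def by (meson linear subsetI)

lemma segment_atMost [simp]: "segment {..x}"
  and segment_lessThan [simp]: "segment {..<x}"
  and segment_empty [simp]: "segment {}"
  and segment_UNIV [simp]: "segment UNIV"
  by (auto simp: segment_def)

text \<open>
  Points of the line are images of initial segments under an injection \<open>g\<close>, so that the line lives
  over the type required by the theorem.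
\<close>

locale cut_line =
  fixes g :: "'i::linorder \<Rightarrow> 'b"
  assumes inj: "inj g"
begin

definition cuts :: "'b set set" where
  "cuts = {g ` I | I. segment I}"

definition cut_rel :: "'b set rel" where
  "cut_rel = {(A, B). A \<in> cuts \<and> B \<in> cuts \<and> A \<subseteq> B}"

abbreviation cut_top :: "'b set topology" where
  "cut_top \<equiv> order_topology_on cuts cut_rel"

abbreviation cut_C :: "('b set discrete \<Rightarrow>\<^sub>C real) set" where
  "cut_C \<equiv> cfun_space cut_top"

lemma cutsI [simp, intro]: "segment I \<Longrightarrow> g ` I \<in> cuts"
  unfolding cuts_def by blast

lemma cutsE: "A \<in> cuts \<Longrightarrow> (\<And>I. segment I \<Longrightarrow> A = g ` I \<Longrightarrow> P) \<Longrightarrow> P"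
  unfolding cuts_def by blast

lemma vimage_image [simp]: "g -` (g ` I) = I"
  by (rule inj_vimage_image_eq[OF inj])

lemma image_subset_iff' [simp]: "g ` I \<subseteq> g ` J \<longleftrightarrow> I \<subseteq> J"
  using inj by (simp add: inj_image_subset_iff)

lemma image_eq_iff' [simp]: "g ` I = g ` J \<longleftrightarrow> I = J"
  using inj by (simp add: inj_image_eq_iff)

lemma linear_order_cut_rel: "linear_order_on cuts cut_rel"
  unfolding order_on_defs
proof (intro conjI)
  have "A \<subseteq> B \<or> B \<subseteq> A" if "A \<in> cuts" "B \<in> cuts" for A B
    using that by (elim cutsE) (use segment_linear in auto)
  then show "total_on cuts cut_rel"
    by (auto simp: total_on_def cut_rel_def)
qed (auto simp: refl_on_def trans_def antisym_def cut_rel_def)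

text \<open>Membership tests at finitely many points: the order topology on the cuts is the one
  inherited from the product of two-point spaces indexed by the order.\<close>

definition nhd :: "'i set \<Rightarrow> 'i set \<Rightarrow> 'b set set" where
  "nhd F I = {g ` J | J. segment J \<and> J \<inter> F = I \<inter> F}"

lemma mem_nhd [simp]: "g ` J \<in> nhd F I \<longleftrightarrow> segment J \<and> J \<inter> F = I \<inter> F"
  unfolding nhd_def by auto

lemma nhd_subset_cuts: "nhd F I \<subseteq> cuts"
  unfolding nhd_def by auto

lemma openin_ray:
  assumes "A \<in> cuts"
  shows "openin cut_top {B \<in> cuts. B \<subset> A}" "openin cut_top {B \<in> cuts. A \<subset> B}"
proof -
  have 1: "{B \<in> cuts. B \<subset> A} = {B \<in> cuts. (B, A) \<in> cut_rel \<and> B \<noteq> A}"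
    and 2: "{B \<in> cuts. A \<subset> B} = {B \<in> cuts. (A, B) \<in> cut_rel \<and> B \<noteq> A}"
    unfolding cut_rel_def using assms by blast+
  show "openin cut_top {B \<in> cuts. B \<subset> A}"
    unfolding 1 order_topology_on_def by (rule topology_generated_by_Basis) (use assms in blast)
  show "openin cut_top {B \<in> cuts. A \<subset> B}"
    unfolding 2 order_topology_on_def by (rule topology_generated_by_Basis) (use assms in blast)
qed

lemma openin_nhd:
  assumes "finite F"
  shows "openin cut_top (nhd F I)"
  using assms
proof (induction F)
  case empty
  have "nhd {} I = topspace cut_top" by (auto simp: nhd_def elim: cutsE)
  then show ?case by (metis openin_topspace)
next
  case (insert x F)
  have 1: "nhd {x} I = (if x \<in> I then {B \<in> cuts. g ` {..<x} \<subset> B} else {B \<in> cuts. B \<subset> g ` {..x}})"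
  proof -
    \<comment> \<open>Each \<open>x\<close> gives a jump from \<open>{..<x}\<close> to
      \<open>{..x}\<close> with no cut in between, so both membership and non-membership of
      \<open>x\<close> are described by open rays.\<close>
    have 1: "x \<in> J \<longleftrightarrow> {..<x} \<subset> J" if J: "segment J" for J
    proof
      assume "x \<in> J"
      then show "{..<x} \<subset> J" using segmentD[OF J, of x] by auto
    next
      assume "{..<x} \<subset> J"
      then obtain y where "y \<in> J" "x \<le> y" by (auto simp: not_less[symmetric])
      then show "x \<in> J" using segmentD[OF J] by blast
    qed
    have 2: "x \<notin> J \<longleftrightarrow> J \<subset> {..x}" if J: "segment J" for J
    proof
      assume x: "x \<notin> J"
      then have "J \<subseteq> {..x}" using segmentD[OF J] by (meson atMost_iff linear subsetI)
      then show "J \<subset> {..x}" using x by blast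
    next
      assume "J \<subset> {..x}"
      then show "x \<notin> J" using segmentD[OF J, of x] by auto
    qed
    have "B \<in> nhd {x} I \<longleftrightarrow> B \<in> (if x \<in> I then {B \<in> cuts. g ` {..<x} \<subset> B}
        else {B \<in> cuts. B \<subset> g ` {..x}})" for B
    proof (cases "B \<in> cuts")
      case True
      then obtain J where "segment J" "B = g ` J" by (rule cutsE)
      then show ?thesis using 1[of J] 2[of J] by (auto simp: psubset_eq)
    next
      case False
      then show ?thesis using nhd_subset_cuts by auto
    qed
    then show ?thesis by blast
  qed
  have "openin cut_top (nhd {x} I)"
    unfolding 1 using openin_ray by simp
  moreover have "nhd (insert x F) I = nhd {x} I \<inter> nhd F I"
    by (auto simp: nhd_def)
  ultimately show ?case using insert by (auto intro: openin_Int)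
qed

lemma nhd_base:
  assumes "openin cut_top U" "g ` I \<in> U" "segment I"
  shows "\<exists>F. finite F \<and> nhd F I \<subseteq> U"
proof -
  let ?S = "insert cuts ({{x \<in> cuts. (x, a) \<in> cut_rel \<and> x \<noteq> a} | a. a \<in> cuts} \<union>
                {{x \<in> cuts. (a, x) \<in> cut_rel \<and> x \<noteq> a} | a. a \<in> cuts})"
  have "generate_topology_on ?S U"
    using assms(1) by (simp add: order_topology_on_def openin_topology_generated_by_iff)
  then show ?thesis using assms(2)
  proof induction
    case (Int a b)
    then obtain F G where FG: "finite F" "nhd F I \<subseteq> a" "finite G" "nhd G I \<subseteq> b" by blast
    have "nhd (F \<union> G) I \<subseteq> nhd F I" "nhd (F \<union> G) I \<subseteq> nhd G I" unfolding nhd_def by blast+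
    then have "nhd (F \<union> G) I \<subseteq> a \<inter> b" using FG by blast
    then show ?case using FG by (intro exI[of _ "F \<union> G"]) simp
  next
    case (UN \<K>)
    then obtain k where k: "k \<in> \<K>" "g ` I \<in> k" by blast
    then obtain F where "finite F" "nhd F I \<subseteq> k" using UN.IH by blast
    then show ?case using k by blast
  next
    case (Basis s)
    then consider "s = cuts" | a where "a \<in> cuts" "s = {x \<in> cuts. (x, a) \<in> cut_rel \<and> x \<noteq> a}"
      | a where "a \<in> cuts" "s = {x \<in> cuts. (a, x) \<in> cut_rel \<and> x \<noteq> a}"
      by (elim insertE UnE CollectE exE conjE) simp_all
    then show ?case
    proof cases
      case 1
      then show ?thesis using nhd_subset_cuts by (intro exI[of _ "{}"]) auto
    next
      case (2 a)
      then obtain J where J: "segment J" "a = g ` J" by (elim cutsE)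
      then have "I \<subset> J" using Basis(2) 2 by (auto simp: cut_rel_def)
      then obtain x where x: "x \<in> J" "x \<notin> I" by blast
      have "nhd {x} I \<subseteq> s"
      proof
        fix B assume "B \<in> nhd {x} I"
        then obtain L where L: "B = g ` L" "segment L" "x \<notin> L" using x by (auto simp: nhd_def)
        then have "L \<subseteq> J" "L \<noteq> J" using x segment_linear[OF L(2) J(1)] by auto
        then show "B \<in> s" using 2 J L by (auto simp: cut_rel_def)
      qed
      then show ?thesis by blast
    next
      case (3 a)
      then obtain J where J: "segment J" "a = g ` J" by (elim cutsE)
      then have "J \<subset> I" using Basis(2) 3 by (auto simp: cut_rel_def)
      then obtain x where x: "x \<in> I" "x \<notin> J" by blast
      have "nhd {x} I \<subseteq> s"
      proof
        fix B assume "B \<in> nhd {x} I"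
        then obtain L where L: "B = g ` L" "segment L" "x \<in> L" using x by (auto simp: nhd_def)
        then have "J \<subseteq> L" "L \<noteq> J" using x segment_linear[OF L(2) J(1)] by auto
        then show "B \<in> s" using 3 J L by (auto simp: cut_rel_def)
      qed
      then show ?thesis by blast
    qed
  qed simp
qed

text \<open>Creeping along the line: the union of the cuts below which a finite subcover exists.\<close>

lemma compact_space_cut_top: "compact_space cut_top"
  unfolding compact_space_alt topspace_order_topology_on
proof (intro allI impI)
  fix \<U> assume "(\<forall>U\<in>\<U>. openin cut_top U) \<and> cuts \<subseteq> \<Union>\<U>"
  then have \<U>: "\<forall>U\<in>\<U>. openin cut_top U" "cuts \<subseteq> \<Union>\<U>" by auto
  define down where "down A = {g ` J | J. segment J \<and> J \<subseteq> A}" for A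
  define good where "good A \<longleftrightarrow> segment A \<and>
    (\<exists>\<F>. finite \<F> \<and> \<F> \<subseteq> \<U> \<and> down A \<subseteq> \<Union>\<F>)" for A
  have good_segment: "segment A" if "good A" for A using that unfolding good_def by simp
  have cov: "\<exists>U\<in>\<U>. g ` I \<in> U" if "segment I" for I
    using \<U>(2) that by (meson UnionE cutsI subsetD)
  have good_add: "good B" if A: "good A" and U: "U \<in> \<U>" and B: "segment B"
    "\<And>J. segment J \<Longrightarrow> J \<subseteq> B \<Longrightarrow> J \<subseteq> A \<or> g ` J \<in> U" for A B U
  proof -
    obtain \<F> where F: "finite \<F>" "\<F> \<subseteq> \<U>" "down A \<subseteq> \<Union>\<F>"
      using A unfolding good_def by auto
    have "down B \<subseteq> down A \<union> U"
      using B(2) unfolding down_def by auto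
    then have "down B \<subseteq> \<Union>(insert U \<F>)" using F(3) by auto
    then show ?thesis
      unfolding good_def using F(1,2) U B(1) by (intro conjI exI[of _ "insert U \<F>"]) auto
  qed
  have good_empty: "good {}"
  proof -
    obtain U where "U \<in> \<U>" "g ` {} \<in> U" using cov segment_empty by blast
    then show ?thesis unfolding good_def down_def by (intro conjI exI[of _ "{U}"]) auto
  qed
  define S where "S = \<Union>{A. good A}"
  have S: "segment S" unfolding S_def segment_def using segmentD[OF good_segment] by auto
  obtain U where U: "U \<in> \<U>" "g ` S \<in> U" using cov[OF S] by blast
  obtain F where F: "finite F" "nhd F S \<subseteq> U" using nhd_base U S \<U>(1) by metis
  have in_U: "g ` J \<in> U" if "segment J" "J \<inter> F = S \<inter> F" for J
    using F(2) that mem_nhd by blast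
  have "\<exists>A. good A \<and> G \<subseteq> A" if "finite G" "G \<subseteq> S" for G
    using that
  proof (induction G)
    case empty
    then show ?case using good_empty by blast
  next
    case (insert x G)
    then obtain A B where AB: "good A" "G \<subseteq> A" "good B" "x \<in> B" unfolding S_def by auto
    then have "A \<subseteq> B \<or> B \<subseteq> A" using segment_linear good_segment by blast
    then show ?case using AB by blast
  qed
  then obtain A where A: "good A" "S \<inter> F \<subseteq> A" using F(1) by (meson finite_Int inf_le1)
  have AS: "A \<subseteq> S" using A unfolding S_def by blast
  \<comment> \<open>One extra set \<open>U\<close> suffices: a segment that is not inside
    \<open>A\<close> contains \<open>A\<close>, hence the trace of \<open>S\<close> on
    \<open>F\<close>. Lying inside \<open>B\<close> it has exactly that trace, and so it is in
    \<open>U\<close>.\<close>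
  have beyond: "good B" if "segment B" "B \<inter> F = S \<inter> F" for B
  proof (rule good_add[OF A(1) U(1) that(1)])
    fix J assume J: "segment J" "J \<subseteq> B"
    show "J \<subseteq> A \<or> g ` J \<in> U"
    proof (cases "J \<subseteq> A")
      case False
      then have "A \<subseteq> J" using J A segment_linear good_segment by blast
      then have "J \<inter> F = S \<inter> F" using A J that by blast
      then show ?thesis using in_U J by blast
    qed simp
  qed
  \<comment> \<open>Otherwise let \<open>m\<close> be the first test point outside \<open>S\<close>.
    Then \<open>{..<m}\<close> still has the trace of \<open>S\<close> and is good, and
    \<open>{..m}\<close> is the only further cut up to \<open>m\<close>, so one more open set makes
    it good, against the choice of \<open>S\<close>.\<close>
  have "F \<subseteq> S"
  proof (rule ccontr)
    assume "\<not> F \<subseteq> S"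
    then have ne: "finite (F - S)" "F - S \<noteq> {}" using F(1) by auto
    define m where "m = Min (F - S)"
    have m: "m \<in> F - S" unfolding m_def using Min_in[OF ne] .
    have SB: "S \<subseteq> {..<m}"
    proof
      fix x assume "x \<in> S"
      then show "x \<in> {..<m}" using segmentD[OF S, of x m] m by (cases "m \<le> x") auto
    qed
    have "m \<le> x" if "x \<in> F" "x \<notin> S" for x
      using Min_le[OF ne(1), of x] that unfolding m_def by simp
    then have "{..<m} \<inter> F = S \<inter> F"
      using SB by (auto simp: not_less[symmetric])
    then have gm: "good {..<m}" by (rule beyond[OF segment_lessThan])
    obtain V where V: "V \<in> \<U>" "g ` {..m} \<in> V" using cov segment_atMost by blast
    have "good {..m}"
    proof (rule good_add[OF gm V(1) segment_atMost])
      fix J assume J: "segment J" "J \<subseteq> {..m}"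
      show "J \<subseteq> {..<m} \<or> g ` J \<in> V"
      proof (cases "m \<in> J")
        case True
        then have "J = {..m}" using J by (auto simp: segment_def)
        then show ?thesis using V by simp
      next
        case False
        then have "J \<subseteq> {..<m}" using J(2) by (auto simp: less_le)
        then show ?thesis by simp
      qed
    qed
    then have "m \<in> S" unfolding S_def by auto
    then show False using m by simp
  qed
  then have "good UNIV" by (intro beyond) auto
  then obtain \<F> where "finite \<F>" "\<F> \<subseteq> \<U>" "down UNIV \<subseteq> \<Union>\<F>"
    unfolding good_def by auto
  moreover have "down UNIV = cuts" unfolding down_def cuts_def by simp
  ultimately show "\<exists>\<F>. finite \<F> \<and> \<F> \<subseteq> \<U> \<and> cuts \<subseteq> \<Union>\<F>" by auto
qed

lemma compact_line_cuts: "compact_line cuts cut_rel"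
  unfolding compact_line_def using linear_order_cut_rel compact_space_cut_top by blast

text \<open>\<open>{..x}\<close> is the least cut that contains \<open>x\<close>. A basic set around
  it made of cuts containing \<open>x\<close> therefore determines \<open>x\<close>.\<close>

lemma card_base_ge:
  assumes "topology_base cut_top \<B>"
  shows "|UNIV :: 'i set| \<le>o |\<B>|"
proof -
  have "\<exists>V\<in>\<B>. g ` {..x} \<in> V \<and> V \<subseteq> nhd {x} {..x}" for x
    using assms openin_nhd[of "{x}" "{..x}"] unfolding topology_base_def by simp
  then obtain V where V: "\<And>x. V x \<in> \<B>" "\<And>x. g ` {..x} \<in> V x" "\<And>x. V x \<subseteq> nhd {x} {..x}"
    by metis
  have "y \<le> x" if "V x = V y" for x y
  proof -
    have "g ` {..x} \<in> nhd {y} {..y}" using V that by blast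
    then show ?thesis by auto
  qed
  then have "inj V" by (intro injI) (metis order_antisym)
  then show ?thesis using V(1) card_of_ordLeq[of UNIV \<B>] by blast
qed

lemma has_weight_cut_top:
  fixes \<kappa> :: "'k rel"
  assumes card: "|UNIV :: 'i set| =o \<kappa>" and fin: "|Collect finite :: 'i set set| \<le>o \<kappa>"
    and inf: "infinite (UNIV :: 'i set)"
  shows "has_weight cut_top \<kappa>"
proof -
  define \<B> where "\<B> = (\<lambda>(F, G). nhd F G) ` (Collect finite \<times> Collect finite)"
  have base: "topology_base cut_top \<B>"
    unfolding topology_base_def
  proof (intro conjI ballI allI impI)
    show "openin cut_top V" if "V \<in> \<B>" for V using that openin_nhd by (auto simp: \<B>_def)
    fix U x assume U: "openin cut_top U \<and> x \<in> U"
    then have "x \<in> cuts" using openin_subset by fastforce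
    then obtain I where I: "segment I" "x = g ` I" by (rule cutsE)
    obtain F where F: "finite F" "nhd F I \<subseteq> U" using nhd_base U I by metis
    \<comment> \<open>Only the trace of \<open>I\<close> on \<open>F\<close> matters, so pairs of
      finite sets index a base.\<close>
    have eq: "nhd F I = nhd F (I \<inter> F)" by (auto simp: nhd_def)
    have "nhd F I \<in> \<B>" unfolding eq \<B>_def using F by (intro image_eqI[of _ _ "(F, I \<inter> F)"]) auto
    moreover have "x \<in> nhd F I" using I by simp
    ultimately show "\<exists>V\<in>\<B>. x \<in> V \<and> V \<subseteq> U" using F by blast
  qed
  have ge: "\<kappa> \<le>o |\<B>'|" if "topology_base cut_top \<B>'" for \<B>'
    using card_base_ge[OF that] card ordIso_ordLeq_trans ordIso_symmetric by blast
  have fin': "|Collect finite :: 'i set set| \<le>o |UNIV :: 'i set|"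
    using fin card ordLeq_ordIso_trans ordIso_symmetric by blast
  have "|\<B>| \<le>o |(Collect finite :: 'i set set) \<times> (Collect finite :: 'i set set)|"
    unfolding \<B>_def by (rule card_of_image)
  moreover have "|(Collect finite :: 'i set set) \<times> (Collect finite :: 'i set set)|
      \<le>o |(UNIV :: 'i set) \<times> (UNIV :: 'i set)|"
    using ordLeq_transitive[OF card_of_Times_mono1[OF fin'] card_of_Times_mono2[OF fin']] .
  moreover have "|(UNIV :: 'i set) \<times> (UNIV :: 'i set)| =o \<kappa>"
    using ordIso_transitive[OF card_of_Times_same_infinite[OF inf] card] .
  ultimately have "|\<B>| \<le>o \<kappa>"
    using ordLeq_transitive ordLeq_ordIso_trans by blast
  then have "|\<B>| =o \<kappa>" using ge[OF base] ordIso_iff_ordLeq by blast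
  then show ?thesis unfolding has_weight_def using base ge by blast
qed

end

section \<open>Continuous functions on a line of initial segments\<close>

context cut_line
begin

definition val :: "('b set discrete \<Rightarrow>\<^sub>C real) \<Rightarrow> 'i set \<Rightarrow> real" where
  "val f I = apply_bcontfun f (discrete (g ` I))"

lemma val_simps [simp]:
  "val (f + h) I = val f I + val h I" "val (f - h) I = val f I - val h I"
  "val (c *\<^sub>R f) I = c * val f I" "val 0 I = 0"
  by (simp_all add: val_def)

lemma val_sum: "val (\<Sum>i\<in>A. f i) I = (\<Sum>i\<in>A. val (f i) I)"
  by (induction A rule: infinite_finite_induct) auto

lemma abs_val_le: "\<bar>val f I\<bar> \<le> norm f"
  using norm_bounded[of f] by (simp add: val_def)

lemma cut_C_outside:
  assumes "f \<in> cut_C" "A \<notin> cuts"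
  shows "apply_bcontfun f (discrete A) = 0"
  using assms by (simp add: cfun_space_def)

lemma norm_le_val:
  assumes "f \<in> cut_C" "\<And>I. segment I \<Longrightarrow> \<bar>val f I\<bar> \<le> B"
  shows "norm f \<le> B"
proof (rule norm_bound)
  fix y :: "'b set discrete"
  obtain A where y: "y = discrete A" by (metis of_discrete_inverse)
  have B: "0 \<le> B" using assms(2)[OF segment_empty] by linarith
  show "norm (apply_bcontfun f y) \<le> B"
  proof (cases "A \<in> cuts")
    case True
    then obtain I where "segment I" "A = g ` I" by (rule cutsE)
    then show ?thesis using assms(2) y by (simp add: val_def)
  next
    case False
    then show ?thesis using cut_C_outside[OF assms(1)] y B by simp
  qed
qed

definition mk :: "('i set \<Rightarrow> real) \<Rightarrow> ('b set discrete \<Rightarrow>\<^sub>C real)" where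
  "mk h = Bcontfun (\<lambda>y. if of_discrete y \<in> cuts then h (g -` of_discrete y) else 0)"

lemma apply_mk:
  assumes "\<And>I. segment I \<Longrightarrow> \<bar>h I\<bar> \<le> B"
  shows "apply_bcontfun (mk h) y = (if of_discrete y \<in> cuts then h (g -` of_discrete y) else 0)"
proof -
  have "\<bar>if of_discrete y \<in> cuts then h (g -` of_discrete y) else 0\<bar> \<le> max B 0" for y
    using assms by (fastforce elim: cutsE)
  then have "(\<lambda>y. if of_discrete y \<in> cuts then h (g -` of_discrete y) else 0) \<in> bcontfun"
    by (intro bcontfun_normI[where b = "max B 0"])
      (auto simp: continuous_on_open_vimage open_discrete)
  then show ?thesis by (simp add: mk_def Bcontfun_inverse)
qed

lemma val_mk:
  assumes "\<And>I. segment I \<Longrightarrow> \<bar>h I\<bar> \<le> B" "segment I"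
  shows "val (mk h) I = h I"
  using assms(2) by (simp add: val_def apply_mk[of h B, OF assms(1)] discrete_inverse)

lemma mk_in_cut_C:
  assumes h: "\<And>I. segment I \<Longrightarrow> \<bar>h I\<bar> \<le> B"
    and cont: "\<And>I \<epsilon>. segment I \<Longrightarrow> 0 < \<epsilon> \<Longrightarrow>
      \<exists>F. finite F \<and> (\<forall>J. segment J \<and> J \<inter> F = I \<inter> F \<longrightarrow> \<bar>h J - h I\<bar> < \<epsilon>)"
  shows "mk h \<in> cut_C"
proof -
  have "openin cut_top {x \<in> cuts. apply_bcontfun (mk h) (discrete x) \<in> U}" if U: "open U" for U
  proof (subst openin_subopen, intro ballI)
    fix x assume "x \<in> {x \<in> cuts. apply_bcontfun (mk h) (discrete x) \<in> U}"
    then have x: "x \<in> cuts" "apply_bcontfun (mk h) (discrete x) \<in> U" by auto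
    then obtain I where I: "segment I" "x = g ` I" by (elim cutsE)
    then have "h I \<in> U" using x val_mk[of h B, OF h I(1)] by (simp add: val_def)
    then obtain \<epsilon> where e: "\<epsilon> > 0" "ball (h I) \<epsilon> \<subseteq> U" using U by (metis open_contains_ball)
    obtain F where F: "finite F" "\<And>J. segment J \<Longrightarrow> J \<inter> F = I \<inter> F \<Longrightarrow> \<bar>h J - h I\<bar> < \<epsilon>"
      using cont[OF I(1) e(1)] by blast
    have "nhd F I \<subseteq> {x \<in> cuts. apply_bcontfun (mk h) (discrete x) \<in> U}"
    proof
      fix y assume "y \<in> nhd F I"
      then obtain J where J: "segment J" "y = g ` J" "J \<inter> F = I \<inter> F" by (auto simp: nhd_def)
      then have "h J \<in> U" using e(2) F(2)[of J] by (auto simp: dist_real_def)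
      then show "y \<in> {x \<in> cuts. apply_bcontfun (mk h) (discrete x) \<in> U}"
        using J val_mk[of h B, OF h J(1)] by (simp add: val_def)
    qed
    moreover have "x \<in> nhd F I" using I by simp
    ultimately show "\<exists>T. openin cut_top T \<and> x \<in> T \<and>
        T \<subseteq> {x \<in> cuts. apply_bcontfun (mk h) (discrete x) \<in> U}"
      using openin_nhd[OF F(1)] by blast
  qed
  then have "continuous_map cut_top euclideanreal (\<lambda>x. apply_bcontfun (mk h) (discrete x))"
    by (simp add: continuous_map_def)
  moreover have "apply_bcontfun (mk h) (discrete x) = 0" if "x \<notin> cuts" for x
    using that by (simp add: apply_mk[of h B, OF h] discrete_inverse)
  ultimately show ?thesis by (simp add: cfun_space_def)
qed

lemma cut_C_locally_const:
  assumes f: "f \<in> cut_C" and I: "segment I" and e: "0 < \<epsilon>"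
  shows "\<exists>F. finite F \<and> (\<forall>J. segment J \<and> J \<inter> F = I \<inter> F \<longrightarrow> \<bar>val f J - val f I\<bar> < \<epsilon>)"
proof -
  define U where "U = {x \<in> topspace cut_top. apply_bcontfun f (discrete x) \<in> ball (val f I) \<epsilon>}"
  have U: "openin cut_top U"
    unfolding U_def using f by (intro openin_continuous_map_preimage[of cut_top euclideanreal])
      (auto simp: cfun_space_def)
  have "g ` I \<in> U" using I e by (simp add: val_def U_def)
  then obtain F where F: "finite F" "nhd F I \<subseteq> U" using nhd_base[OF U _ I] by blast
  have "\<bar>val f J - val f I\<bar> < \<epsilon>" if "segment J" "J \<inter> F = I \<inter> F" for J
  proof -
    have "g ` J \<in> nhd F I" using that by simp
    then have "g ` J \<in> U" using F(2) by blast
    then have "apply_bcontfun f (discrete (g ` J)) \<in> ball (val f I) \<epsilon>" by (simp add: U_def)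
    then show ?thesis by (simp add: val_def dist_real_def abs_minus_commute)
  qed
  then show ?thesis using F(1) by blast
qed

text \<open>Compactness turns the local test sets into one: a finite union of those that control
  \<open>f\<close> up to half of the tolerance.\<close>

lemma cut_C_uniform:
  assumes f: "f \<in> cut_C" and e: "0 < \<epsilon>"
  obtains F where "finite F"
    "\<And>I J. segment I \<Longrightarrow> segment J \<Longrightarrow> I \<inter> F = J \<inter> F \<Longrightarrow> \<bar>val f I - val f J\<bar> < \<epsilon>"
proof -
  have "\<exists>F. segment I \<longrightarrow> finite F \<and> (\<forall>J. segment J \<and> J \<inter> F = I \<inter> F \<longrightarrow> \<bar>val f J - val f I\<bar> < \<epsilon> / 2)" for I
    using cut_C_locally_const[OF f, of I "\<epsilon> / 2"] e by (cases "segment I") auto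
  then obtain F where F: "\<And>I. segment I \<Longrightarrow> finite (F I)"
    "\<And>I J. segment I \<Longrightarrow> segment J \<Longrightarrow> J \<inter> F I = I \<inter> F I \<Longrightarrow> \<bar>val f J - val f I\<bar> < \<epsilon> / 2"
    by metis
  define \<U> where "\<U> = (\<lambda>I. nhd (F I) I) ` Collect segment"
  have "\<forall>U\<in>\<U>. openin cut_top U" using openin_nhd F(1) by (auto simp: \<U>_def)
  moreover have "topspace cut_top \<subseteq> \<Union>\<U>" by (auto simp: \<U>_def elim!: cutsE)
  ultimately obtain \<F> where \<F>: "finite \<F>" "\<F> \<subseteq> \<U>" "cuts \<subseteq> \<Union>\<F>"
    using compact_space_cut_top unfolding compact_space_alt topspace_order_topology_on by metis
  then obtain S where S: "S \<subseteq> Collect segment" "finite S" "\<F> = (\<lambda>I. nhd (F I) I) ` S"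
    unfolding \<U>_def by (meson finite_subset_image)
  show ?thesis
  proof (rule that[of "\<Union>I\<in>S. F I"])
    show "finite (\<Union>I\<in>S. F I)" using S F(1) by auto
    fix I J assume IJ: "segment I" "segment J" "I \<inter> (\<Union>I\<in>S. F I) = J \<inter> (\<Union>I\<in>S. F I)"
    have "g ` I \<in> \<Union>\<F>" using IJ(1) \<F>(3) by blast
    then obtain L where L: "L \<in> S" "g ` I \<in> nhd (F L) L" using S(3) by blast
    then have 1: "I \<inter> F L = L \<inter> F L" by simp
    have "J \<inter> F L = I \<inter> F L" using IJ(3) L(1) by blast
    then have 2: "J \<inter> F L = L \<inter> F L" using 1 by simp
    have "segment L" using S(1) L(1) by blast
    then have "\<bar>val f I - val f L\<bar> < \<epsilon> / 2" "\<bar>val f J - val f L\<bar> < \<epsilon> / 2"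
      using F(2) IJ 1 2 by blast+
    then show "\<bar>val f I - val f J\<bar> < \<epsilon>" by linarith
  qed
qed

section \<open>Generators and the subspaces spanned by them\<close>

definition unit_fun :: "'b set discrete \<Rightarrow>\<^sub>C real" where
  "unit_fun = mk (\<lambda>_. 1)"

definition ind :: "'i \<Rightarrow> ('b set discrete \<Rightarrow>\<^sub>C real)" where
  "ind x = mk (\<lambda>I. if x \<in> I then 1 else 0)"

lemma val_unit_fun [simp]: "segment I \<Longrightarrow> val unit_fun I = 1"
  unfolding unit_fun_def by (rule val_mk[where B = 1]) auto

lemma val_ind [simp]: "segment I \<Longrightarrow> val (ind x) I = (if x \<in> I then 1 else 0)"
  unfolding ind_def by (rule val_mk[where B = 1]) auto

lemma unit_fun_in_cut_C [simp]: "unit_fun \<in> cut_C"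
  unfolding unit_fun_def by (rule mk_in_cut_C[where B = 1]) auto

lemma ind_in_cut_C [simp]: "ind x \<in> cut_C"
  unfolding ind_def
proof (rule mk_in_cut_C[where B = 1])
  fix I :: "'i set" and \<epsilon> :: real assume "\<epsilon> > 0"
  then show "\<exists>F. finite F \<and> (\<forall>J. segment J \<and> J \<inter> F = I \<inter> F \<longrightarrow>
      \<bar>(if x \<in> J then 1 else 0) - (if x \<in> I then 1 else 0)\<bar> < \<epsilon>)"
    by (intro exI[of _ "{x}"]) (auto simp: set_eq_iff)
qed auto

definition gens :: "'i set \<Rightarrow> ('b set discrete \<Rightarrow>\<^sub>C real) set" where
  "gens Y = insert unit_fun (ind ` Y)"

definition sub_C :: "'i set \<Rightarrow> ('b set discrete \<Rightarrow>\<^sub>C real) set" where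
  "sub_C Y = closure (span (gens Y))"

lemma gens_subset_cut_C: "gens Y \<subseteq> cut_C"
  unfolding gens_def by auto

lemma subspace_sub_C: "subspace (sub_C Y)"
  unfolding sub_C_def by (intro subspace_closure subspace_span)

lemma closed_sub_C: "closed (sub_C Y)"
  unfolding sub_C_def by simp

lemma sub_C_subset_cut_C: "sub_C Y \<subseteq> cut_C"
  unfolding sub_C_def
  by (intro closure_span_subset subspace_cfun_space closed_cfun_space gens_subset_cut_C)

lemma gens_subset_sub_C: "gens Y \<subseteq> sub_C Y"
  unfolding sub_C_def using closure_subset span_superset by (meson order_trans)

lemma ind_in_sub_C: "x \<in> Y \<Longrightarrow> ind x \<in> sub_C Y"
  and unit_fun_in_sub_C: "unit_fun \<in> sub_C Y"
  using gens_subset_sub_C by (auto simp: gens_def)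

lemma sub_C_mono: "Y \<subseteq> Z \<Longrightarrow> sub_C Y \<subseteq> sub_C Z"
  unfolding sub_C_def gens_def by (intro closure_mono span_mono) auto

lemma ex_step_fun:
  fixes \<phi> :: "'i set \<Rightarrow> real"
  assumes "finite F"
  shows "\<exists>s\<in>span (gens F). \<forall>I. segment I \<longrightarrow> val s I = \<phi> (I \<inter> F)"
  using assms
proof (induction F rule: finite_linorder_max_induct)
  case empty
  have "\<phi> {} *\<^sub>R unit_fun \<in> span (gens {})" by (auto simp: gens_def intro: span_scale span_base)
  then show ?case by (intro bexI[of _ "\<phi> {} *\<^sub>R unit_fun"]) auto
next
  case (insert m F)
  then obtain s where s: "s \<in> span (gens F)" "\<And>I. segment I \<Longrightarrow> val s I = \<phi> (I \<inter> F)" by blast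
  \<comment> \<open>\<open>m\<close> is the maximum, so a segment containing it contains all of
    \<open>F\<close>. Adding \<open>m\<close> thus creates the single new trace
    \<open>insert m F\<close>, and one coefficient corrects the value there.\<close>
  let ?t = "s + (\<phi> (insert m F) - \<phi> F) *\<^sub>R ind m"
  have "gens F \<subseteq> gens (insert m F)" by (auto simp: gens_def)
  then have "s \<in> span (gens (insert m F))" using s(1) span_mono by blast
  moreover have "ind m \<in> gens (insert m F)" by (simp add: gens_def)
  ultimately have "?t \<in> span (gens (insert m F))"
    by (intro span_add span_scale span_base[of "ind m"])
  moreover have "val ?t I = \<phi> (I \<inter> insert m F)" if I: "segment I" for I
  proof (cases "m \<in> I")
    case True
    then have "F \<subseteq> I" using insert.hyps segmentD[OF I] by (meson less_imp_le subsetI)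
    then have "I \<inter> F = F" "I \<inter> insert m F = insert m F" using True by auto
    then show ?thesis using True I s(2)[OF I] by simp
  next
    case False
    then show ?thesis using I s(2)[OF I] by simp
  qed
  ultimately show ?case by blast
qed

lemma cut_C_approx:
  assumes f: "f \<in> cut_C" and e: "0 < \<epsilon>"
  obtains s where "s \<in> span (gens UNIV)" "norm (f - s) \<le> \<epsilon>"
proof -
  obtain F where F: "finite F"
    "\<And>I J. segment I \<Longrightarrow> segment J \<Longrightarrow> I \<inter> F = J \<inter> F \<Longrightarrow> \<bar>val f I - val f J\<bar> < \<epsilon>"
    using cut_C_uniform[OF f e] by blast
  define rep where "rep G = (SOME J. segment J \<and> J \<inter> F = G)" for G
  have rep: "segment (rep (I \<inter> F)) \<and> rep (I \<inter> F) \<inter> F = I \<inter> F" if "segment I" for I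
    unfolding rep_def by (rule someI_ex) (use that in blast)
  obtain s where s: "s \<in> span (gens F)" "\<And>I. segment I \<Longrightarrow> val s I = val f (rep (I \<inter> F))"
    using ex_step_fun[OF F(1), of "\<lambda>G. val f (rep G)"] by blast
  have "span (gens F) \<subseteq> span (gens UNIV)" by (intro span_mono) (auto simp: gens_def)
  then have s': "s \<in> span (gens UNIV)" using s(1) by blast
  have "s \<in> cut_C" using s' span_minimal[OF gens_subset_cut_C subspace_cfun_space] by blast
  then have "norm (f - s) \<le> \<epsilon>"
  proof (intro norm_le_val)
    fix I :: "'i set" assume I: "segment I"
    show "\<bar>val (f - s) I\<bar> \<le> \<epsilon>"
      using F(2)[OF I, of "rep (I \<inter> F)"] rep[OF I] s(2)[OF I] by simp
  qed (use f subspace_diff[OF subspace_cfun_space] in blast)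
  then show ?thesis using that s' by blast
qed

lemma sub_C_UNIV: "sub_C UNIV = cut_C"
proof
  show "cut_C \<subseteq> sub_C UNIV"
  proof
    fix f assume f: "f \<in> cut_C"
    show "f \<in> sub_C UNIV"
      unfolding sub_C_def closure_approachable
    proof (intro allI impI)
      fix e :: real assume "0 < e"
      then obtain s where "s \<in> span (gens UNIV)" "norm (f - s) \<le> e / 2"
        using cut_C_approx[OF f, of "e / 2"] by auto
      then show "\<exists>s\<in>span (gens UNIV). dist s f < e"
        using \<open>0 < e\<close> by (intro bexI[of _ s]) (auto simp: dist_norm norm_minus_commute)
    qed
  qed
qed (rule sub_C_subset_cut_C)

text \<open>The generators of \<open>sub_C Y\<close> only see the trace on \<open>Y\<close>. In
  particular, no function in \<open>sub_C Y\<close> jumps from \<open>{..<x}\<close> to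
  \<open>{..x}\<close> at a point \<open>x\<close> outside \<open>Y\<close>.\<close>

lemma sub_C_const:
  assumes f: "f \<in> sub_C Y" and IJ: "segment I" "segment J" "I \<inter> Y = J \<inter> Y"
  shows "val f I = val f J"
proof -
  have "subspace {f. val f I = val f J}" by (auto simp: subspace_def)
  moreover have "closed {f. val f I = val f J}"
  proof -
    have "\<bar>val f L - val h L\<bar> \<le> norm (f - h)" for f h L using abs_val_le[of "f - h" L] by simp
    then have "1-lipschitz_on UNIV (\<lambda>f. val f L)" for L
      by (intro lipschitz_onI) (auto simp: dist_norm)
    then have "continuous_on UNIV (\<lambda>f. val f L)" for L by (rule lipschitz_on_continuous_on)
    then show ?thesis by (intro closed_Collect_eq)
  qed
  moreover have "gens Y \<subseteq> {f. val f I = val f J}"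
  proof -
    have "y \<in> I \<longleftrightarrow> y \<in> J" if "y \<in> Y" for y using IJ(3) that by blast
    then show ?thesis using IJ(1,2) by (auto simp: gens_def)
  qed
  ultimately have "sub_C Y \<subseteq> {f. val f I = val f J}"
    unfolding sub_C_def by (rule closure_span_subset)
  then show ?thesis using f by blast
qed

lemma span_gens_finite:
  assumes "s \<in> span (gens Y)"
  shows "\<exists>F. finite F \<and> F \<subseteq> Y \<and> s \<in> sub_C F"
proof -
  obtain D where D: "finite D" "D \<subseteq> gens Y" "s \<in> span D" using in_span_finite[OF assms] by auto
  have "D - {unit_fun} \<subseteq> ind ` Y" using D(2) by (auto simp: gens_def)
  then obtain F where F: "F \<subseteq> Y" "finite F" "D - {unit_fun} = ind ` F"
    using D(1) finite_subset_image[of "D - {unit_fun}" ind Y] by auto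
  then have "D \<subseteq> gens F" by (auto simp: gens_def)
  then have "span D \<subseteq> sub_C F" unfolding sub_C_def by (meson closure_subset order_trans span_mono)
  then show ?thesis using F D by auto
qed

lemma sub_C_in_Sep:
  assumes "countable Y"
  shows "sub_C Y \<in> Sep cut_C"
  unfolding Sep_def
  using assms sub_C_subset_cut_C subspace_sub_C closed_sub_C separable_closure_span[of "gens Y"]
  by (auto simp: sub_C_def gens_def)

lemma Sep_subset_sub_C:
  assumes "S \<in> Sep cut_C"
  obtains Y where "countable Y" "S \<subseteq> sub_C Y"
proof -
  have "S \<subseteq> closure (span (gens UNIV))" "separable_space (top_of_set S)"
    using assms sub_C_UNIV unfolding Sep_def sub_C_def by auto
  then obtain D where D: "countable D" "D \<subseteq> gens UNIV" "S \<subseteq> closure (span D)"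
    using separable_subset_closure_span by metis
  have "D - {unit_fun} \<subseteq> range ind" using D(2) by (auto simp: gens_def)
  then obtain Y where Y: "countable Y" "D - {unit_fun} = ind ` Y"
    using D(1) by (metis countable_Diff countable_subset_image)
  then have "D \<subseteq> gens Y" by (auto simp: gens_def)
  then have "closure (span D) \<subseteq> sub_C Y" unfolding sub_C_def by (intro closure_mono span_mono)
  then show ?thesis using that Y D by blast
qed

lemma sub_C_UN:
  assumes F: "\<And>n. F n = sub_C (Y n)" and ne: "A \<noteq> {}"
  shows "closure (span (\<Union>n\<in>A. F n)) = sub_C (\<Union>n\<in>A. Y n)"
proof
  have "F n \<subseteq> sub_C (\<Union>n\<in>A. Y n)" if "n \<in> A" for n
    unfolding F using that by (intro sub_C_mono) auto
  then show "closure (span (\<Union>n\<in>A. F n)) \<subseteq> sub_C (\<Union>n\<in>A. Y n)"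
    by (intro closure_span_subset subspace_sub_C closed_sub_C) auto
  have "gens (\<Union>n\<in>A. Y n) \<subseteq> (\<Union>n\<in>A. F n)"
    unfolding gens_def using ind_in_sub_C unit_fun_in_sub_C ne by (auto simp: F)
  then show "sub_C (\<Union>n\<in>A. Y n) \<subseteq> closure (span (\<Union>n\<in>A. F n))"
    unfolding sub_C_def by (intro closure_mono span_mono)
qed

text \<open>The functionals \<open>\<Lambda> I\<close> play the part of the adjoint at point
  evaluations: \<open>P f\<close> is defined cut by cut. Continuity of \<open>P f\<close> in the cut
  is not assumed. It holds on generators through \<open>T\<close>, and passes to all of C(K) because
  \<open>P\<close> is bounded and \<open>sub_C Y\<close> is a closed subspace. Both kinds of
  projection constructed below come from this lemma.\<close>

lemma ex_projection:
  fixes T :: "'i \<Rightarrow> ('b set discrete \<Rightarrow>\<^sub>C real)"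
    and \<Lambda> :: "'i set \<Rightarrow> ('b set discrete \<Rightarrow>\<^sub>C real) \<Rightarrow> real"
  assumes add: "\<And>I f h. segment I \<Longrightarrow> \<Lambda> I (f + h) = \<Lambda> I f + \<Lambda> I h"
    and scale: "\<And>I c f. segment I \<Longrightarrow> \<Lambda> I (c *\<^sub>R f) = c * \<Lambda> I f"
    and bound: "\<And>I f. segment I \<Longrightarrow> \<bar>\<Lambda> I f\<bar> \<le> M * norm f"
    and unit: "\<And>I. segment I \<Longrightarrow> \<Lambda> I unit_fun = 1"
    and gen: "\<And>I x. segment I \<Longrightarrow> \<Lambda> I (ind x) = val (T x) I"
    and T: "\<And>x. T x \<in> sub_C Y" "\<And>x. x \<in> Y \<Longrightarrow> T x = ind x"
  obtains P where "projection_on cut_C P" "\<And>f. f \<in> cut_C \<Longrightarrow> norm (P f) \<le> M * norm f"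
    "P ` cut_C = sub_C Y" "P unit_fun = unit_fun" "\<And>x. P (ind x) = T x"
proof -
  define P where "P f = mk (\<lambda>I. \<Lambda> I f)" for f
  have val_P: "val (P f) I = \<Lambda> I f" if "segment I" for f I
    unfolding P_def by (rule val_mk[OF bound that])
  have outside: "apply_bcontfun (P f) (discrete A) = 0" if "A \<notin> cuts" for f A
    unfolding P_def using that by (simp add: apply_mk[of "\<lambda>I. \<Lambda> I f", OF bound] discrete_inverse)
  have eqI: "p = q" if "\<And>A. A \<notin> cuts \<Longrightarrow> apply_bcontfun p (discrete A) = 0"
    "\<And>A. A \<notin> cuts \<Longrightarrow> apply_bcontfun q (discrete A) = 0"
    "\<And>I. segment I \<Longrightarrow> val p I = val q I" for p q
  proof (rule bcontfun_eqI)
    fix y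
    show "apply_bcontfun p y = apply_bcontfun q y"
    proof (cases "of_discrete y \<in> cuts")
      case True
      then obtain I where "segment I" "of_discrete y = g ` I" by (rule cutsE)
      then show ?thesis using that(3)[of I] unfolding val_def by (metis of_discrete_inverse)
    next
      case False
      then show ?thesis using that(1,2)[of "of_discrete y"] by (simp add: of_discrete_inverse)
    qed
  qed
  have P_add: "P (f + h) = P f + P h" for f h
    by (rule eqI) (auto simp: val_P outside add)
  have P_scale: "P (c *\<^sub>R f) = c *\<^sub>R P f" for c f
    by (rule eqI) (auto simp: val_P outside scale)
  have P_bound: "norm (P f) \<le> M * norm f" for f
  proof (rule norm_bound)
    fix y
    have "0 \<le> \<bar>\<Lambda> {} f\<bar>" by simp
    also have "... \<le> M * norm f" by (rule bound) simp
    finally have nn: "0 \<le> M * norm f" .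
    show "norm (apply_bcontfun (P f) y) \<le> M * norm f"
    proof (cases "of_discrete y \<in> cuts")
      case True
      then obtain I where "segment I" "of_discrete y = g ` I" by (rule cutsE)
      then show ?thesis
        using bound[of I f] val_P[of I f] unfolding val_def by (metis of_discrete_inverse real_norm_def)
    next
      case False
      then show ?thesis using outside[of "of_discrete y"] nn by (simp add: of_discrete_inverse)
    qed
  qed
  have P_unit: "P unit_fun = unit_fun"
    by (rule eqI) (auto simp: val_P outside unit cut_C_outside)
  have P_ind: "P (ind x) = T x" for x
  proof (rule eqI)
    show "apply_bcontfun (T x) (discrete A) = 0" if "A \<notin> cuts" for A
      using T(1)[of x] sub_C_subset_cut_C that by (intro cut_C_outside) auto
  qed (auto simp: val_P outside gen)
  have bl: "bounded_linear_on cut_C P"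
    unfolding bounded_linear_on_def using P_add P_scale P_bound by blast
  have into: "P f \<in> sub_C Y" if "f \<in> cut_C" for f
  proof (rule bounded_linear_on_closure_span[OF subspace_cfun_space closed_cfun_space bl
        subspace_sub_C closed_sub_C gens_subset_cut_C])
    show "f \<in> closure (span (gens UNIV))" using that sub_C_UNIV unfolding sub_C_def by simp
    show "P x \<in> sub_C Y" if "x \<in> gens UNIV" for x
      using that T(1) P_unit P_ind unit_fun_in_sub_C by (auto simp: gens_def)
  qed
  have id: "P f = f" if "f \<in> sub_C Y" for f
  proof (rule bounded_linear_on_eq_closure_span[OF subspace_cfun_space closed_cfun_space bl _
        gens_subset_cut_C])
    show "f \<in> closure (span (gens Y))" using that unfolding sub_C_def by simp
    show "P x = x" if "x \<in> gens Y" for x using that T(2) P_unit P_ind by (auto simp: gens_def)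
    show "bounded_linear_on cut_C (\<lambda>x. x)"
      unfolding bounded_linear_on_def by (auto intro: exI[of _ 1])
  qed
  have im: "P ` cut_C = sub_C Y"
  proof
    show "sub_C Y \<subseteq> P ` cut_C"
      using id sub_C_subset_cut_C by (metis image_eqI subsetD subsetI)
  qed (use into in blast)
  have "projection_on cut_C P"
    unfolding projection_on_def using bl into id sub_C_subset_cut_C by blast
  then show ?thesis using that P_bound im P_unit P_ind by blast
qed

text \<open>\<open>ind (a i) - ind (b i)\<close> is the indicator of the cuts that contain
  \<open>a i\<close> but not \<open>b i\<close>. These sets are disjoint for different
  \<open>i\<close>, so at each cut at most one summand survives.\<close>

lemma norm_disjoint_sum:
  assumes F: "finite F" and eps: "\<And>i. i \<in> F \<Longrightarrow> \<bar>\<epsilon> i\<bar> \<le> 1"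
    and le: "\<And>i. i \<in> F \<Longrightarrow> a i \<le> b i"
    and disj: "\<And>i j. i \<in> F \<Longrightarrow> j \<in> F \<Longrightarrow> i \<noteq> j \<Longrightarrow> b i \<le> a j \<or> b j \<le> a i"
  shows "norm (\<Sum>i\<in>F. \<epsilon> i *\<^sub>R (ind (a i) - ind (b i))) \<le> 1"
proof (rule norm_le_val)
  show "(\<Sum>i\<in>F. \<epsilon> i *\<^sub>R (ind (a i) - ind (b i))) \<in> cut_C"
    by (intro subspace_sum subspace_cfun_space subspace_scale subspace_diff) auto
  fix I :: "'i set" assume I: "segment I"
  let ?h = "\<lambda>i. if a i \<in> I \<and> b i \<notin> I then \<epsilon> i else 0"
  have "val (\<Sum>i\<in>F. \<epsilon> i *\<^sub>R (ind (a i) - ind (b i))) I = (\<Sum>i\<in>F. ?h i)"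
    unfolding val_sum by (rule sum.cong) (use I le segmentD[OF I] in auto)
  moreover have "\<bar>\<Sum>i\<in>F. ?h i\<bar> \<le> 1"
  proof (cases "\<exists>i\<in>F. a i \<in> I \<and> b i \<notin> I")
    case True
    then obtain i where i: "i \<in> F" "a i \<in> I" "b i \<notin> I" by blast
    have "?h j = 0" if "j \<in> F - {i}" for j
      using that disj[of i j] i segmentD[OF I] by auto
    then have "(\<Sum>j\<in>F. ?h j) = ?h i"
      using i(1) F by (subst sum.remove[of F i]) auto
    then show ?thesis using eps i by simp
  next
    case False
    then have "(\<Sum>i\<in>F. ?h i) = 0" by (intro sum.neutral) auto
    then show ?thesis by simp
  qed
  ultimately show "\<bar>val (\<Sum>i\<in>F. \<epsilon> i *\<^sub>R (ind (a i) - ind (b i))) I\<bar> \<le> 1" by simp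
qed

end

section \<open>A lexicographic order with ladders\<close>

definition rk :: "omega1 \<Rightarrow> nat" where
  "rk = (SOME rk. \<forall>n. stationary {d. rk d = n})"

lemma stationary_rk: "stationary {d. rk d = n}"
  using someI_ex[OF ex_rank_function] unfolding rk_def by blast

definition ladder :: "omega1 \<Rightarrow> nat \<Rightarrow> omega1" where
  "ladder d = (SOME f. (\<forall>n. f n < f (Suc n)) \<and> (\<forall>n. f n < d) \<and> (\<forall>a<d. \<exists>n. a < f n))"

lemma ladder:
  assumes d: "limit1 d"
  shows "strict_mono (ladder d)" "ladder d n < d" "a < d \<Longrightarrow> \<exists>n. a < ladder d n"
proof -
  have "\<exists>c\<in>UNIV. a < c \<and> c < d" if "a < d" for a
    using d that unfolding limit1_def by (intro bexI[of _ "suc1 a"]) auto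
  then obtain f :: "nat \<Rightarrow> omega1" where "\<And>n. f n < f (Suc n)" "\<And>n. f n < d"
      "\<And>a. a < d \<Longrightarrow> \<exists>n. a < f n"
    using limit1_cofinal_sequence[OF d, of UNIV] by auto
  then have "\<exists>f :: nat \<Rightarrow> omega1. (\<forall>n. f n < f (Suc n)) \<and> (\<forall>n. f n < d) \<and> (\<forall>a<d. \<exists>n. a < f n)"
    by auto
  from someI_ex[OF this, folded ladder_def]
  have *: "(\<forall>n. ladder d n < ladder d (Suc n)) \<and> (\<forall>n. ladder d n < d) \<and> (\<forall>a<d. \<exists>n. a < ladder d n)" .
  then show "strict_mono (ladder d)" by (simp add: strict_mono_Suc_iff)
  show "ladder d n < d" "a < d \<Longrightarrow> \<exists>n. a < ladder d n" using * by auto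
qed

text \<open>
  The ladder is cut into blocks of three rungs. A branch takes the middle rung of all but
  finitely many blocks, so that every branch with a spare modification is approached from below
  and from above by branches with one more.
\<close>

definition mods :: "(nat \<Rightarrow> nat) \<Rightarrow> nat set" where
  "mods y = {k. y k \<noteq> 1}"

definition patterns :: "nat \<Rightarrow> (nat \<Rightarrow> nat) set" where
  "patterns n = {y. (\<forall>k. y k \<le> 2) \<and> finite (mods y) \<and> card (mods y) \<le> n}"

definition branch :: "omega1 \<Rightarrow> (nat \<Rightarrow> nat) \<Rightarrow> nat \<Rightarrow> omega1" where
  "branch d y = (\<lambda>k. ladder d (3 * k + y k))"

definition finitary :: "(nat \<Rightarrow> omega1) \<Rightarrow> bool" where
  "finitary f \<longleftrightarrow> (\<exists>n. \<forall>k\<ge>n. f k = zero1)"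

text \<open>Finite sequences are padded with \<^const>\<open>zero1\<close>, the least ordinal.\<close>

typedef seq = "{f. finitary f \<or> (\<exists>d. limit1 d \<and> f \<in> branch d ` patterns (rk d))}"
  morphisms entry Abs_seq
  by (rule exI[of _ "\<lambda>_. zero1"]) (auto simp: finitary_def)

section \<open>Lexicographic comparison of initial parts\<close>

definition agree :: "nat \<Rightarrow> seq \<Rightarrow> seq \<Rightarrow> bool" where
  "agree k x y \<longleftrightarrow> (\<forall>i<k. entry x i = entry y i)"

definition less_upto :: "nat \<Rightarrow> seq \<Rightarrow> seq \<Rightarrow> bool" where
  "less_upto k x y \<longleftrightarrow> (\<exists>i<k. agree i x y \<and> entry x i < entry y i)"

lemma agree_sym: "agree k x y \<Longrightarrow> agree k y x"
  and agree_trans: "agree k x y \<Longrightarrow> agree k y z \<Longrightarrow> agree k x z"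
  and agree_mono: "agree k x y \<Longrightarrow> j \<le> k \<Longrightarrow> agree j x y"
  by (auto simp: agree_def)

lemma agree_imp_eq: "(\<And>k. agree k x y) \<Longrightarrow> x = y"
  by (metis agree_def entry_inject lessI ext)

lemma first_difference:
  assumes "\<not> agree k x y"
  obtains i where "i < k" "agree i x y" "entry x i \<noteq> entry y i"
proof -
  define i where "i = (LEAST i. entry x i \<noteq> entry y i)"
  obtain j where j: "j < k" "entry x j \<noteq> entry y j" using assms by (auto simp: agree_def)
  have "entry x i \<noteq> entry y i" unfolding i_def by (rule LeastI[of _ j]) (rule j(2))
  moreover have "i \<le> j" unfolding i_def by (rule Least_le) (rule j(2))
  moreover have "agree i x y" unfolding agree_def i_def using not_less_Least by blast
  ultimately show ?thesis using that[of i] j(1) by simp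
qed

lemma less_upto_mono: "less_upto j x y \<Longrightarrow> j \<le> k \<Longrightarrow> less_upto k x y"
  unfolding less_upto_def by (meson order_less_le_trans)

lemma less_upto_cases: "less_upto k x y \<or> less_upto k y x \<or> agree k x y"
proof (cases "agree k x y")
  case False
  then obtain i where "i < k" "agree i x y" "entry x i \<noteq> entry y i" by (rule first_difference)
  then show ?thesis unfolding less_upto_def by (metis agree_sym neqE)
qed simp

lemma less_upto_agree:
  "less_upto k x y \<Longrightarrow> agree k x x' \<Longrightarrow> agree k y y' \<Longrightarrow> less_upto k x' y'"
  unfolding less_upto_def agree_def by (metis order_less_trans)

lemma less_upto_trans:
  assumes "less_upto j x y" "less_upto k y z"
  shows "less_upto (min j k) x z"
proof -
  obtain i where i: "i < j" "agree i x y" "entry x i < entry y i"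
    using assms(1) by (auto simp: less_upto_def)
  obtain l where l: "l < k" "agree l y z" "entry y l < entry z l"
    using assms(2) by (auto simp: less_upto_def)
  have "agree (min i l) x z" "entry x (min i l) < entry z (min i l)"
    using i l unfolding agree_def by (auto simp: min_def)
      (metis linorder_le_less_linear order_le_imp_less_or_eq order_less_trans)+
  moreover have "min i l < min j k" using i(1) l(1) by auto
  ultimately show ?thesis unfolding less_upto_def by blast
qed

instantiation seq :: linorder
begin

definition less_seq :: "seq \<Rightarrow> seq \<Rightarrow> bool"
  where "x < y \<longleftrightarrow> (\<exists>k. less_upto k x y)"

definition less_eq_seq :: "seq \<Rightarrow> seq \<Rightarrow> bool"
  where "x \<le> y \<longleftrightarrow> x = y \<or> x < (y :: seq)"

instance
proof
  have trans: "x < z" if "x < y" "y < z" for x y z :: seq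
    using that unfolding less_seq_def by (metis less_upto_trans)
  have irrefl: "\<not> x < x" for x :: seq
    unfolding less_seq_def less_upto_def by simp
  have total: "x = y \<or> x < y \<or> y < x" for x y :: seq
    unfolding less_seq_def using less_upto_cases agree_imp_eq by metis
  fix x y z :: seq
  show "(x < y) = (x \<le> y \<and> \<not> y \<le> x)" unfolding less_eq_seq_def by (metis trans irrefl)
  show "x \<le> x" unfolding less_eq_seq_def by simp
  show "x \<le> y \<Longrightarrow> y \<le> z \<Longrightarrow> x \<le> z" unfolding less_eq_seq_def by (metis trans)
  show "x \<le> y \<Longrightarrow> y \<le> x \<Longrightarrow> x = y" unfolding less_eq_seq_def by (metis trans irrefl)
  show "x \<le> y \<or> y \<le> x" unfolding less_eq_seq_def by (metis total)
qed

end

lemma less_upto_imp_less: "less_upto k x y \<Longrightarrow> x < y"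
  unfolding less_seq_def by blast

lemma le_imp_not_less_upto: "x \<le> y \<Longrightarrow> \<not> less_upto k y x"
  using less_upto_imp_less by fastforce

text \<open>The comparison with \<open>z\<close> is settled among the first \<open>k\<close>
  entries, which \<open>x\<close> and \<open>x'\<close> share.\<close>

lemma less_iff_of_agree:
  assumes "agree k x x'" "\<not> agree k z x"
  shows "z < x \<longleftrightarrow> z < x'" "x < z \<longleftrightarrow> x' < z"
proof -
  have z: "agree k z z" by (simp add: agree_def)
  have nz: "\<not> agree k z x'" using assms agree_sym agree_trans by blast
  consider "less_upto k z x" | "less_upto k x z" using less_upto_cases assms(2) by blast
  then have "(z < x \<and> z < x') \<or> (x < z \<and> x' < z)"
    using less_upto_agree[OF _ z assms(1)] less_upto_agree[OF _ assms(1) z] less_upto_imp_less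
    by cases blast+
  then show "z < x \<longleftrightarrow> z < x'" "x < z \<longleftrightarrow> x' < z" by auto
qed

text \<open>Padding with the least ordinal puts a finite sequence below everything that extends
  it.\<close>

lemma le_of_agree_zero:
  assumes "agree k x y" "\<And>i. i \<ge> k \<Longrightarrow> entry x i = zero1"
  shows "x \<le> y"
proof (rule ccontr)
  assume "\<not> x \<le> y"
  then obtain j where "less_upto j y x" by (auto simp: not_le less_seq_def)
  then obtain i where i: "agree i y x" "entry y i < entry x i" by (auto simp: less_upto_def)
  then have "k \<le> i" using assms(1) by (auto simp: agree_def not_less[symmetric])
  then show False using assms(2)[of i] i(2) zero1_le[of "entry y i"] by (simp add: not_le[symmetric])
qed

section \<open>Truncations and successors of finite sequences\<close>

definition trunc :: "nat \<Rightarrow> (nat \<Rightarrow> omega1) \<Rightarrow> seq" where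
  "trunc n f = Abs_seq (\<lambda>k. if k < n then f k else zero1)"

lemma entry_trunc [simp]: "entry (trunc n f) k = (if k < n then f k else zero1)"
proof -
  have "finitary (\<lambda>k. if k < n then f k else zero1)"
    unfolding finitary_def by (intro exI[of _ n]) auto
  then show ?thesis unfolding trunc_def by (subst Abs_seq_inverse) auto
qed

lemma agree_trunc: "j \<le> k \<Longrightarrow> agree j (trunc k (entry x)) x"
  by (auto simp: agree_def)

text \<open>For \<open>k > 0\<close> this is the least element above every sequence with the same
  first \<open>k\<close> entries as \<open>x\<close>. A segment contains it exactly if some member
  exceeds \<open>x\<close> within the first \<open>k\<close> entries, so a single \<open>ind\<close>
  tests that condition.\<close>

definition inc :: "nat \<Rightarrow> seq \<Rightarrow> seq" where
  "inc k x = trunc k ((entry x)(k - 1 := suc1 (entry x (k - 1))))"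

lemma less_upto_inc: "k > 0 \<Longrightarrow> less_upto k x (inc k x)"
  unfolding less_upto_def inc_def agree_def by (intro exI[of _ "k - 1"]) auto

lemma inc_le:
  assumes "less_upto k x y"
  shows "inc k x \<le> y"
proof -
  obtain i where i: "i < k" "agree i x y" "entry x i < entry y i"
    using assms by (auto simp: less_upto_def)
  have ag: "agree i (inc k x) y" using i(1,2) by (auto simp: inc_def agree_def)
  show ?thesis
  proof (cases "entry (inc k x) i < entry y i")
    case True
    then have "less_upto (Suc i) (inc k x) y" using ag unfolding less_upto_def by blast
    then show ?thesis using less_upto_imp_less by fastforce
  next
    case False
    \<comment> \<open>Before its last position \<open>inc k x\<close> copies \<open>x\<close>, so a
      tie with \<open>y\<close> is possible only there.\<close>
    have "i = k - 1"
    proof (rule ccontr)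
      assume "i \<noteq> k - 1"
      then have "entry (inc k x) i = entry x i" using i(1) by (simp add: inc_def)
      then show False using False i(3) by simp
    qed
    then have "entry (inc k x) i = suc1 (entry x i)" using i(1) by (simp add: inc_def)
    then have "entry (inc k x) i = entry y i"
      using False i(3) by (simp add: antisym not_less)
    then have "agree k (inc k x) y"
      using ag i(1) \<open>i = k - 1\<close> unfolding agree_def
      by (metis Suc_pred' less_antisym not_gr_zero not_less0 not_less_eq)
    then show ?thesis by (rule le_of_agree_zero) (simp add: inc_def)
  qed
qed

lemma inc_in_segment_iff:
  assumes "segment J" "k > 0"
  shows "inc k x \<in> J \<longleftrightarrow> (\<exists>y\<in>J. less_upto k x y)"
  using less_upto_inc[OF assms(2)] inc_le segmentD[OF assms(1)] by blast

section \<open>Bounded sequences and branches cofinal in a limit ordinal\<close>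

definition bounded_by :: "omega1 \<Rightarrow> seq set" where
  "bounded_by c = {x. \<forall>k. entry x k \<le> c}"

text \<open>The bound is uniform in the entries. For a limit ordinal \<open>d\<close>, a branch of
  \<open>d\<close> has all entries less than \<open>d\<close> and is still excluded; by
  \<open>below_or_branches\<close> nothing else with entries less than \<open>d\<close> is
  lost.\<close>

definition below :: "omega1 \<Rightarrow> seq set" where
  "below d = (\<Union>c\<in>{..<d}. bounded_by c)"

definition branches :: "omega1 \<Rightarrow> seq set" where
  "branches d = {x. entry x \<in> branch d ` patterns (rk d)}"

lemma branch_less: "limit1 d \<Longrightarrow> branch d y k < d"
  by (simp add: branch_def ladder)

lemma branch_cofinal:
  assumes "limit1 d" "a < d"
  shows "\<exists>k. a < branch d y k"
proof -
  obtain n where "a < ladder d n" using ladder(3)[OF assms] by blast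
  also have "ladder d n \<le> branch d y n"
    unfolding branch_def using strict_mono_less_eq[OF ladder(1)[OF assms(1)]] by simp
  finally show ?thesis by blast
qed

lemma bounded_finitely_many:
  fixes f :: "nat \<Rightarrow> omega1"
  assumes "limit1 d" "\<And>i. i < n \<Longrightarrow> f i < d"
  shows "\<exists>c<d. \<forall>i<n. f i \<le> c"
  using assms(2)
proof (induction n)
  case 0
  then show ?case using assms(1) by (auto simp: limit1_def)
next
  case (Suc n)
  then obtain c where "c < d" "\<forall>i<n. f i \<le> c" by auto
  then show ?case using Suc(2)[of n]
    by (intro exI[of _ "max c (f n)"]) (auto simp: less_Suc_eq le_max_iff_disj)
qed

lemma trunc_in_below:
  fixes f :: "nat \<Rightarrow> omega1"
  assumes "limit1 d" "\<And>i. i < n \<Longrightarrow> f i < d"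
  shows "trunc n f \<in> below d"
proof -
  obtain c where "c < d" "\<forall>i<n. f i \<le> c" using bounded_finitely_many[of d n f] assms by auto
  then show ?thesis by (auto simp: below_def bounded_by_def)
qed

lemma inc_in_below:
  assumes "limit1 d" "\<And>i. i < k \<Longrightarrow> entry x i < d"
  shows "inc k x \<in> below d"
  unfolding inc_def
  by (rule trunc_in_below[OF assms(1)]) (use assms in \<open>auto simp: limit1_def\<close>)

lemma branches_not_below:
  assumes "limit1 d" "x \<in> branches d"
  shows "x \<notin> below d"
proof
  assume "x \<in> below d"
  then obtain c where c: "c < d" "\<And>k. entry x k \<le> c" by (auto simp: below_def bounded_by_def)
  obtain y where "entry x = branch d y" using assms(2) by (auto simp: branches_def)
  then show False using branch_cofinal[OF assms(1) c(1), of y] c(2) by (auto simp: not_less[symmetric])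
qed

lemma seq_cases:
  obtains "finitary (entry x)" | d where "limit1 d" "x \<in> branches d"
  using entry[of x] by (auto simp: branches_def)

text \<open>A finite sequence has a largest entry. A branch of some \<open>d'\<close> can have all
  entries less than \<open>d\<close> only if \<open>d'\<close> is at most \<open>d\<close>, and for
  \<open>d' < d\<close> it is bounded by \<open>d'\<close>.\<close>

lemma below_or_branches:
  assumes d: "limit1 d" and x: "\<And>k. entry x k < d"
  shows "x \<in> below d \<or> x \<in> branches d"
proof (cases rule: seq_cases[of x])
  case 1
  then obtain n where n: "\<forall>k\<ge>n. entry x k = zero1" by (auto simp: finitary_def)
  then have "x = trunc n (entry x)"
    by (intro agree_imp_eq) (auto simp: agree_def)
  then show ?thesis using trunc_in_below[OF d] x by metis
next
  case (2 d')
  then obtain y where y: "entry x = branch d' y" by (auto simp: branches_def)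
  have "\<not> d < d'"
    using branch_cofinal[OF 2(1), of d y] x y by (metis order_less_asym)
  then consider "d' = d" | "d' < d" by (meson linorder_cases)
  then show ?thesis
  proof cases
    case lt: 2
    then have "x \<in> bounded_by d'" using branch_less[OF 2(1), of y] y
      by (simp add: bounded_by_def less_imp_le)
    then show ?thesis using lt by (auto simp: below_def)
  qed (use 2 in simp)
qed

section \<open>Countability and cardinality\<close>

lemma countable_eventually_const:
  fixes A :: "'a set"
  assumes "countable A"
  shows "countable {f :: nat \<Rightarrow> 'a. (\<forall>k. f k \<in> A) \<and> (\<exists>n. \<forall>k\<ge>n. f k = a)}"
proof (rule countable_subset)
  show "{f :: nat \<Rightarrow> 'a. (\<forall>k. f k \<in> A) \<and> (\<exists>n. \<forall>k\<ge>n. f k = a)}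
      \<subseteq> (\<lambda>l k. if k < length l then l ! k else a) ` lists A"
  proof
    fix f :: "nat \<Rightarrow> 'a" assume "f \<in> {f. (\<forall>k. f k \<in> A) \<and> (\<exists>n. \<forall>k\<ge>n. f k = a)}"
    then obtain n where n: "\<And>k. f k \<in> A" "\<And>k. n \<le> k \<Longrightarrow> f k = a" by auto
    have "f = (\<lambda>k. if k < length (map f [0..<n]) then map f [0..<n] ! k else a)"
      using n(2) by auto
    then show "f \<in> (\<lambda>l k. if k < length l then l ! k else a) ` lists A"
      using n(1) by (intro image_eqI[of _ _ "map f [0..<n]"]) auto
  qed
  show "countable ((\<lambda>l k. if k < length l then l ! k else a) ` lists A)"
    using assms by (intro countable_image countable_lists)
qed

lemma countable_patterns: "countable (patterns n)"
proof (rule countable_subset)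
  show "patterns n \<subseteq> {f. (\<forall>k. f k \<in> UNIV) \<and> (\<exists>n. \<forall>k\<ge>n. f k = 1)}"
  proof
    fix y assume "y \<in> patterns n"
    then have "finite (mods y)" by (simp add: patterns_def)
    then obtain m where "\<forall>k\<in>mods y. k < m" using finite_nat_set_iff_bounded by blast
    then have "\<forall>k\<ge>m. y k = 1" by (auto simp: mods_def)
    then show "y \<in> {f. (\<forall>k. f k \<in> UNIV) \<and> (\<exists>n. \<forall>k\<ge>n. f k = 1)}" by auto
  qed
  show "countable {f :: nat \<Rightarrow> nat. (\<forall>k. f k \<in> UNIV) \<and> (\<exists>n. \<forall>k\<ge>n. f k = 1)}"
    by (rule countable_eventually_const) simp
qed

text \<open>A branch of \<open>d\<close> is bounded by \<open>c\<close> only if \<open>d\<close> is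
  at most \<open>c\<close>, so countably many ladders contribute, and each carries countably many
  patterns because a pattern is eventually 1.\<close>

lemma countable_bounded_by: "countable (bounded_by c)"
proof -
  let ?A = "{f :: nat \<Rightarrow> omega1. (\<forall>k. f k \<in> {..c}) \<and> (\<exists>n. \<forall>k\<ge>n. f k = zero1)}"
  let ?B = "\<Union>d\<in>{..c}. branch d ` patterns (rk d)"
  have "entry ` bounded_by c \<subseteq> ?A \<union> ?B"
  proof
    fix f assume "f \<in> entry ` bounded_by c"
    then obtain x where x: "f = entry x" "\<And>k. entry x k \<le> c" by (auto simp: bounded_by_def)
    show "f \<in> ?A \<union> ?B"
    proof (cases rule: seq_cases[of x])
      case 1
      then show ?thesis using x by (auto simp: finitary_def)
    next
      case (2 d)
      then obtain y where y: "y \<in> patterns (rk d)" "entry x = branch d y"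
        by (auto simp: branches_def)
      have "d \<le> c" using branch_cofinal[OF 2(1), of c y] x(2) y(2) by (metis leD leI)
      then show ?thesis using x y by auto
    qed
  qed
  moreover have "countable ?A"
    by (rule countable_eventually_const[OF countable_atMost_omega1])
  moreover have "countable ?B"
    using countable_atMost_omega1 countable_patterns by (intro countable_UN countable_image) auto
  ultimately have "countable (entry ` bounded_by c)" by (meson countable_Un countable_subset)
  then show ?thesis by (rule countable_image_inj_on) (simp add: inj_on_def entry_inject)
qed

lemma countable_below: "countable (below d)"
proof -
  have "countable {..<d}" by (rule countable_subset[OF _ countable_atMost_omega1[of d]]) auto
  then show ?thesis unfolding below_def using countable_bounded_by by blast
qed

lemma countable_subset_bounded_by:
  assumes "countable Y"
  obtains c where "Y \<subseteq> bounded_by c"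
proof -
  have "countable (\<Union>x\<in>Y. range (entry x))" using assms by auto
  then obtain c where "\<And>a. a \<in> (\<Union>x\<in>Y. range (entry x)) \<Longrightarrow> a < c"
    using countable_bounded_omega1 by metis
  then have "entry x k < c" if "x \<in> Y" for x k using that by auto
  then show ?thesis by (intro that[of c]) (auto simp: bounded_by_def less_imp_le)
qed

lemma card_of_countable_UN:
  assumes "\<And>c :: omega1. countable (A c)"
  shows "|\<Union>c. A c| \<le>o (cardSuc natLeq :: nat set rel)"
proof -
  have inf: "\<not> finite (UNIV :: omega1 set)" using uncountable_omega1 countable_finite by blast
  then have nat: "|UNIV :: nat set| \<le>o |UNIV :: omega1 set|"
    by (simp add: infinite_iff_card_of_nat)
  have "|A c| \<le>o |UNIV :: omega1 set|" for c
  proof -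
    have "|A c| \<le>o |UNIV :: nat set|"
      using assms[of c] card_of_ordLeq[of "A c" "UNIV :: nat set"] by (auto elim!: countableE)
    then show ?thesis using nat ordLeq_transitive by blast
  qed
  then have "|\<Union>c. A c| \<le>o |UNIV :: omega1 set|"
    by (intro card_of_UNION_ordLeq_infinite[OF inf]) (auto intro: card_of_mono1)
  then show ?thesis using card_of_omega1 ordLeq_ordIso_trans by blast
qed

lemma card_of_seq: "|UNIV :: seq set| =o (cardSuc natLeq :: nat set rel)"
proof -
  have "\<exists>c. x \<in> bounded_by c" for x
    using countable_subset_bounded_by[of "{x}"] by auto
  then have "UNIV = (\<Union>c. bounded_by c)" by auto
  then have "|UNIV :: seq set| \<le>o (cardSuc natLeq :: nat set rel)"
    using card_of_countable_UN[of bounded_by] countable_bounded_by by simp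
  moreover have "inj (\<lambda>a. trunc 1 (\<lambda>_. a))"
    by (rule injI) (metis entry_trunc zero_less_one)
  then have "|UNIV :: omega1 set| \<le>o |UNIV :: seq set|" using card_of_ordLeq by blast
  then have "(cardSuc natLeq :: nat set rel) \<le>o |UNIV :: seq set|"
    using card_of_omega1 ordIso_ordLeq_trans ordIso_symmetric by blast
  ultimately show ?thesis by (simp add: ordIso_iff_ordLeq)
qed

lemma card_of_finite_seq_sets: "|Collect finite :: seq set set| \<le>o (cardSuc natLeq :: nat set rel)"
proof -
  have "Collect finite = (\<Union>c. {F. finite F \<and> F \<subseteq> bounded_by c})"
  proof (intro equalityI subsetI)
    fix F :: "seq set" assume F: "F \<in> Collect finite"
    then obtain c where "F \<subseteq> bounded_by c" using countable_subset_bounded_by countable_finite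
      by (metis mem_Collect_eq)
    then show "F \<in> (\<Union>c. {F. finite F \<and> F \<subseteq> bounded_by c})" using F by auto
  qed auto
  then show ?thesis
    using card_of_countable_UN[of "\<lambda>c. {F. finite F \<and> F \<subseteq> bounded_by c}"]
      countable_Collect_finite_subset[OF countable_bounded_by] by simp
qed

text \<open>Elements of \<open>omega1\<close> are represented by sets of naturals, so an injection
  into \<open>omega1\<close> yields labels of type \<open>nat set\<close>, and cuts become points of
  the prescribed type.\<close>

lemma ex_inj_seq: "\<exists>g :: seq \<Rightarrow> nat set. inj g"
proof -
  have "|UNIV :: seq set| \<le>o |UNIV :: omega1 set|"
    by (rule ordIso_imp_ordLeq[OF ordIso_transitive[OF card_of_seq ordIso_symmetric[OF card_of_omega1]]])
  then obtain h :: "seq \<Rightarrow> omega1" where "inj h"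
    using card_of_ordLeq[of "UNIV :: seq set" "UNIV :: omega1 set"] by auto
  then have "inj (Rep_omega1 \<circ> h)" by (simp add: inj_def Rep_omega1_inject)
  then show ?thesis by (rule exI[where P = inj])
qed

section \<open>Projections of finite norm\<close>

lemma branch_inject:
  assumes "limit1 d"
  shows "branch d y k = branch d z k \<longleftrightarrow> y k = z k"
  unfolding branch_def using strict_mono_eq[OF ladder(1)[OF assms]] by auto

definition pattern_of :: "omega1 \<Rightarrow> seq \<Rightarrow> nat \<Rightarrow> nat" where
  "pattern_of d x = (SOME y. y \<in> patterns (rk d) \<and> entry x = branch d y)"

lemma pattern_of:
  assumes "x \<in> branches d"
  shows "pattern_of d x \<in> patterns (rk d)" "entry x = branch d (pattern_of d x)"
proof -
  have "\<exists>y. y \<in> patterns (rk d) \<and> entry x = branch d y" using assms by (auto simp: branches_def)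
  from someI_ex[OF this] show "pattern_of d x \<in> patterns (rk d)" "entry x = branch d (pattern_of d x)"
    unfolding pattern_of_def by auto
qed

text \<open>
  The length of the initial part of \<open>x\<close> that is kept when \<open>x\<close> is pushed up into \<^term>\<open>below d\<close>:
  up to the first entry outside \<open>d\<close>, or past the last modified block if all entries are in \<open>d\<close>.
\<close>

definition break_at :: "omega1 \<Rightarrow> seq \<Rightarrow> nat" where
  "break_at d x = (if \<exists>k. d \<le> entry x k then LEAST k. d \<le> entry x k
     else Suc (Max (insert 0 (mods (pattern_of d x)))))"

lemma entry_less_before_break:
  assumes "i < break_at d x"
  shows "entry x i < d"
proof (cases "\<exists>k. d \<le> entry x k")
  case True
  then have "i < (LEAST k. d \<le> entry x k)" using assms by (simp add: break_at_def)
  then show ?thesis using not_less_Least[of i "\<lambda>k. d \<le> entry x k"] by simp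
qed (simp add: not_le)

lemma break_at_eq_Least:
  assumes "\<exists>k. d \<le> entry x k"
  shows "d \<le> entry x (break_at d x)"
  using LeastI_ex[OF assms] assms by (simp add: break_at_def)

lemma break_atI:
  assumes "\<And>i. i < k \<Longrightarrow> entry x i < d" "d \<le> entry x k"
  shows "break_at d x = k"
  using assms unfolding break_at_def by (metis (mono_tags, lifting) Least_equality linorder_not_less)

text \<open>The elements of \<open>J\<close> whose pushed-up version leaves \<open>J\<close>: no
  member of \<open>J\<close> exceeds \<open>x\<close> within the kept part. At such a cut the
  indicator of \<open>x\<close> and its image differ.\<close>

definition bad :: "omega1 \<Rightarrow> seq set \<Rightarrow> seq set" where
  "bad d J = {x \<in> J - below d. \<forall>y\<in>J. \<not> less_upto (break_at d x) x y}"

definition bad_high :: "omega1 \<Rightarrow> seq set \<Rightarrow> seq set" where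
  "bad_high d J = {x \<in> bad d J. \<exists>k. d \<le> entry x k}"

definition bad_branches :: "omega1 \<Rightarrow> seq set \<Rightarrow> seq set" where
  "bad_branches d J = {x \<in> bad d J. \<forall>k. entry x k < d}"

lemma bad_split: "bad d J = bad_high d J \<union> bad_branches d J" "bad_high d J \<inter> bad_branches d J = {}"
  by (auto simp: bad_high_def bad_branches_def not_less[symmetric])

text \<open>The bad elements with an entry outside \<open>d\<close> sit at the upper end of
  \<open>J\<close>: whatever lies above one of them in \<open>J\<close> shares its kept part and has
  an entry at least as large at the break. Removing them is thus only a change of cut and costs no
  norm.\<close>

lemma segment_diff_bad_high:
  assumes J: "segment J"
  shows "segment (J - bad_high d J)"
  unfolding segment_def
proof (intro ballI allI impI)
  fix y x assume y: "y \<in> J - bad_high d J" and xy: "x \<le> y"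
  have xJ: "x \<in> J" using J y xy by (auto intro: segmentD)
  show "x \<in> J - bad_high d J"
  proof (rule ccontr)
    assume "x \<notin> J - bad_high d J"
    then have x: "x \<in> bad d J" "\<exists>k. d \<le> entry x k" using xJ by (auto simp: bad_high_def)
    define k where "k = break_at d x"
    have k: "d \<le> entry x k" "\<And>i. i < k \<Longrightarrow> entry x i < d"
      using break_at_eq_Least[OF x(2)] entry_less_before_break unfolding k_def by auto
    have no: "\<not> less_upto k x z" if "z \<in> J" for z using x(1) that by (auto simp: bad_def k_def)
    have ag: "agree k x y"
      using less_upto_cases[of k x y] no[of y] y le_imp_not_less_upto[OF xy] by blast
    have yk: "entry x k \<le> entry y k"
    proof (rule ccontr)
      assume "\<not> entry x k \<le> entry y k"
      then have "less_upto (Suc k) y x"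
        using ag agree_sym unfolding less_upto_def by (intro exI[of _ k]) auto
      then show False using le_imp_not_less_upto[OF xy] by blast
    qed
    have dy: "d \<le> entry y k" using k(1) yk by order
    have "entry y i < d" if "i < k" for i using k(2)[OF that] ag that by (simp add: agree_def)
    then have bky: "break_at d y = k" using dy by (rule break_atI)
    have "\<not> less_upto k y z" if "z \<in> J" for z
      using no[OF that] less_upto_agree[OF _ agree_sym[OF ag], of z z] by (auto simp: agree_def)
    moreover have "y \<notin> below d"
      using dy by (auto simp: below_def bounded_by_def not_less[symmetric]) (metis linorder_not_le order_le_less_trans)
    ultimately have "y \<in> bad_high d J" using y dy by (auto simp: bad_high_def bad_def bky)
    then show False using y by blast
  qed
qed

text \<open>
  Two different bad branches agree up to the smaller of their break points, so the one with the
  larger break point has more modifications.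
\<close>

lemma bad_branches_card:
  assumes d: "limit1 d" and J: "segment J"
  shows "finite (bad_branches d J)" "card (bad_branches d J) \<le> Suc (rk d)"
proof -
  let ?m = "\<lambda>x. mods (pattern_of d x)"
  have br: "x \<in> branches d" if "x \<in> bad_branches d J" for x
    using that below_or_branches[OF d, of x] by (auto simp: bad_branches_def bad_def)
  have bk: "break_at d x = Suc (Max (insert 0 (?m x)))" if "x \<in> bad_branches d J" for x
    using that by (auto simp: bad_branches_def break_at_def not_le[symmetric])
  have fin: "finite (?m x)" "card (?m x) \<le> rk d" if "x \<in> bad_branches d J" for x
    using pattern_of[OF br[OF that]] by (auto simp: patterns_def)
  have lt: "k < break_at d x" if "x \<in> bad_branches d J" "k \<in> ?m x" for x k
    using Max_ge[of "insert 0 (?m x)" k] fin(1)[OF that(1)] that by (simp add: bk less_Suc_eq_le)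
  have key: "x = y \<or> card (?m x) < card (?m y)"
    if x: "x \<in> bad_branches d J" and y: "y \<in> bad_branches d J" and le: "break_at d x \<le> break_at d y" for x y
  proof -
    have "\<not> less_upto (break_at d x) x y" "\<not> less_upto (break_at d y) y x"
      using x y by (auto simp: bad_branches_def bad_def)
    then have ag: "agree (break_at d x) x y"
      using less_upto_cases[of "break_at d x" x y] less_upto_mono[OF _ le] by blast
    have eq: "pattern_of d x i = pattern_of d y i" if "i < break_at d x" for i
    proof -
      have "entry x i = entry y i" using ag that by (simp add: agree_def)
      then have "branch d (pattern_of d x) i = branch d (pattern_of d y) i"
        using pattern_of(2)[OF br[OF x]] pattern_of(2)[OF br[OF y]] by metis
      then show ?thesis using branch_inject[OF d] by blast
    qed
    have sub: "?m x \<subseteq> ?m y"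
    proof
      fix i assume i: "i \<in> ?m x"
      have "pattern_of d x i = pattern_of d y i" by (rule eq[OF lt[OF x i]])
      then show "i \<in> ?m y" using i by (simp add: mods_def)
    qed
    show ?thesis
    proof (cases "?m x = ?m y")
      case True
      \<comment> \<open>All modifications of \<open>x\<close> precede its break, so past it equal
        modification sets force the value 1 in both patterns.\<close>
      have "pattern_of d x i = pattern_of d y i" for i
      proof (cases "i < break_at d x")
        case False
        then have "i \<notin> ?m x" using lt[OF x] by blast
        then have "pattern_of d x i = 1" "pattern_of d y i = 1" using True by (auto simp: mods_def)
        then show ?thesis by simp
      qed (rule eq)
      then have "pattern_of d x = pattern_of d y" by auto
      then have "entry x = entry y"
        using pattern_of(2)[OF br[OF x]] pattern_of(2)[OF br[OF y]] by simp
      then show ?thesis by (simp add: entry_inject)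
    next
      case False
      then show ?thesis using sub fin(1)[OF y] psubset_card_mono[of "?m y" "?m x"] by blast
    qed
  qed
  have inj: "inj_on (\<lambda>x. card (?m x)) (bad_branches d J)"
  proof (rule inj_onI)
    fix x y assume xy: "x \<in> bad_branches d J" "y \<in> bad_branches d J" "card (?m x) = card (?m y)"
    show "x = y"
      using key[OF xy(1,2)] key[OF xy(2,1)] xy(3) by (metis less_irrefl nat_le_linear)
  qed
  have im: "(\<lambda>x. card (?m x)) ` bad_branches d J \<subseteq> {..rk d}" using fin(2) by auto
  show "finite (bad_branches d J)" using inj_on_finite[OF inj im] by simp
  show "card (bad_branches d J) \<le> Suc (rk d)" using card_inj_on_le[OF inj im] by simp
qed

locale seq_line = cut_line g for g :: "seq \<Rightarrow> 'b"
begin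

lemma complemented_below:
  assumes d: "limit1 d"
  shows "complemented_in cut_C (sub_C (below d))"
proof -
  \<comment> \<open>If the break is 0, nothing exceeds \<open>x\<close> within the first 0 entries,
    so the image of \<open>ind x\<close> is the zero function.\<close>
  define T where "T x = (if x \<in> below d then ind x
     else if break_at d x = 0 then 0 else ind (inc (break_at d x) x))" for x
  \<comment> \<open>The formula is forced by \<open>T\<close>. High bad elements are removed by
    passing to a smaller cut. For a bad branch \<open>z\<close> the jump of \<open>f\<close> at
    \<open>z\<close> is subtracted; as a functional of \<open>f\<close> it is 1 on
    \<open>ind z\<close> and 0 on the other generators.\<close>
  define \<Lambda> where "\<Lambda> J f = val f (J - bad_high d J)
     - (\<Sum>z\<in>bad_branches d J. val f {..z} - val f {..<z})" for J f
  have val_T: "val (T x) J = (if x \<in> J - bad d J then 1 else 0)" if J: "segment J" for x J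
  proof (cases "x \<in> below d")
    case True
    then show ?thesis using J by (simp add: T_def bad_def)
  next
    case False
    let ?k = "break_at d x"
    have "x \<in> J - bad d J \<longleftrightarrow> (\<exists>y\<in>J. less_upto ?k x y)"
    proof
      assume "\<exists>y\<in>J. less_upto ?k x y"
      then obtain y where y: "y \<in> J" "less_upto ?k x y" by blast
      then have "x \<in> J" using segmentD[OF J y(1)] less_upto_imp_less[OF y(2)] by simp
      then show "x \<in> J - bad d J" using y by (auto simp: bad_def)
    qed (use False in \<open>auto simp: bad_def\<close>)
    moreover have "val (T x) J = (if \<exists>y\<in>J. less_upto ?k x y then 1 else 0)"
    proof (cases "?k = 0")
      case True
      then show ?thesis using False by (simp add: T_def less_upto_def)
    next
      case nz: False
      then show ?thesis using False J inc_in_segment_iff[OF J, of ?k x] by (simp add: T_def)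
    qed
    ultimately show ?thesis by simp
  qed
  have gen: "\<Lambda> J (ind x) = val (T x) J" if J: "segment J" for J x
  proof -
    have "(\<Sum>z\<in>bad_branches d J. val (ind x) {..z} - val (ind x) {..<z})
        = (\<Sum>z\<in>bad_branches d J. if x = z then 1 else 0)"
      by (intro sum.cong) auto
    also have "... = (if x \<in> bad_branches d J then 1 else 0)"
      using bad_branches_card(1)[OF d J] by simp
    finally have "\<Lambda> J (ind x) = (if x \<in> J - bad_high d J then 1 else 0)
        - (if x \<in> bad_branches d J then 1 else 0)"
      using segment_diff_bad_high[OF J] by (simp add: \<Lambda>_def)
    moreover have "bad_branches d J \<subseteq> J" by (auto simp: bad_branches_def bad_def)
    ultimately show ?thesis
      using val_T[OF J] bad_split[of d J] by auto
  qed
  \<comment> \<open>One evaluation and at most \<open>rk d + 1\<close> jumps of norm at most 2 each: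
    altogether \<open>2 rk d + 3\<close>.\<close>
  have bound: "\<bar>\<Lambda> J f\<bar> \<le> (1 + 2 * Suc (rk d)) * norm f" if J: "segment J" for J f
  proof -
    have "\<bar>val f {..z} - val f {..<z}\<bar> \<le> 2 * norm f" for z
      using abs_val_le[of f "{..z}"] abs_val_le[of f "{..<z}"] by linarith
    then have "\<bar>\<Sum>z\<in>bad_branches d J. val f {..z} - val f {..<z}\<bar>
        \<le> real (card (bad_branches d J)) * (2 * norm f)"
      by (intro order_trans[OF sum_abs sum_bounded_above])
    also have "... \<le> real (Suc (rk d)) * (2 * norm f)"
      using bad_branches_card(2)[OF d J] by (intro mult_right_mono) auto
    finally have "\<bar>\<Sum>z\<in>bad_branches d J. val f {..z} - val f {..<z}\<bar> \<le> real (Suc (rk d)) * (2 * norm f)" .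
    then have "\<bar>\<Lambda> J f\<bar> \<le> norm f + real (Suc (rk d)) * (2 * norm f)"
      unfolding \<Lambda>_def using abs_val_le[of f "J - bad_high d J"] by linarith
    then show ?thesis by (simp add: algebra_simps)
  qed
  obtain P where "projection_on cut_C P" "P ` cut_C = sub_C (below d)"
  proof (rule ex_projection[of \<Lambda> _ T "below d"])
    show "\<Lambda> I (f + h) = \<Lambda> I f + \<Lambda> I h" for I f h
      by (simp add: \<Lambda>_def sum.distrib sum_subtractf)
    show "\<Lambda> I (c *\<^sub>R f) = c * \<Lambda> I f" for I c f
      by (simp add: \<Lambda>_def sum_distrib_left right_diff_distrib)
    show "\<Lambda> I unit_fun = 1" if "segment I" for I
      using segment_diff_bad_high[OF that] by (simp add: \<Lambda>_def)
    show "T x \<in> sub_C (below d)" for x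
      using inc_in_below[OF d] entry_less_before_break[of _ d x] ind_in_sub_C
        subspace_0[OF subspace_sub_C] by (auto simp: T_def)
    show "T x = ind x" if "x \<in> below d" for x using that by (simp add: T_def)
  qed (use bound gen in auto)
  then show ?thesis unfolding complemented_in_def by blast
qed

end

section \<open>Lower bounds for projections\<close>

definition branch_seq :: "omega1 \<Rightarrow> (nat \<Rightarrow> nat) \<Rightarrow> seq" where
  "branch_seq d y = Abs_seq (branch d y)"

lemma entry_branch_seq:
  assumes "limit1 d" "y \<in> patterns (rk d)"
  shows "entry (branch_seq d y) = branch d y"
  unfolding branch_seq_def using assms by (intro Abs_seq_inverse) auto

lemma branch_seq_in_branches:
  assumes "limit1 d" "y \<in> patterns (rk d)"
  shows "branch_seq d y \<in> branches d"
  unfolding branches_def using entry_branch_seq[OF assms] assms(2) by simp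

lemma finite_common_difference:
  assumes "finite G"
  shows "\<exists>m. \<forall>z\<in>G. z \<noteq> x \<longrightarrow> \<not> agree m z x"
  using assms
proof (induction G)
  case (insert z G)
  then obtain m where m: "\<forall>z\<in>G. z \<noteq> x \<longrightarrow> \<not> agree m z x" by auto
  obtain k where k: "z \<noteq> x \<longrightarrow> \<not> agree k z x" using agree_imp_eq[of z x] by auto
  have "\<not> agree (max m k) w x" if "w \<in> insert z G" "w \<noteq> x" for w
    using m k that agree_mono[of "max m k" w x m] agree_mono[of "max m k" w x k] by auto
  then show ?case by auto
qed simp

text \<open>Modify one unmodified block beyond the places where the members of \<open>G\<close> part
  from the branch: rung 0 of the block moves it down, rung 2 up, and the position relative to
  \<open>G\<close> is kept. \<open>G\<close> will consist of the test points of a step function and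
  the branches used so far.\<close>

lemma approach_branch:
  fixes b :: nat
  assumes d: "limit1 d" and y: "y \<in> patterns (rk d)" "card (mods y) < rk d" and G: "finite G"
    and b: "b \<in> {0, 2}"
  obtains y' where "y' \<in> patterns (rk d)" "card (mods y') \<le> Suc (card (mods y))"
    "b = 0 \<Longrightarrow> branch_seq d y' < branch_seq d y" "b = 2 \<Longrightarrow> branch_seq d y < branch_seq d y'"
    "\<And>z. z \<in> G \<Longrightarrow> z \<noteq> branch_seq d y \<Longrightarrow> z < branch_seq d y \<longleftrightarrow> z < branch_seq d y'"
    "\<And>z. z \<in> G \<Longrightarrow> z \<noteq> branch_seq d y \<Longrightarrow> branch_seq d y < z \<longleftrightarrow> branch_seq d y' < z"
proof -
  let ?x = "branch_seq d y"
  obtain m where m: "\<forall>z\<in>G. z \<noteq> ?x \<longrightarrow> \<not> agree m z ?x" using finite_common_difference[OF G] by blast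
  have fin: "finite (mods y)" using y by (simp add: patterns_def)
  obtain i where i: "i \<notin> {..m} \<union> mods y"
    using ex_new_if_finite[of "{..m} \<union> mods y"] fin by (meson finite_Un finite_atMost infinite_UNIV_nat)
  then have yi: "y i = 1" "m < i" by (auto simp: mods_def)
  define y' where "y' = y(i := b)"
  let ?x' = "branch_seq d y'"
  have mods: "mods y' = insert i (mods y)" using b by (auto simp: mods_def y'_def)
  have y': "y' \<in> patterns (rk d)"
    using y b fin by (auto simp: patterns_def mods card_insert_if) (auto simp: y'_def)
  note e = entry_branch_seq[OF d y(1)] entry_branch_seq[OF d y']
  have ag: "agree i ?x ?x'" unfolding agree_def e by (auto simp: branch_def y'_def)
  have ladder_less: "ladder d j < ladder d k \<longleftrightarrow> j < k" for j k
    using strict_mono_less[OF ladder(1)[OF d]] .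
  have less: "less_upto (Suc i) ?x' ?x" if "b = 0"
    using agree_sym[OF ag] that yi unfolding less_upto_def e
    by (intro exI[of _ i]) (auto simp: branch_def y'_def ladder_less)
  have greater: "less_upto (Suc i) ?x ?x'" if "b = 2"
    using ag that yi unfolding less_upto_def e
    by (intro exI[of _ i]) (auto simp: branch_def y'_def ladder_less)
  have agm: "agree m ?x ?x'" using agree_mono[OF ag] yi(2) by simp
  show ?thesis
  proof (rule that[OF y'])
    show "card (mods y') \<le> Suc (card (mods y))" using fin by (simp add: mods card_insert_if)
    show "b = 0 \<Longrightarrow> ?x' < ?x" "b = 2 \<Longrightarrow> ?x < ?x'" using less greater less_upto_imp_less by blast+
    show "z < ?x \<longleftrightarrow> z < ?x'" "?x < z \<longleftrightarrow> ?x' < z" if "z \<in> G" "z \<noteq> ?x" for z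
      using less_iff_of_agree[OF agm] m that by blast+
  qed
qed

text \<open>The initial part of \<open>x\<close> up to and including its first difference from
  \<open>z\<close> is bounded below \<open>d\<close>, and padding keeps it at most
  \<open>x\<close>.\<close>

lemma separate_branches:
  assumes d: "limit1 d" and x: "x \<in> branches d" and lt: "z < x"
  obtains s where "s \<in> below d" "z < s" "s \<le> x"
proof -
  obtain k where "less_upto k z x" using lt by (auto simp: less_seq_def)
  then obtain i where i: "agree i z x" "entry z i < entry x i" by (auto simp: less_upto_def)
  have lt: "entry x j < d" for j using x branch_less[OF d] by (auto simp: branches_def)
  show ?thesis
  proof (rule that)
    show "trunc (Suc i) (entry x) \<in> below d" using trunc_in_below[OF d] lt by blast
    show "z < trunc (Suc i) (entry x)"
      using i by (intro less_upto_imp_less[of "Suc i"]) (auto simp: less_upto_def agree_def)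
    show "trunc (Suc i) (entry x) \<le> x"
      by (rule le_of_agree_zero[OF agree_trunc[of "Suc i"]]) auto
  qed
qed

context seq_line
begin

text \<open>Put a point \<open>b z\<close> of \<open>below d\<close> between \<open>z\<close> and
  the next element of \<open>F\<close>. The signed indicators of these disjoint intervals add up to
  some \<open>h\<close> of norm at most 1, and \<open>P\<close> fixes each \<open>ind (b z)\<close>,
  so the sum of residues is \<open>h - P h\<close>.\<close>

lemma branch_residues_bound:
  assumes d: "limit1 d" and P: "projection_on cut_C P" "\<And>f. f \<in> cut_C \<Longrightarrow> norm (P f) \<le> M * norm f"
    "P ` cut_C = sub_C (below d)" and M: "0 \<le> M"
    and F: "finite F" "F \<subseteq> branches d" and eps: "\<And>z. \<bar>\<epsilon> z\<bar> \<le> 1"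
  shows "norm (\<Sum>z\<in>F. \<epsilon> z *\<^sub>R (ind z - P (ind z))) \<le> 1 + M"
proof -
  have bl: "bounded_linear_on cut_C P" using P(1) by (simp add: projection_on_def)
  have "\<exists>s. s \<in> below d \<and> z < s \<and> (\<forall>x\<in>F. z < x \<longrightarrow> s \<le> x)" if z: "z \<in> F" for z
  proof (cases "{x \<in> F. z < x} = {}")
    case True
    have "entry z i < d" for i using z F(2) branch_less[OF d] by (auto simp: branches_def)
    then have "inc 1 z \<in> below d" by (intro inc_in_below[OF d])
    then show ?thesis using True less_upto_imp_less[OF less_upto_inc[of 1 z]] by auto
  next
    case False
    define x where "x = Min {x \<in> F. z < x}"
    have fin: "finite {x \<in> F. z < x}" using F(1) by simp
    have x: "x \<in> F" "z < x" using Min_in[OF fin False] by (auto simp: x_def)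
    obtain s where s: "s \<in> below d" "z < s" "s \<le> x"
      using separate_branches[OF d _ x(2)] x(1) F(2) by blast
    have "s \<le> w" if "w \<in> F" "z < w" for w
    proof -
      have "x \<le> w" unfolding x_def by (rule Min_le[OF fin]) (use that in simp)
      then show ?thesis using s(3) by simp
    qed
    then show ?thesis using s by blast
  qed
  then obtain b where b: "\<And>z. z \<in> F \<Longrightarrow> b z \<in> below d \<and> z < b z \<and> (\<forall>x\<in>F. z < x \<longrightarrow> b z \<le> x)"
    by metis
  define h where "h = (\<Sum>z\<in>F. \<epsilon> z *\<^sub>R (ind z - ind (b z)))"
  have in_C: "\<epsilon> z *\<^sub>R (ind z - ind (b z)) \<in> cut_C" for z
    by (intro subspace_scale subspace_diff subspace_cfun_space) auto
  have hC: "h \<in> cut_C" unfolding h_def by (intro subspace_sum subspace_cfun_space in_C)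
  have nh: "norm h \<le> 1"
    unfolding h_def
  proof (rule norm_disjoint_sum[OF F(1)])
    show "\<bar>\<epsilon> i\<bar> \<le> 1" for i by (rule eps)
    show "i \<le> b i" if "i \<in> F" for i using b[OF that] by (simp add: less_imp_le)
    show "b i \<le> j \<or> b j \<le> i" if "i \<in> F" "j \<in> F" "i \<noteq> j" for i j
      using b[OF that(1)] b[OF that(2)] that by (meson linorder_neqE)
  qed
  have Pb: "P (ind (b z)) = ind (b z)" if "z \<in> F" for z
  proof -
    have "ind (b z) \<in> P ` cut_C" using P(3) ind_in_sub_C b[OF that] by auto
    then show ?thesis using P(1) by (auto simp: projection_on_def)
  qed
  have "P h = (\<Sum>z\<in>F. P (\<epsilon> z *\<^sub>R (ind z - ind (b z))))"
    unfolding h_def by (rule bounded_linear_on_sum[OF subspace_cfun_space bl in_C])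
  also have "... = (\<Sum>z\<in>F. \<epsilon> z *\<^sub>R (P (ind z) - ind (b z)))"
  proof (rule sum.cong[OF refl])
    fix z assume z: "z \<in> F"
    have "P (\<epsilon> z *\<^sub>R (ind z - ind (b z))) = \<epsilon> z *\<^sub>R P (ind z - ind (b z))"
      using bl subspace_diff[OF subspace_cfun_space, of "ind z" cut_top "ind (b z)"]
      by (simp add: bounded_linear_on_def)
    then show "P (\<epsilon> z *\<^sub>R (ind z - ind (b z))) = \<epsilon> z *\<^sub>R (P (ind z) - ind (b z))"
      using bounded_linear_on_diff[OF subspace_cfun_space bl, of "ind z" "ind (b z)"] Pb[OF z]
      by simp
  qed
  finally have "(\<Sum>z\<in>F. \<epsilon> z *\<^sub>R (ind z - P (ind z))) = h - P h"
    unfolding h_def by (simp add: sum_subtractf[symmetric] scaleR_diff_right)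
  moreover have "norm (h - P h) \<le> 1 + M"
  proof -
    have "norm (P h) \<le> M * 1"
      using P(2)[OF hC] nh M by (meson mult_left_mono order_trans)
    then show ?thesis using norm_triangle_ineq4[of h "P h"] nh by simp
  qed
  ultimately show ?thesis by simp
qed

text \<open>
  Subtracting \<^term>\<open>P (ind x)\<close>, which does not jump at \<open>x\<close>, leaves a function that jumps by one at
  \<open>x\<close>. Moving \<open>x\<close> towards a point where a signed sum of such functions is large raises that sum
  on one side of the new jump by almost one half.
\<close>

lemma large_residue_sum:
  assumes d: "limit1 d" and P: "projection_on cut_C P" "P ` cut_C = sub_C (below d)"
    and n: "n \<le> rk d"
  shows "\<exists>F \<epsilon> y c. finite F \<and> F \<subseteq> branches d \<and> (\<forall>z. \<bar>\<epsilon> z\<bar> \<le> 1) \<and>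
     y \<in> patterns (rk d) \<and> card (mods y) \<le> n \<and>
     (c = {..<branch_seq d y} \<or> c = {..branch_seq d y}) \<and>
     real (Suc n) / 3 \<le> val (\<Sum>z\<in>F. \<epsilon> z *\<^sub>R (ind z - P (ind z))) c"
  using n
proof (induction n)
  let ?u = "\<lambda>z. ind z - P (ind z)"
  have jump: "\<exists>\<sigma> c. \<bar>\<sigma>\<bar> \<le> 1 \<and> (c = {..<x} \<or> c = {..x}) \<and> 1 / 2 \<le> \<sigma> * val (?u x) c"
    if x: "x \<in> branches d" for x
  proof -
    have "{..x} \<inter> below d = {..<x} \<inter> below d"
      using branches_not_below[OF d x] by (auto simp: less_le)
    moreover have "P (ind x) \<in> sub_C (below d)" using P(2) by auto
    ultimately have "val (P (ind x)) {..x} = val (P (ind x)) {..<x}"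
      by (intro sub_C_const) auto
    then have "val (?u x) {..x} = val (?u x) {..<x} + 1" by simp
    \<comment> \<open>The values on the two sides of a jump by 1 cannot both lie strictly between
      -1/2 and 1/2; the sign \<open>\<sigma>\<close> makes the chosen one positive.\<close>
    then consider "1 / 2 \<le> val (?u x) {..x}" | "val (?u x) {..<x} \<le> - (1 / 2)" by linarith
    then show ?thesis
    proof cases
      case 1
      then show ?thesis by (intro exI[of _ 1] exI[of _ "{..x}"]) simp
    next
      case 2
      then show ?thesis by (intro exI[of _ "-1"] exI[of _ "{..<x}"]) simp
    qed
  qed
  {
    case 0
    have y: "(\<lambda>_. 1) \<in> patterns (rk d)" by (simp add: patterns_def mods_def)
    let ?x = "branch_seq d (\<lambda>_. 1)"
    obtain \<sigma> c where "\<bar>\<sigma>\<bar> \<le> 1" "c = {..<?x} \<or> c = {..?x}" "1 / 2 \<le> \<sigma> * val (?u ?x) c"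
      using jump[OF branch_seq_in_branches[OF d y]] by blast
    then show ?case
      using y branch_seq_in_branches[OF d y]
      by (intro exI[of _ "{?x}"] exI[of _ "\<lambda>_. \<sigma>"] exI[of _ "\<lambda>_. 1"] exI[of _ c])
        (simp add: mods_def)
  next
    case (Suc n)
    then obtain F \<epsilon> y c where F: "finite F" "F \<subseteq> branches d" and eps: "\<And>z. \<bar>\<epsilon> z\<bar> \<le> 1"
      and y: "y \<in> patterns (rk d)" "card (mods y) \<le> n"
      and c: "c = {..<branch_seq d y} \<or> c = {..branch_seq d y}"
      and large: "real (Suc n) / 3 \<le> val (\<Sum>z\<in>F. \<epsilon> z *\<^sub>R ?u z) c"
      by auto
    let ?x = "branch_seq d y"
    define h where "h = (\<Sum>z\<in>F. \<epsilon> z *\<^sub>R ?u z)"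
    have "h \<in> cut_C"
      unfolding h_def using P(1)
      by (intro subspace_sum subspace_scale subspace_diff subspace_cfun_space)
        (auto simp: projection_on_def)
    \<comment> \<open>Replacing \<open>h\<close> by \<open>s\<close> at \<open>c\<close> and at
      \<open>c'\<close> loses at most 2/12, so the gain per round is 1/2 - 1/6 = 1/3, the constant
      of the statement.\<close>
    then obtain s where s: "s \<in> span (gens UNIV)" "norm (h - s) \<le> 1 / 12"
      using cut_C_approx[of h "1 / 12"] by auto
    obtain G where G: "finite G" "s \<in> sub_C G" using span_gens_finite[OF s(1)] by auto
    have close: "\<bar>val h I - val s I\<bar> \<le> 1 / 12" for I
      using abs_val_le[of "h - s" I] s(2) by simp
    \<comment> \<open>The new branch goes below \<open>?x\<close> if \<open>c\<close> omits
      \<open>?x\<close>, and above if \<open>c\<close> contains it. Hence \<open>c'\<close> has the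
      same trace on \<open>G\<close> as \<open>c\<close>, even when \<open>?x\<close> itself is in
      \<open>G\<close>.\<close>
    define b :: nat where "b = (if c = {..<?x} then 0 else 2)"
    have lt: "card (mods y) < rk d" and fin: "finite (F \<union> G)" and b: "b \<in> {0, 2}"
      using y(2) Suc.prems F(1) G(1) by (simp_all add: b_def)
    obtain y' where y': "y' \<in> patterns (rk d)" "card (mods y') \<le> Suc (card (mods y))"
      "b = 0 \<Longrightarrow> branch_seq d y' < ?x" "b = 2 \<Longrightarrow> ?x < branch_seq d y'"
      "\<And>z. z \<in> F \<union> G \<Longrightarrow> z \<noteq> ?x \<Longrightarrow> z < ?x \<longleftrightarrow> z < branch_seq d y'"
      "\<And>z. z \<in> F \<union> G \<Longrightarrow> z \<noteq> ?x \<Longrightarrow> ?x < z \<longleftrightarrow> branch_seq d y' < z"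
      using approach_branch[OF d y(1) lt fin b] by blast
    let ?x' = "branch_seq d y'"
    have ne: "?x' \<noteq> ?x" using y'(3,4) b by (metis insertE singletonD less_irrefl)
    have new: "?x' \<notin> F"
      using y'(5,6)[of ?x'] ne by (metis UnI1 less_irrefl linorder_neqE)
    obtain \<sigma> c' where \<sigma>: "\<bar>\<sigma>\<bar> \<le> 1" "c' = {..<?x'} \<or> c' = {..?x'}" "1 / 2 \<le> \<sigma> * val (?u ?x') c'"
      using jump[OF branch_seq_in_branches[OF d y'(1)]] by blast
    have seg: "segment c" "segment c'" using c \<sigma>(2) segment_atMost segment_lessThan by metis+
    have "c' \<inter> G = c \<inter> G"
    proof -
      have "z \<in> c' \<longleftrightarrow> z \<in> c" if z: "z \<in> G" for z
      proof (cases "z = ?x")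
        case True
        show ?thesis
        proof (cases "c = {..<?x}")
          case c1: True
          then have "?x' < ?x" using y'(3) by (simp add: b_def)
          then show ?thesis using True c1 \<sigma>(2) by auto
        next
          case c2: False
          then have "?x < ?x'" "c = {..?x}" using y'(4) c by (simp_all add: b_def)
          then show ?thesis using True \<sigma>(2) by auto
        qed
      next
        case False
        then have "z < ?x \<longleftrightarrow> z < ?x'" "?x < z \<longleftrightarrow> ?x' < z" using y'(5,6) z by auto
        moreover from this have "z \<noteq> ?x'" using False by (metis less_irrefl linorder_neqE)
        ultimately have "z \<le> ?x \<longleftrightarrow> z < ?x'" "z \<le> ?x' \<longleftrightarrow> z < ?x'" "z < ?x \<longleftrightarrow> z < ?x'"
          using False by (simp_all add: le_less)
        then show ?thesis using c \<sigma>(2)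
          by (elim disjE) (simp_all only: lessThan_iff atMost_iff)
      qed
      then show ?thesis by (auto simp only: Int_iff)
    qed
    then have "val s c' = val s c"
      by (rule sub_C_const[OF G(2) seg(2,1)])
    then have h_c': "val h c' \<ge> val h c - 1 / 6" using close[of c] close[of c'] by linarith
    define \<epsilon>' where "\<epsilon>' = \<epsilon>(?x' := \<sigma>)"
    have "(\<Sum>z\<in>F. \<epsilon>' z *\<^sub>R ?u z) = h"
      unfolding h_def \<epsilon>'_def using new by (intro sum.cong) auto
    then have "(\<Sum>z\<in>insert ?x' F. \<epsilon>' z *\<^sub>R ?u z) = \<sigma> *\<^sub>R ?u ?x' + h"
      using new F(1) by (simp add: \<epsilon>'_def)
    then have "val (\<Sum>z\<in>insert ?x' F. \<epsilon>' z *\<^sub>R ?u z) c' = \<sigma> * val (?u ?x') c' + val h c'" by simp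
    then have "real (Suc (Suc n)) / 3 \<le> val (\<Sum>z\<in>insert ?x' F. \<epsilon>' z *\<^sub>R ?u z) c'"
      using \<sigma>(3) h_c' large[folded h_def] by simp
    moreover have "\<forall>z. \<bar>\<epsilon>' z\<bar> \<le> 1" using eps \<sigma>(1) by (simp add: \<epsilon>'_def)
    moreover have "card (mods y') \<le> Suc n" using y'(2) y(2) by simp
    ultimately show ?case
      using F y'(1) \<sigma>(2) branch_seq_in_branches[OF d y'(1)]
      by (intro exI[of _ "insert ?x' F"] exI[of _ \<epsilon>'] exI[of _ y'] exI[of _ c']) simp
  }
qed

lemma not_k_complemented_below:
  assumes d: "limit1 d" and k: "0 \<le> k" "3 * (1 + k) \<le> real (rk d)"
  shows "\<not> k_complemented_in k cut_C (sub_C (below d))"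
proof
  assume "k_complemented_in k cut_C (sub_C (below d))"
  then obtain P where P: "projection_on cut_C P" "\<And>f. f \<in> cut_C \<Longrightarrow> norm (P f) \<le> k * norm f"
    "P ` cut_C = sub_C (below d)"
    unfolding k_complemented_in_def by blast
  obtain F \<epsilon> y c where F: "finite F" "F \<subseteq> branches d" and eps: "\<And>z. \<bar>\<epsilon> z\<bar> \<le> 1"
    and large: "real (Suc (rk d)) / 3 \<le> val (\<Sum>z\<in>F. \<epsilon> z *\<^sub>R (ind z - P (ind z))) c"
    using large_residue_sum[OF d P(1,3) order_refl] by auto
  have "norm (\<Sum>z\<in>F. \<epsilon> z *\<^sub>R (ind z - P (ind z))) \<le> 1 + k"
    by (rule branch_residues_bound[OF d P k(1) F eps])
  then have "real (Suc (rk d)) / 3 \<le> 1 + k"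
    using large abs_val_le[of "\<Sum>z\<in>F. \<epsilon> z *\<^sub>R (ind z - P (ind z))" c] by linarith
  then show False using k(2) by simp
qed

end

section \<open>Controlled projections\<close>

lemma bounded_linear_on_compose:
  assumes "bounded_linear_on E f" "bounded_linear_on E h" "f ` E \<subseteq> E"
  shows "bounded_linear_on E (\<lambda>x. h (f x))"
proof -
  obtain B where B: "\<And>x. x \<in> E \<Longrightarrow> norm (f x) \<le> B * norm x"
    using assms(1) unfolding bounded_linear_on_def by blast
  obtain D where D: "\<And>x. x \<in> E \<Longrightarrow> norm (h x) \<le> D * norm x"
    using assms(2) unfolding bounded_linear_on_def by blast
  have in_E: "f x \<in> E" if "x \<in> E" for x using assms(3) that by blast
  have "norm (h (f x)) \<le> (max D 0 * B) * norm x" if "x \<in> E" for x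
  proof -
    have "norm (h (f x)) \<le> D * norm (f x)" using D[OF in_E[OF that]] .
    also have "... \<le> max D 0 * norm (f x)" by (intro mult_right_mono) auto
    also have "... \<le> max D 0 * (B * norm x)" by (intro mult_left_mono B that) auto
    finally show ?thesis by (simp add: mult.assoc)
  qed
  then have "\<exists>B. \<forall>x\<in>E. norm (h (f x)) \<le> B * norm x" by blast
  then show ?thesis
    using assms(1,2) in_E unfolding bounded_linear_on_def by simp
qed

section \<open>A monotone retraction onto a countable set\<close>

definition push :: "omega1 \<Rightarrow> seq \<Rightarrow> seq" where
  "push e x = (if \<exists>k. e \<le> entry x k
     then let k = (LEAST k. e \<le> entry x k) in trunc (Suc k) ((entry x)(k := e)) else x)"

lemma push_low: "(\<And>k. entry x k < e) \<Longrightarrow> push e x = x"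
  by (auto simp: push_def not_le[symmetric])

lemma push_high:
  assumes "\<And>i. i < k \<Longrightarrow> entry x i < e" "e \<le> entry x k"
  shows "push e x = trunc (Suc k) ((entry x)(k := e))"
proof -
  have "(LEAST k. e \<le> entry x k) = k"
    by (rule Least_equality) (use assms in \<open>auto simp: not_less[symmetric]\<close>)
  then show ?thesis using assms(2) by (auto simp: push_def)
qed

lemma seq_low_or_high:
  obtains "\<And>k. entry x k < e" | k where "\<And>i. i < k \<Longrightarrow> entry x i < e" "e \<le> entry x k"
proof (cases "\<exists>k. e \<le> entry x k")
  case True
  define k where "k = (LEAST k. e \<le> entry x k)"
  have "e \<le> entry x k" unfolding k_def using True by (rule LeastI_ex)
  moreover have "entry x i < e" if "i < k" for i
    using not_less_Least[OF that[unfolded k_def]] by simp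
  ultimately show ?thesis using that(2) by blast
qed (use that(1) in \<open>auto simp: not_le\<close>)

lemma entry_push:
  assumes "\<And>j. j < i \<Longrightarrow> entry x j < e"
  shows "entry (push e x) i = min (entry x i) e"
proof (cases rule: seq_low_or_high[of x e])
  case 1
  then show ?thesis by (simp add: push_low min_def less_imp_le)
next
  case (2 k)
  then have "i \<le> k" using assms[of k] by (auto simp: not_less[symmetric])
  then show ?thesis using push_high[OF 2] 2 by (cases "i = k") (auto simp: min_def less_imp_le)
qed

lemma push_cong:
  assumes "\<And>i. i < k \<Longrightarrow> entry x i < e" "e \<le> entry x k" "agree k x y" "e \<le> entry y k"
  shows "push e x = push e y"
proof -
  have "push e y = trunc (Suc k) ((entry y)(k := e))"
    by (rule push_high) (use assms in \<open>auto simp: agree_def\<close>)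
  also have "... = trunc (Suc k) ((entry x)(k := e))"
    using assms(3) by (intro agree_imp_eq) (auto simp: agree_def less_Suc_eq)
  finally show ?thesis using push_high[OF assms(1,2)] by simp
qed

lemma push_idem [simp]: "push e (push e x) = push e x"
proof (cases rule: seq_low_or_high[of x e])
  case (2 k)
  have "agree k x (push e x)" "e \<le> entry (push e x) k"
    using push_high[OF 2] by (auto simp: agree_def)
  then show ?thesis using push_cong[of k x e "push e x"] 2 by metis
qed (simp add: push_low)

text \<open>If \<open>x\<close> stays under \<open>e\<close> up to and including the first
  difference, the images differ there in the same direction. Otherwise both sequences reach
  \<open>e\<close> at the same place after the same beginning, and the images coincide.\<close>

lemma push_mono:
  assumes "x \<le> y"
  shows "push e x \<le> push e y"
proof (cases "x = y")
  case False
  then obtain k where "less_upto k x y" using assms by (auto simp: less_eq_seq_def less_seq_def)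
  then obtain i where i: "agree i x y" "entry x i < entry y i" by (auto simp: less_upto_def)
  show ?thesis
  proof (cases "\<forall>j\<le>i. entry x j < e")
    case True
    have ex: "entry (push e x) j = entry x j" if "j \<le> i" for j
      using True that by (subst entry_push) (auto simp: min_def less_imp_le)
    have y: "entry y j < e" if "j < i" for j
      using True i(1) that by (metis agree_def less_imp_le)
    have ey: "entry (push e y) j = min (entry y j) e" if "j \<le> i" for j
      using y that by (intro entry_push) auto
    have "agree i (push e x) (push e y)"
      using ex ey y i(1) by (auto simp: agree_def min_def less_imp_le)
    moreover have "entry (push e x) i < entry (push e y) i"
      using ex ey i(2) True by (simp add: min_def)
    ultimately have "less_upto (Suc i) (push e x) (push e y)" unfolding less_upto_def by blast
    then show ?thesis using less_upto_imp_less by fastforce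
  next
    case False
    show ?thesis
    proof (cases rule: seq_low_or_high[of x e])
      case 1
      then show ?thesis using False by simp
    next
      case (2 k)
      then have ki: "k \<le> i" using False by (metis linorder_not_le order_le_less_trans order_less_le_trans)
      have "entry x k \<le> entry y k"
        using i ki by (cases "k = i") (auto simp: agree_def)
      then have "e \<le> entry y k" using 2(2) by (rule order_trans[rotated])
      then have "push e x = push e y"
        using push_cong[of k x e y] 2 agree_mono[OF i(1) ki] by metis
      then show ?thesis by simp
    qed
  qed
qed simp

lemma push_in_bounded_by: "push e x \<in> bounded_by e"
proof (cases rule: seq_low_or_high[of x e])
  case 1
  then show ?thesis by (simp add: push_low bounded_by_def less_imp_le)
next
  case (2 k)
  then show ?thesis
    by (auto simp: push_high[OF 2] bounded_by_def less_Suc_eq less_imp_le)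
qed

context seq_line
begin

text \<open>Otherwise there are arbitrarily many disjoint intervals among the extensions of one
  prefix, on whose indicators the functional exceeds \<open>\<epsilon>\<close> in absolute value. A
  signed sum of \<open>N\<close> of them has norm at most 1 but value at least
  \<open>N * \<epsilon>\<close>, which contradicts boundedness.\<close>

lemma functional_almost_const:
  assumes \<phi>: "bounded_linear_on cut_C \<phi>" and e: "\<epsilon> > 0"
  shows "\<exists>b. \<forall>y z. agree k x y \<and> agree k x z \<and> b \<le> entry y k \<and> b \<le> entry z k \<longrightarrow>
     \<bar>\<phi> (ind y) - \<phi> (ind z)\<bar> \<le> (\<epsilon> :: real)"
proof (rule ccontr)
  assume "\<not> ?thesis"
  then have no: "\<exists>y z. agree k x y \<and> agree k x z \<and> b \<le> entry y k \<and> b \<le> entry z k \<and>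
      \<epsilon> < \<bar>\<phi> (ind y) - \<phi> (ind z)\<bar>" for b by (meson not_le)
  have "\<exists>y z. agree k x y \<and> agree k x z \<and> b \<le> entry y k \<and> b \<le> entry z k \<and>
      \<epsilon> < \<bar>\<phi> (ind y) - \<phi> (ind z)\<bar> \<and> y \<le> z" for b
    using no[of b] by (metis abs_minus_commute linear)
  then obtain Y Z where YZ: "\<And>b. agree k x (Y b)" "\<And>b. agree k x (Z b)" "\<And>b. b \<le> entry (Y b) k"
    "\<And>b. b \<le> entry (Z b) k" "\<And>b. \<epsilon> < \<bar>\<phi> (ind (Y b)) - \<phi> (ind (Z b))\<bar>" "\<And>b. Y b \<le> Z b"
    by metis
  \<comment> \<open>The next threshold exceeds the entry at \<open>k\<close> of the current upper
    end, so the intervals from \<open>Y\<close> to \<open>Z\<close> follow one another.\<close>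
  define b where "b = rec_nat zero1 (\<lambda>_ c. suc1 (entry (Z c) k))"
  have bS: "b (Suc n) = suc1 (entry (Z (b n)) k)" for n by (simp add: b_def)
  have "b n < b (Suc n)" for n using YZ(4)[of "b n"] by (simp add: bS)
  then have mono: "strict_mono b" by (simp add: strict_mono_Suc_iff)
  have lt: "Z (b m) \<le> Y (b n)" if "m < n" for m n
  proof -
    have "entry (Z (b m)) k < b (Suc m)" by (simp add: bS)
    also have "b (Suc m) \<le> b n" using mono that by (simp add: strict_mono_less_eq)
    also have "b n \<le> entry (Y (b n)) k" by (rule YZ(3))
    finally have "less_upto (Suc k) (Z (b m)) (Y (b n))"
      using agree_trans[OF agree_sym[OF YZ(2)] YZ(1)] unfolding less_upto_def by blast
    then show ?thesis using less_upto_imp_less by fastforce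
  qed
  obtain B where B: "\<And>f. f \<in> cut_C \<Longrightarrow> \<bar>\<phi> f\<bar> \<le> B * norm f"
    using \<phi> unfolding bounded_linear_on_def real_norm_def by blast
  obtain N :: nat where N: "max B 0 < N * \<epsilon>" using reals_Archimedean3[OF e] by blast
  define \<sigma> where "\<sigma> n = sgn (\<phi> (ind (Y (b n))) - \<phi> (ind (Z (b n))))" for n
  define f where "f = (\<Sum>n<N. \<sigma> n *\<^sub>R (ind (Y (b n)) - ind (Z (b n))))"
  have nf: "norm f \<le> 1"
    unfolding f_def
  proof (rule norm_disjoint_sum)
    show "\<bar>\<sigma> i\<bar> \<le> 1" for i by (simp add: \<sigma>_def sgn_if)
    show "Z (b i) \<le> Y (b j) \<or> Z (b j) \<le> Y (b i)" if "i \<noteq> j" for i j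
      using lt that by (meson linorder_neqE_nat)
  qed (use YZ(6) in auto)
  have in_C: "\<sigma> n *\<^sub>R (ind (Y (b n)) - ind (Z (b n))) \<in> cut_C" for n
    by (intro subspace_scale subspace_diff subspace_cfun_space) auto
  have fC: "f \<in> cut_C" unfolding f_def by (intro subspace_sum subspace_cfun_space in_C)
  have "\<phi> f = (\<Sum>n<N. \<phi> (\<sigma> n *\<^sub>R (ind (Y (b n)) - ind (Z (b n)))))"
    unfolding f_def by (rule bounded_linear_on_sum[OF subspace_cfun_space \<phi> in_C])
  also have "... = (\<Sum>n<N. \<bar>\<phi> (ind (Y (b n))) - \<phi> (ind (Z (b n)))\<bar>)"
  proof (rule sum.cong[OF refl])
    fix n
    have "\<phi> (\<sigma> n *\<^sub>R (ind (Y (b n)) - ind (Z (b n)))) = \<sigma> n * \<phi> (ind (Y (b n)) - ind (Z (b n)))"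
      using \<phi> subspace_diff[OF subspace_cfun_space, of "ind (Y (b n))" cut_top "ind (Z (b n))"]
      by (simp add: bounded_linear_on_def)
    also have "\<phi> (ind (Y (b n)) - ind (Z (b n))) = \<phi> (ind (Y (b n))) - \<phi> (ind (Z (b n)))"
      by (intro bounded_linear_on_diff[OF subspace_cfun_space \<phi>]) auto
    finally show "\<phi> (\<sigma> n *\<^sub>R (ind (Y (b n)) - ind (Z (b n)))) = \<bar>\<phi> (ind (Y (b n))) - \<phi> (ind (Z (b n)))\<bar>"
      by (simp add: \<sigma>_def abs_sgn mult.commute)
  qed
  also have "... \<ge> N * \<epsilon>"
    using sum_bounded_below[of "{..<N}" \<epsilon> "\<lambda>n. \<bar>\<phi> (ind (Y (b n))) - \<phi> (ind (Z (b n)))\<bar>"]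
      less_imp_le[OF YZ(5)] by simp
  finally have "N * \<epsilon> \<le> \<phi> f" .
  moreover have "\<phi> f \<le> max B 0 * 1"
  proof -
    have "\<phi> f \<le> B * norm f" using B[OF fC] by simp
    also have "... \<le> max B 0 * norm f" by (intro mult_right_mono) auto
    also have "... \<le> max B 0 * 1" by (intro mult_left_mono nf) auto
    finally show ?thesis .
  qed
  ultimately show False using N by simp
qed

text \<open>The thresholds for the countably many tolerances \<open>1/(n+1)\<close> have an upper
  bound in \<open>omega1\<close>.\<close>

lemma functional_eventually_const:
  fixes \<phi> :: "('b set discrete \<Rightarrow>\<^sub>C real) \<Rightarrow> real"
  assumes \<phi>: "bounded_linear_on cut_C \<phi>"
  shows "\<exists>b. \<forall>y z. agree k x y \<and> agree k x z \<and> b \<le> entry y k \<and> b \<le> entry z k \<longrightarrow>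
     \<phi> (ind y) = \<phi> (ind z)"
proof -
  have "\<exists>b. \<forall>y z. agree k x y \<and> agree k x z \<and> b \<le> entry y k \<and> b \<le> entry z k \<longrightarrow>
      \<bar>\<phi> (ind y) - \<phi> (ind z)\<bar> \<le> inverse (real (Suc n))" for n
    by (rule functional_almost_const[OF \<phi>]) simp
  then obtain b where b: "\<And>n y z. agree k x y \<Longrightarrow> agree k x z \<Longrightarrow> b n \<le> entry y k \<Longrightarrow> b n \<le> entry z k
      \<Longrightarrow> \<bar>\<phi> (ind y) - \<phi> (ind z)\<bar> \<le> inverse (real (Suc n))" by metis
  have b_le: "b n \<le> lub1 (range b)" for n by (rule lub1_upper) auto
  have "\<phi> (ind y) = \<phi> (ind z)"
    if yz: "agree k x y" "agree k x z" "lub1 (range b) \<le> entry y k" "lub1 (range b) \<le> entry z k" for y z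
  proof -
    have le: "\<bar>\<phi> (ind y) - \<phi> (ind z)\<bar> \<le> inverse (real (Suc n))" for n
      using b[OF yz(1,2), of n] b_le[of n] yz(3,4) by (meson order_trans)
    have "\<bar>\<phi> (ind y) - \<phi> (ind z)\<bar> \<le> 0"
      by (rule LIMSEQ_le_const[OF LIMSEQ_inverse_real_of_nat]) (use le in blast)
    then show ?thesis by simp
  qed
  then show ?thesis by blast
qed

lemma controlled_SCP_cut_C: "controlled_SCP cut_C"
  unfolding controlled_SCP_def
proof (intro allI impI)
  fix S T assume "countable S \<and> S \<subseteq> cut_C \<and> countable T \<and> T \<subseteq> dual_on cut_C"
  then have S: "countable S" "S \<subseteq> cut_C" and T: "countable T" "T \<subseteq> dual_on cut_C" by auto
  have "closure (span S) \<in> Sep cut_C"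
    unfolding Sep_def using S separable_closure_span[OF S(1)]
      closure_span_subset[OF subspace_cfun_space closed_cfun_space S(2)]
    by (simp add: subspace_closure)
  then obtain Y where Y: "countable Y" "closure (span S) \<subseteq> sub_C Y" by (rule Sep_subset_sub_C)
  then have SY: "S \<subseteq> sub_C Y" using closure_subset span_superset by blast
  obtain c where c: "Y \<subseteq> bounded_by c" using countable_subset_bounded_by[OF Y(1)] .
  have "\<exists>b. \<forall>y z. agree k x y \<and> agree k x z \<and> b \<le> entry y k \<and> b \<le> entry z k \<longrightarrow>
     \<phi> (ind y) = \<phi> (ind z)" if "\<phi> \<in> T" for \<phi> k x
    using functional_eventually_const T(2) that by (auto simp: dual_on_def)
  then obtain b where b: "\<And>\<phi> k x y z. \<phi> \<in> T \<Longrightarrow> agree k x y \<Longrightarrow> agree k x z \<Longrightarrow>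
      b \<phi> k x \<le> entry y k \<Longrightarrow> b \<phi> k x \<le> entry z k \<Longrightarrow> \<phi> (ind y) = \<phi> (ind z)" by metis
  \<comment> \<open>These are the thresholds for functionals in \<open>T\<close> and prefixes
    bounded by \<open>a\<close>. The set is countable, so \<open>e\<close> can be closed under its
    supremum; then no prefix kept by \<open>push e\<close> needs a threshold beyond
    \<open>e\<close>.\<close>
  define A where "A a = (\<lambda>(\<phi>, k, x). b \<phi> k x) ` (T \<times> UNIV \<times> bounded_by a)" for a
  have A: "countable (A a)" for a
    unfolding A_def using T(1) countable_bounded_by by (intro countable_image countable_SIGMA) auto
  obtain e where e: "limit1 e" "c < e" "\<And>a. a < e \<Longrightarrow> lub1 (A a) < e"
    using ex_limit1_closed_under[of c "\<lambda>a. lub1 (A a)"] by blast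
  have b_less: "b \<phi> k x < e" if "\<phi> \<in> T" "x \<in> below e" for \<phi> k x
  proof -
    obtain a where a: "a < e" "x \<in> bounded_by a" using \<open>x \<in> below e\<close> by (auto simp: below_def)
    have "b \<phi> k x \<in> A a" unfolding A_def using that a by (intro image_eqI[of _ _ "(\<phi>, k, x)"]) auto
    then show ?thesis using lub1_upper[OF A] e(3)[OF a(1)] by (meson order_le_less_trans)
  qed
  have inv: "\<phi> (ind (push e x)) = \<phi> (ind x)" if \<phi>: "\<phi> \<in> T" for \<phi> x
  proof (cases rule: seq_low_or_high[of x e])
    case 1
    then show ?thesis by (simp add: push_low)
  next
    case (2 k)
    let ?t = "trunc k (entry x)"
    have "?t \<in> below e" by (rule trunc_in_below[OF e(1) 2(1)])
    then have "b \<phi> k ?t \<le> e" using b_less[OF \<phi>] by (simp add: less_imp_le)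
    then have "b \<phi> k ?t \<le> entry (push e x) k" "b \<phi> k ?t \<le> entry x k"
      using 2 by (auto simp: push_high[OF 2])
    moreover have "agree k ?t (push e x)" "agree k ?t x" by (auto simp: push_high[OF 2] agree_def)
    ultimately show ?thesis using b[OF \<phi>] by blast
  qed
  have seg: "segment {x. push e x \<in> J}" if "segment J" for J
    unfolding segment_def using push_mono segmentD[OF that] by blast
  \<comment> \<open>The value at a cut is a single evaluation, at the inverse image of the cut under
    \<open>push e\<close>; this is why the norm is at most 1.\<close>
  define \<Lambda> where "\<Lambda> J f = val f {x. push e x \<in> J}" for J f
  define T' where "T' x = ind (push e x)" for x
  obtain P where P: "projection_on cut_C P" "P ` cut_C = sub_C (range (push e))"
    "P unit_fun = unit_fun" "\<And>x. P (ind x) = T' x"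
  proof (rule ex_projection[of \<Lambda> 1 T' "range (push e)"])
    show "\<bar>\<Lambda> I f\<bar> \<le> 1 * norm f" for I f using abs_val_le by (simp add: \<Lambda>_def)
    show "\<Lambda> I unit_fun = 1" "\<Lambda> I (ind x) = val (T' x) I" if "segment I" for I x
      using seg[OF that] that by (simp_all add: \<Lambda>_def T'_def)
    show "T' x \<in> sub_C (range (push e))" for x unfolding T'_def by (rule ind_in_sub_C) simp
    show "T' x = ind x" if "x \<in> range (push e)" for x using that by (auto simp: T'_def)
  qed (auto simp: \<Lambda>_def)
  have Pbl: "bounded_linear_on cut_C P" "P ` cut_C \<subseteq> cut_C" using P(1) by (auto simp: projection_on_def)
  have "countable (range (push e))"
    by (rule countable_subset[OF _ countable_bounded_by[of e]]) (use push_in_bounded_by in blast)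
  then have "separable_space (top_of_set (P ` cut_C))"
    unfolding P(2) using sub_C_in_Sep by (simp add: Sep_def)
  moreover have "S \<subseteq> P ` cut_C"
  proof -
    have "Y \<subseteq> range (push e)"
    proof
      fix x assume "x \<in> Y"
      then have "entry x k \<le> c" for k using c by (auto simp: bounded_by_def)
      then have "entry x k < e" for k using e(2) by (rule order_le_less_trans)
      then show "x \<in> range (push e)" using push_low[of x e] by (metis rangeI)
    qed
    then show ?thesis unfolding P(2) using SY sub_C_mono by blast
  qed
  moreover have "T \<subseteq> adjoint_on cut_C P ` dual_on cut_C"
  proof
    fix \<phi> assume \<phi>: "\<phi> \<in> T"
    then have dual: "\<phi> \<in> extensional cut_C" "bounded_linear_on cut_C \<phi>"
      using T(2) by (auto simp: dual_on_def)
    have "\<phi> (P f) = \<phi> f" if "f \<in> cut_C" for f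
    proof (rule bounded_linear_on_eq_closure_span[OF subspace_cfun_space closed_cfun_space
          bounded_linear_on_compose[OF Pbl(1) dual(2) Pbl(2)] dual(2) gens_subset_cut_C])
      show "f \<in> closure (span (gens UNIV))" using that sub_C_UNIV by (simp add: sub_C_def)
      show "\<phi> (P x) = \<phi> x" if "x \<in> gens UNIV" for x
        using that P(3,4) inv[OF \<phi>] by (auto simp: gens_def T'_def)
    qed
    \<comment> \<open>\<open>\<phi>\<close> is its own preimage under the adjoint, because its
      values on indicators do not change along \<open>push e\<close>.\<close>
    then have "\<phi> = adjoint_on cut_C P \<phi>"
      unfolding adjoint_on_def compose_def
      by (intro extensionalityI[OF dual(1) restrict_extensional]) simp
    then show "\<phi> \<in> adjoint_on cut_C P ` dual_on cut_C" using T(2) \<phi> by blast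
  qed
  ultimately show "\<exists>P. projection_on cut_C P \<and> separable_space (top_of_set (P ` cut_C)) \<and>
      S \<subseteq> P ` cut_C \<and> T \<subseteq> adjoint_on cut_C P ` dual_on cut_C"
    using P(1) by blast
qed

end

section \<open>The continuous separable complementation property\<close>

lemma subspace_UN_incseq:
  fixes F :: "nat \<Rightarrow> 'a::real_vector set"
  assumes "incseq F" "\<And>n. subspace (F n)"
  shows "subspace (\<Union>n. F n)"
  unfolding subspace_def
proof (intro conjI ballI allI)
  show "0 \<in> (\<Union>n. F n)" using subspace_0[OF assms(2)] by blast
  fix x assume "x \<in> (\<Union>n. F n)"
  then obtain m where m: "x \<in> F m" by blast
  then show "c *\<^sub>R x \<in> (\<Union>n. F n)" for c using subspace_scale[OF assms(2)] by blast
  fix y assume "y \<in> (\<Union>n. F n)"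
  then obtain n where "y \<in> F n" by blast
  then have "x \<in> F (max m n)" "y \<in> F (max m n)"
    using m incseqD[OF assms(1)] by (meson max.cobounded1 max.cobounded2 subsetD)+
  then show "x + y \<in> (\<Union>n. F n)" using subspace_add[OF assms(2)] by blast
qed

text \<open>Take chain members containing the terms of a dense sequence of \<open>S\<close>. Their
  running maxima increase, and the chain contains the closure of the union, hence a member above
  \<open>S\<close>. Spans add nothing, since an increasing union of subspaces is a subspace. The
  statement about chains thus follows from the one about closed cofinal families.\<close>

lemma closed_cofinal_continuous_chain:
  fixes E :: "'a::real_normed_vector set"
  assumes chain: "continuous_chain E \<F>" and E: "E = \<Union>\<F>"
  shows "closed_cofinal E \<F>"
proof -
  have sub: "subspace F" "closed F" if "F \<in> \<F>" for F
    using that chain by (auto simp: continuous_chain_def Sep_def)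
  have sup: "closure (\<Union>n. F n) \<in> \<F>" if "range F \<subseteq> \<F>" "incseq F" for F :: "nat \<Rightarrow> 'a set"
    using chain that by (simp add: continuous_chain_def)
  have cofinal: "\<exists>F\<in>\<F>. S \<subseteq> F" if S: "S \<in> Sep E" for S
  proof -
    have "S \<subseteq> E" "subspace S" "separable_space (top_of_set S)" using S by (auto simp: Sep_def)
    then obtain D where D: "countable D" "D \<subseteq> S" "(top_of_set S) closure_of D = S"
      unfolding separable_space_def by auto
    have S_D: "S \<subseteq> closure D" using D by (auto simp: closure_of_subtopology inf.absorb2)
    have "D \<noteq> {}" using S_D subspace_0[OF \<open>subspace S\<close>] by auto
    then obtain e :: "nat \<Rightarrow> 'a" where e: "range e = D" using D(1) by (metis range_from_nat_into)
    have "\<exists>F\<in>\<F>. e n \<in> F" for n using e D(2) \<open>S \<subseteq> E\<close> E by blast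
    then obtain F where F: "\<And>n. F n \<in> \<F>" "\<And>n. e n \<in> F n" by metis
    define G where "G = rec_nat (F 0) (\<lambda>n G. if G \<subseteq> F (Suc n) then F (Suc n) else G)"
    have G_simps: "G 0 = F 0" "G (Suc n) = (if G n \<subseteq> F (Suc n) then F (Suc n) else G n)" for n
      by (simp_all add: G_def)
    have GF: "G n \<in> \<F>" for n by (induction n) (auto simp: G_simps F(1))
    have inc: "incseq G" by (intro incseq_SucI) (auto simp: G_simps)
    have F_le_G: "F n \<subseteq> G n" for n
    proof (cases n)
      case (Suc m)
      have "G m \<subseteq> F n \<or> F n \<subseteq> G m"
        using chain GF[of m] F(1)[of n] unfolding continuous_chain_def by blast
      then show ?thesis unfolding Suc G_simps by auto
    qed (simp add: G_simps)
    have "D \<subseteq> (\<Union>n. G n)" using e F(2) F_le_G by blast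
    then have "S \<subseteq> closure (\<Union>n. G n)" using S_D closure_mono by blast
    moreover have "range G \<subseteq> \<F>" using GF by auto
    ultimately show ?thesis using sup[OF _ inc] by blast
  qed
  have "closure (span (\<Union>n. F n)) \<in> \<F>" if F: "range F \<subseteq> \<F>" "incseq F" for F :: "nat \<Rightarrow> 'a set"
  proof -
    have "subspace (F n)" for n using sub(1) F(1) by blast
    then have "span (\<Union>n. F n) = (\<Union>n. F n)"
      unfolding span_eq_iff by (rule subspace_UN_incseq[OF F(2)])
    then show ?thesis by (rule ssubst) (rule sup[OF F])
  qed
  then show ?thesis
    unfolding closed_cofinal_def using chain cofinal by (simp add: continuous_chain_def)
qed

lemma below_lub1:
  assumes "countable D"
  shows "below (lub1 D) = (\<Union>d\<in>D. below d)"
proof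
  show "below (lub1 D) \<subseteq> (\<Union>d\<in>D. below d)"
    using less_lub1 by (fastforce simp: below_def)
  show "(\<Union>d\<in>D. below d) \<subseteq> below (lub1 D)"
    using lub1_upper[OF assms] order_less_le_trans by (fastforce simp: below_def)
qed

lemma limit1_lub1:
  assumes "countable D" "D \<noteq> {}" "\<And>d. d \<in> D \<Longrightarrow> limit1 d"
  shows "limit1 (lub1 D)"
  unfolding limit1_def
proof (intro conjI allI impI)
  obtain d where "d \<in> D" using assms(2) by blast
  then show "zero1 < lub1 D"
    using assms(3) lub1_upper[OF assms(1)] unfolding limit1_def by (meson order_less_le_trans)
  fix a assume "a < lub1 D"
  then obtain d where "d \<in> D" "a < d" using less_lub1 by blast
  then show "suc1 a < lub1 D"
    using assms(3) lub1_upper[OF assms(1)] unfolding limit1_def by (meson order_less_le_trans)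
qed

context seq_line
begin

lemma continuous_SCP_cut_C: "continuous_SCP cut_C"
proof -
  define \<F> where "\<F> = {sub_C (below d) | d. limit1 d}"
  have "closed_cofinal cut_C \<F>"
    unfolding closed_cofinal_def
  proof (intro conjI ballI allI impI)
    show "\<F> \<subseteq> Sep cut_C" using sub_C_in_Sep[OF countable_below] by (auto simp: \<F>_def)
    show "\<exists>F\<in>\<F>. S \<subseteq> F" if "S \<in> Sep cut_C" for S
    proof -
      obtain Y where Y: "countable Y" "S \<subseteq> sub_C Y" using Sep_subset_sub_C[OF \<open>S \<in> Sep cut_C\<close>] .
      obtain c where c: "Y \<subseteq> bounded_by c" using countable_subset_bounded_by[OF Y(1)] .
      obtain d where d: "limit1 d" "c < d" using ex_limit1_closed_under[of c "\<lambda>c. c"] by blast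
      have "Y \<subseteq> below d" using c d(2) by (auto simp: below_def)
      then have "S \<subseteq> sub_C (below d)" using Y(2) sub_C_mono by blast
      then show ?thesis using d(1) by (auto simp: \<F>_def)
    qed
    fix F :: "nat \<Rightarrow> _" assume "range F \<subseteq> \<F> \<and> incseq F"
    then have "\<exists>d. limit1 d \<and> F n = sub_C (below d)" for n by (auto simp: \<F>_def)
    \<comment> \<open>The chosen ordinals \<open>d n\<close> may fail to increase; by
      \<open>below_lub1\<close> the union is still \<open>below\<close> of their supremum.\<close>
    then obtain d where d: "\<And>n. limit1 (d n)" "\<And>n. F n = sub_C (below (d n))" by metis
    have "closure (span (\<Union>n. F n)) = sub_C (\<Union>n. below (d n))"
      by (rule sub_C_UN[OF d(2)]) simp
    also have "(\<Union>n. below (d n)) = below (lub1 (range d))" using below_lub1[of "range d"] by simp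
    finally show "closure (span (\<Union>n. F n)) \<in> \<F>"
      using limit1_lub1[of "range d"] d(1) by (auto simp: \<F>_def)
  qed
  moreover have "\<forall>F\<in>\<F>. complemented_in cut_C F" using complemented_below by (auto simp: \<F>_def)
  ultimately show ?thesis unfolding continuous_SCP_def by blast
qed

text \<open>Members of the family and the subspaces of sets \<open>bounded_by c\<close> can be
  interleaved along an increasing sequence, so the supremum is at once in the family and equal to
  some \<open>sub_C (below d)\<close>.\<close>

lemma club_closed_cofinal:
  assumes \<F>: "closed_cofinal cut_C \<F>"
  shows "club {d. limit1 d \<and> sub_C (below d) \<in> \<F>}"
proof -
  have Sep: "\<And>F. F \<in> \<F> \<Longrightarrow> F \<in> Sep cut_C" and cofinal: "\<And>S. S \<in> Sep cut_C \<Longrightarrow> \<exists>F\<in>\<F>. S \<subseteq> F"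
    and sup: "\<And>F :: nat \<Rightarrow> _. range F \<subseteq> \<F> \<Longrightarrow> incseq F \<Longrightarrow> closure (span (\<Union>n. F n)) \<in> \<F>"
    using \<F> unfolding closed_cofinal_def by auto
  have unbounded: "\<exists>d. limit1 d \<and> sub_C (below d) \<in> \<F> \<and> a < d" for a
  proof -
    have "\<exists>F. F \<in> \<F> \<and> sub_C (bounded_by c) \<subseteq> F" for c
      using cofinal[OF sub_C_in_Sep[OF countable_bounded_by]] by blast
    then obtain U where U: "\<And>c. U c \<in> \<F>" "\<And>c. sub_C (bounded_by c) \<subseteq> U c" by metis
    have "\<exists>c'. c < c' \<and> U c \<subseteq> sub_C (bounded_by c')" for c
    proof -
      obtain Y where Y: "countable Y" "U c \<subseteq> sub_C Y" using Sep_subset_sub_C[OF Sep[OF U(1)]] .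
      obtain c' where c': "Y \<subseteq> bounded_by c'" using countable_subset_bounded_by[OF Y(1)] .
      \<comment> \<open>The term \<open>suc1 c\<close> makes the ordinals grow strictly, so that
        their supremum is a limit ordinal.\<close>
      have "c < max (suc1 c) c'" by (simp add: less_max_iff_disj)
      moreover have "Y \<subseteq> bounded_by (max (suc1 c) c')"
        using c' by (auto simp: bounded_by_def le_max_iff_disj)
      ultimately show ?thesis using Y(2) sub_C_mono by blast
    qed
    then obtain nx where nx: "\<And>c. c < nx c" "\<And>c. U c \<subseteq> sub_C (bounded_by (nx c))" by metis
    define c where "c n = (nx ^^ n) a" for n
    have cS: "c (Suc n) = nx (c n)" for n by (simp add: c_def)
    have "c n < c (Suc n)" for n using nx(1) by (simp add: cS)
    note lim = limit1_lub1_strict_mono[of c, OF this]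
    let ?d = "lub1 (range c)"
    have inc: "incseq (\<lambda>n. U (c n))"
      by (rule incseq_SucI) (use nx(2) U(2) in \<open>auto simp: cS\<close>)
    have "sub_C (below ?d) \<subseteq> closure (span (\<Union>n. U (c n)))"
    proof -
      have "below ?d \<subseteq> (\<Union>n. bounded_by (c n))"
      proof
        fix x assume "x \<in> below ?d"
        then obtain b where b: "b < ?d" "x \<in> bounded_by b" by (auto simp: below_def)
        then obtain n where "b < c n" using less_lub1 by blast
        then have "x \<in> bounded_by (c n)"
          using b(2) by (auto simp: bounded_by_def intro: order_trans less_imp_le)
        then show "x \<in> (\<Union>n. bounded_by (c n))" by blast
      qed
      then have "sub_C (below ?d) \<subseteq> sub_C (\<Union>n. bounded_by (c n))" by (rule sub_C_mono)
      also have "... = closure (span (\<Union>n. sub_C (bounded_by (c n))))"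
        by (rule sub_C_UN[OF refl, symmetric]) simp
      also have "... \<subseteq> closure (span (\<Union>n. U (c n)))"
        using U(2) by (intro closure_mono span_mono UN_mono) auto
      finally show ?thesis .
    qed
    moreover have "closure (span (\<Union>n. U (c n))) \<subseteq> sub_C (below ?d)"
    proof (rule closure_span_subset[OF subspace_sub_C closed_sub_C])
      have "U (c n) \<subseteq> sub_C (below ?d)" for n
      proof -
        have "bounded_by (c (Suc n)) \<subseteq> below ?d" using lim(2)[of "Suc n"] by (auto simp: below_def)
        then show ?thesis using nx(2)[of "c n"] sub_C_mono unfolding cS[symmetric] by blast
      qed
      then show "(\<Union>n. U (c n)) \<subseteq> sub_C (below ?d)" by blast
    qed
    ultimately have "sub_C (below ?d) = closure (span (\<Union>n. U (c n)))" by (rule subset_antisym)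
    also have "... \<in> \<F>" by (rule sup[OF _ inc]) (use U(1) in auto)
    finally show ?thesis using lim(1) lim(2)[of 0] by (auto simp: c_def)
  qed
  have closed: "sub_C (below d) \<in> \<F>"
    if d: "limit1 d" "\<And>a. a < d \<Longrightarrow> \<exists>c\<in>{d. limit1 d \<and> sub_C (below d) \<in> \<F>}. a < c \<and> c < d" for d
  proof -
    obtain f where f: "\<And>n. f n \<in> {d. limit1 d \<and> sub_C (below d) \<in> \<F>}" "\<And>n. f n < f (Suc n)"
      "\<And>n. f n < d" "\<And>a. a < d \<Longrightarrow> \<exists>n. a < f n"
      using limit1_cofinal_sequence[OF d] by blast
    have "below (f n) \<subseteq> below (f (Suc n))" for n
      using f(2)[of n] by (auto simp: below_def intro: order_less_trans)
    then have "incseq (\<lambda>n. sub_C (below (f n)))" by (intro incseq_SucI sub_C_mono)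
    then have "closure (span (\<Union>n. sub_C (below (f n)))) \<in> \<F>" using f(1) by (intro sup) auto
    also have "closure (span (\<Union>n. sub_C (below (f n)))) = sub_C (\<Union>n. below (f n))"
      by (rule sub_C_UN[OF refl]) simp
    also have "(\<Union>n. below (f n)) = below d"
    proof (intro equalityI subsetI)
      fix x assume "x \<in> below d"
      then obtain a where a: "a < d" "x \<in> bounded_by a" by (auto simp: below_def)
      then obtain n where "a < f n" using f(4) by blast
      then show "x \<in> (\<Union>n. below (f n))" using a(2) by (auto simp: below_def)
    qed (use f(3) in \<open>auto simp: below_def intro: order_less_trans\<close>)
    finally show ?thesis .
  qed
  show ?thesis unfolding club_def using unbounded closed by blast
qed

text \<open>A stationary rank class meets the club of stages in the family. For rank
  \<open>3 * (1 + n)\<close> the lower bound \<open>(rk d + 1) / 3 - 1\<close> equals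
  \<open>n + 1/3\<close>, which exceeds \<open>n\<close>.\<close>

lemma closed_cofinal_not_k_complemented:
  assumes "closed_cofinal cut_C \<F>"
  shows "\<exists>F\<in>\<F>. \<not> k_complemented_in (real n) cut_C F"
proof -
  have "{d. rk d = 3 * (1 + n)} \<inter> {d. limit1 d \<and> sub_C (below d) \<in> \<F>} \<noteq> {}"
    using stationary_rk club_closed_cofinal[OF assms] unfolding stationary_def by blast
  then obtain d where "rk d = 3 * (1 + n)" "limit1 d" "sub_C (below d) \<in> \<F>" by blast
  then show ?thesis using not_k_complemented_below[of d "real n"] by (intro bexI) auto
qed

end

theorem theorem3p12:
  shows "\<exists>(K :: nat set set set) (r :: nat set set rel).
    compact_line K r \<and>
    has_weight (order_topology_on K r) (cardSuc natLeq) \<and>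
    (let C = cfun_space (order_topology_on K r) in
      (continuous_SCP C \<and> controlled_SCP C) \<and>
      (\<forall>n::nat. \<not> continuous_k_SCP (real n) C) \<and>
      (\<forall>\<F>. continuous_chain C \<F> \<and> C = \<Union>\<F> \<longrightarrow>
        (\<exists>X :: nat \<Rightarrow> (nat set set discrete \<Rightarrow>\<^sub>C real) set.
          \<forall>n. X n \<in> \<F> \<and> \<not> k_complemented_in (real n) C (X n))))"
proof -
  obtain g :: "seq \<Rightarrow> nat set" where g: "inj g" using ex_inj_seq by blast
  interpret seq_line g by standard (rule g)
  have "has_weight cut_top (cardSuc natLeq :: nat set rel)"
  proof (rule has_weight_cut_top[OF card_of_seq card_of_finite_seq_sets])
    have "inj (\<lambda>a. trunc 1 (\<lambda>_. a))" by (rule injI) (metis entry_trunc zero_less_one)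
    then show "infinite (UNIV :: seq set)"
      using uncountable_omega1 finite_imageD[of "\<lambda>a. trunc 1 (\<lambda>_. a)" UNIV]
      by (meson countable_finite finite_subset subset_UNIV)
  qed
  moreover have "\<not> continuous_k_SCP (real n) cut_C" for n
    unfolding continuous_k_SCP_def using closed_cofinal_not_k_complemented by blast
  moreover have "\<exists>X. \<forall>n. X n \<in> \<F> \<and> \<not> k_complemented_in (real n) cut_C (X n)"
    if "continuous_chain cut_C \<F>" "cut_C = \<Union>\<F>" for \<F>
    using closed_cofinal_not_k_complemented[OF closed_cofinal_continuous_chain[OF that]]
    by (intro choice) blast
  ultimately show ?thesis
    using compact_line_cuts continuous_SCP_cut_C controlled_SCP_cut_C
    unfolding Let_def by (intro exI[of _ cuts] exI[of _ cut_rel]) blast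
qed

end
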